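(* Let $X$ be an oriented Riemannian four-manifold. 1. If the metric has positive sectional curvatures which are pointwise $2/5$-pinched, then the Levi-Civita connection induces positive definite connections on both $\Lambda^+$ and $\Lambda^-$. 2. If the metric has negative sectional curvatures which are pointwise $2/5$-pinched, then the Levi-Civita connection induces negative definite connections on both $\Lambda^+$ and $\Lambda^-$. Moreover, in each case $2/5$ is the optimal pinching constant for which this result remains true (i.e. for no $K<2/5$ does the statement remain true with $2/5$ replaced by $K$).
   Context: A metric whose sectional curvatures all have the same sign is pointwise $K$-pinched if at every point $p$ one has $\min_p|\sec|/\max_p|\sec|>K$, the minimum and maximum being over all 2-planes in $T_pX$. $\Lambda^\pm$ are the bundles of self-dual and anti-self-dual 2-forms, with their Levi-Civita $SO(3)$-connections. A metric connection on an $SO(3)$-bundle $E\to X^4$, with curvature $F\colon so(E)^*\to\Lambda^2T^*X$, is definite if at each point the image of $F$ is a maximal definite (3-dimensional definite) subspace for the wedge product $\Lambda^2\times\Lambda^2\to\Lambda^4$; equivalently, the curvature on every two-plane in $TX$ is non-zero. A definite connection induces the orientation on $X$ for which the wedge product is positive definite on the image of $F$, and the conformal structure for which the image of $F$ is the bundle of self-dual forms. $so(3)$ is canonically oriented (by bases with $[\epsilon_1,\epsilon_2]=\epsilon_3$ and cyclic permutations), so $so(E)^*$ is oriented; the bundle of self-dual forms of a given orientation and conformal structure is oriented as an $so(3)$ summand of $\Lambda^2\cong so(TX)=so(3)\oplus so(3)$. The definite connection is positive if $F$ is orientation preserving from $so(E)^*$ onto its image and negative if orientation reversing; sign conventions are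 such that the Levi-Civita connection on $\Lambda^+$ of the round $S^4$ is positive. *)

theory Defs
  imports "HOL-Analysis.Analysis"
begin

fun times_differentiable_on ::
  "nat \<Rightarrow> 'a::real_normed_vector set \<Rightarrow> ('a \<Rightarrow> 'b::real_normed_vector) \<Rightarrow> bool" where
  "times_differentiable_on 0 S f \<longleftrightarrow> continuous_on S f"
| "times_differentiable_on (Suc n) S f \<longleftrightarrow>
     (\<forall>x\<in>S. f differentiable (at x)) \<and>
     (\<forall>v. times_differentiable_on n S (\<lambda>x. frechet_derivative f (at x) v))"

text \<open>Only used for open \<open>S\<close>.\<close>

definition smooth_on ::
  "'a::real_normed_vector set \<Rightarrow> ('a \<Rightarrow> 'b::real_normed_vector) \<Rightarrow> bool" where
  "smooth_on S f \<longleftrightarrow> (\<forall>n. times_differentiable_on n S f)"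

definition pd :: "4 \<Rightarrow> (real^4 \<Rightarrow> 'b::real_normed_vector) \<Rightarrow> real^4 \<Rightarrow> 'b" where
  "pd i f x = frechet_derivative f (at x) (axis i 1)"

definition jacobian :: "(real^4 \<Rightarrow> real^4) \<Rightarrow> real^4 \<Rightarrow> real^4^4" where
  "jacobian f x = matrix (frechet_derivative f (at x))"


section \<open>Oriented Riemannian four-manifolds\<close>

text \<open>
  A chart \<open>(U, \<phi>)\<close> is an open set of the manifold with a homeomorphism onto an open subset of
  \<open>\<real>\<^sup>4\<close>. Tensor fields are given by their components in the charts of the atlas:
  \<open>metric_of X c x\<close> is the Gram matrix of the metric at the point with coordinates \<open>x\<close> in the
  chart \<open>c\<close>.  The orientation is the one for which all charts of the atlas are positively oriented.
\<close>

type_synonym 'a chart = "'a set \<times> ('a \<Rightarrow> real^4)"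

record 'a riemannian_data =
  mtopology :: "'a topology"
  atlas :: "'a chart set"
  metric_of :: "'a chart \<Rightarrow> real^4 \<Rightarrow> real^4^4"

definition chart_image :: "'a chart \<Rightarrow> (real^4) set" where
  "chart_image c = snd c ` fst c"

definition is_chart :: "'a topology \<Rightarrow> 'a chart \<Rightarrow> bool" where
  "is_chart T c \<longleftrightarrow> openin T (fst c) \<and> open (chart_image c) \<and>
     homeomorphic_map (subtopology T (fst c)) (top_of_set (chart_image c)) (snd c)"

definition overlap :: "'a chart \<Rightarrow> 'a chart \<Rightarrow> (real^4) set" where
  "overlap c d = snd c ` (fst c \<inter> fst d)"

definition transition :: "'a chart \<Rightarrow> 'a chart \<Rightarrow> real^4 \<Rightarrow> real^4" where
  "transition c d = snd d \<circ> inv_into (fst c) (snd c)"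

definition oriented_smooth_atlas :: "'a topology \<Rightarrow> 'a chart set \<Rightarrow> bool" where
  "oriented_smooth_atlas T C \<longleftrightarrow>
     (\<forall>c\<in>C. is_chart T c) \<and> (\<Union>c\<in>C. fst c) = topspace T \<and>
     (\<forall>c\<in>C. \<forall>d\<in>C. smooth_on (overlap c d) (transition c d) \<and>
        (\<forall>x\<in>overlap c d. det (jacobian (transition c d) x) > 0))"

definition pos_def_matrix :: "real^'n^'n \<Rightarrow> bool" where
  "pos_def_matrix h \<longleftrightarrow> transpose h = h \<and> (\<forall>v. v \<noteq> 0 \<longrightarrow> v \<bullet> (h *v v) > 0)"

definition oriented_riemannian_4manifold :: "'a riemannian_data \<Rightarrow> bool" where
  "oriented_riemannian_4manifold X \<longleftrightarrow>
     Hausdorff_space (mtopology X) \<and> second_countable (mtopology X) \<and>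
     oriented_smooth_atlas (mtopology X) (atlas X) \<and>
     (\<forall>c\<in>atlas X. smooth_on (chart_image c) (metric_of X c) \<and>
        (\<forall>x\<in>chart_image c. pos_def_matrix (metric_of X c x))) \<and>
     (\<forall>c\<in>atlas X. \<forall>d\<in>atlas X. \<forall>x\<in>overlap c d.
        metric_of X c x =
          transpose (jacobian (transition c d) x) ** metric_of X d (transition c d x)
            ** jacobian (transition c d) x)"


section \<open>Connections and curvature in a local frame\<close>

text \<open>
  A connection on a bundle trivialised by a local frame is given by matrices \<open>A i\<close>, where
  \<open>\<nabla>\<^sub>i s = \<partial>\<^sub>i s + A i s\<close> on the components \<open>s\<close> of a section.  The sign of the curvature is that of
  \<open>F\<^sub>i\<^sub>j = \<nabla>\<^sub>i \<nabla>\<^sub>j - \<nabla>\<^sub>j \<nabla>\<^sub>i\<close>.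
\<close>

definition bracket :: "real^'n^'n \<Rightarrow> real^'n^'n \<Rightarrow> real^'n^'n" where
  "bracket a b = a ** b - b ** a"

definition curvature :: "(4 \<Rightarrow> real^4 \<Rightarrow> real^'n^'n) \<Rightarrow> real^4 \<Rightarrow> 4 \<Rightarrow> 4 \<Rightarrow> real^'n^'n" where
  "curvature A x i j = pd i (A j) x - pd j (A i) x + bracket (A i x) (A j x)"

text \<open>The Christoffel symbol \<open>\<Gamma>\<^sup>l\<^sub>i\<^sub>k\<close> is the entry \<open>(l, k)\<close> of \<open>levi_civita g i\<close>.\<close>

definition levi_civita :: "(real^4 \<Rightarrow> real^4^4) \<Rightarrow> 4 \<Rightarrow> real^4 \<Rightarrow> real^4^4" where
  "levi_civita g i x = (\<chi> l k. (\<Sum>m\<in>UNIV. matrix_inv (g x) $ l $ m *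
      (pd i (\<lambda>y. g y $ k $ m) x + pd k (\<lambda>y. g y $ i $ m) x - pd m (\<lambda>y. g y $ i $ k) x)) / 2)"

definition riemann :: "(real^4 \<Rightarrow> real^4^4) \<Rightarrow> real^4 \<Rightarrow> real^4 \<Rightarrow> real^4 \<Rightarrow> real^4 \<Rightarrow> real^4" where
  "riemann g x u v w =
     (\<Sum>i\<in>UNIV. \<Sum>j\<in>UNIV. (u $ i * v $ j) *\<^sub>R (curvature (levi_civita g) x i j *v w))"

definition sectional :: "(real^4 \<Rightarrow> real^4^4) \<Rightarrow> real^4 \<Rightarrow> real^4 \<Rightarrow> real^4 \<Rightarrow> real" where
  "sectional g x u v = (let ip = (\<lambda>a b. a \<bullet> (g x *v b)) in
     ip (riemann g x u v v) u / (ip u u * ip v v - (ip u v)\<^sup>2))"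

definition sectional_curvatures :: "(real^4 \<Rightarrow> real^4^4) \<Rightarrow> real^4 \<Rightarrow> real set" where
  "sectional_curvatures g x = {sectional g x u v |u v. u \<noteq> v \<and> independent {u, v}}"

definition positive_sectional :: "'a riemannian_data \<Rightarrow> bool" where
  "positive_sectional X \<longleftrightarrow> (\<forall>c\<in>atlas X. \<forall>x\<in>chart_image c.
     \<forall>k\<in>sectional_curvatures (metric_of X c) x. k > 0)"

definition negative_sectional :: "'a riemannian_data \<Rightarrow> bool" where
  "negative_sectional X \<longleftrightarrow> (\<forall>c\<in>atlas X. \<forall>x\<in>chart_image c.
     \<forall>k\<in>sectional_curvatures (metric_of X c) x. k < 0)"

text \<open>The infimum and supremum are attained, since the Grassmannian of 2-planes is compact.\<close>

definition pointwise_pinched :: "real \<Rightarrow> 'a riemannian_data \<Rightarrow> bool" where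
  "pointwise_pinched K X \<longleftrightarrow> (\<forall>c\<in>atlas X. \<forall>x\<in>chart_image c.
     let S = abs ` sectional_curvatures (metric_of X c) x in Inf S / Sup S > K)"


section \<open>Two-forms\<close>

text \<open>A 2-form \<open>\<omega>\<close> at a point is the skew matrix of its components \<open>\<omega>(\<partial>\<^sub>i, \<partial>\<^sub>j)\<close>.\<close>

definition two_form :: "real^4^4 \<Rightarrow> bool" where
  "two_form \<omega> \<longleftrightarrow> transpose \<omega> = - \<omega>"

text \<open>The coefficient of \<open>dx\<^sub>1 \<and> dx\<^sub>2 \<and> dx\<^sub>3 \<and> dx\<^sub>4\<close> in \<open>\<alpha> \<and> \<beta>\<close>.\<close>

definition wedge :: "real^4^4 \<Rightarrow> real^4^4 \<Rightarrow> real" where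
  "wedge \<alpha> \<beta> =
      \<alpha>$1$2 * \<beta>$3$4 - \<alpha>$1$3 * \<beta>$2$4 + \<alpha>$1$4 * \<beta>$2$3
    + \<alpha>$2$3 * \<beta>$1$4 - \<alpha>$2$4 * \<beta>$1$3 + \<alpha>$3$4 * \<beta>$1$2"

text \<open>Normalised such that \<open>dx\<^sub>i \<and> dx\<^sub>j\<close>, \<open>i < j\<close>, are orthonormal for \<open>h = mat 1\<close>.\<close>

definition form_inner :: "real^4^4 \<Rightarrow> real^4^4 \<Rightarrow> real^4^4 \<Rightarrow> real" where
  "form_inner h \<alpha> \<beta> = (\<Sum>i\<in>UNIV. \<Sum>j\<in>UNIV. \<Sum>k\<in>UNIV. \<Sum>l\<in>UNIV.
     matrix_inv h $ i $ k * matrix_inv h $ j $ l * \<alpha>$i$j * \<beta>$k$l) / 2"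

text \<open>
  The Hodge star of the metric \<open>h\<close> is defined by \<open>\<alpha> \<and> *\<omega> = \<langle>\<alpha>, \<omega>\<rangle> vol\<close> for all \<open>\<alpha>\<close>.  The sign
  \<open>\<sigma> = 1\<close> is the orientation of \<open>\<real>\<^sup>4\<close> (the given one of the manifold in a chart) and \<open>\<sigma> = -1\<close> the
  opposite one.  So at a point with metric \<open>h\<close>, the fibres of \<open>\<Lambda>\<^sup>+\<close> and \<open>\<Lambda>\<^sup>-\<close> are
  \<open>self_dual_forms h 1\<close> and \<open>self_dual_forms h (-1)\<close>.
\<close>

definition is_hodge_star :: "real^4^4 \<Rightarrow> real \<Rightarrow> real^4^4 \<Rightarrow> real^4^4 \<Rightarrow> bool" where
  "is_hodge_star h \<sigma> \<omega> \<eta> \<longleftrightarrow> two_form \<eta> \<and>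
     (\<forall>\<alpha>. two_form \<alpha> \<longrightarrow> wedge \<alpha> \<eta> = form_inner h \<alpha> \<omega> * (\<sigma> * sqrt (det h)))"

definition self_dual_forms :: "real^4^4 \<Rightarrow> real \<Rightarrow> (real^4^4) set" where
  "self_dual_forms h \<sigma> = {\<omega>. two_form \<omega> \<and> is_hodge_star h \<sigma> \<omega> \<omega>}"

text \<open>\<open>(\<nabla>\<^sub>k \<omega>)\<^sub>i\<^sub>j = \<partial>\<^sub>k \<omega>\<^sub>i\<^sub>j - \<Gamma>\<^sup>l\<^sub>k\<^sub>i \<omega>\<^sub>l\<^sub>j - \<Gamma>\<^sup>l\<^sub>k\<^sub>j \<omega>\<^sub>i\<^sub>l\<close>\<close>

definition nabla_form ::
  "(real^4 \<Rightarrow> real^4^4) \<Rightarrow> 4 \<Rightarrow> (real^4 \<Rightarrow> real^4^4) \<Rightarrow> real^4 \<Rightarrow> real^4^4" where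
  "nabla_form g k \<omega> x =
     pd k \<omega> x - transpose (levi_civita g k x) ** \<omega> x - \<omega> x ** levi_civita g k x"


section \<open>Definite connections\<close>

text \<open>A metric connection on an \<open>SO(3)\<close>-bundle over \<open>V\<close>, in an orthonormal frame.\<close>

definition so3_connection_on :: "(real^4) set \<Rightarrow> (4 \<Rightarrow> real^4 \<Rightarrow> real^3^3) \<Rightarrow> bool" where
  "so3_connection_on V A \<longleftrightarrow>
     (\<forall>i. smooth_on V (A i) \<and> (\<forall>y\<in>V. transpose (A i y) = - A i y))"

text \<open>
  The curvature at \<open>x\<close> as a map \<open>so(E)\<^sup>* \<rightarrow> \<Lambda>\<^sup>2\<close>; an element of \<open>so(3)\<^sup>*\<close> is represented by a linear
  functional on all matrices, of which only the restriction to skew matrices matters.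
\<close>

definition curvature_map ::
  "(4 \<Rightarrow> real^4 \<Rightarrow> real^3^3) \<Rightarrow> real^4 \<Rightarrow> (real^3^3 \<Rightarrow> real) \<Rightarrow> real^4^4" where
  "curvature_map A x \<xi> = (\<chi> i j. \<xi> (curvature A x i j))"

definition curvature_image :: "(4 \<Rightarrow> real^4 \<Rightarrow> real^3^3) \<Rightarrow> real^4 \<Rightarrow> (real^4^4) set" where
  "curvature_image A x = {curvature_map A x \<xi> |\<xi>. linear \<xi>}"

definition definite_at :: "(4 \<Rightarrow> real^4 \<Rightarrow> real^3^3) \<Rightarrow> real^4 \<Rightarrow> bool" where
  "definite_at A x \<longleftrightarrow> dim (curvature_image A x) = 3 \<and>
     ((\<forall>\<omega>\<in>curvature_image A x. \<omega> \<noteq> 0 \<longrightarrow> wedge \<omega> \<omega> > 0) \<or>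
      (\<forall>\<omega>\<in>curvature_image A x. \<omega> \<noteq> 0 \<longrightarrow> wedge \<omega> \<omega> < 0))"

text \<open>
  The orientation \<open>\<sigma>\<close> (relative to the coordinates) and conformal structure \<open>[h]\<close> induced by a
  definite connection.
\<close>

definition induces_structure ::
  "(4 \<Rightarrow> real^4 \<Rightarrow> real^3^3) \<Rightarrow> real^4 \<Rightarrow> real \<Rightarrow> real^4^4 \<Rightarrow> bool" where
  "induces_structure A x \<sigma> h \<longleftrightarrow> \<sigma> \<in> {1, -1} \<and> pos_def_matrix h \<and>
     (\<forall>\<omega>\<in>curvature_image A x. \<omega> \<noteq> 0 \<longrightarrow> \<sigma> * wedge \<omega> \<omega> > 0) \<and>
     curvature_image A x = self_dual_forms h \<sigma>"

definition so3_basis :: "(3 \<Rightarrow> real^'n^'n) \<Rightarrow> bool" where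
  "so3_basis \<epsilon> \<longleftrightarrow> inj \<epsilon> \<and> independent (range \<epsilon>) \<and>
     bracket (\<epsilon> 1) (\<epsilon> 2) = \<epsilon> 3 \<and> bracket (\<epsilon> 2) (\<epsilon> 3) = \<epsilon> 1 \<and> bracket (\<epsilon> 3) (\<epsilon> 1) = \<epsilon> 2"

definition so3_dual_basis :: "(3 \<Rightarrow> real^3^3 \<Rightarrow> real) \<Rightarrow> bool" where
  "so3_dual_basis \<xi> \<longleftrightarrow> (\<forall>i. linear (\<xi> i)) \<and>
     (\<exists>\<epsilon>. so3_basis \<epsilon> \<and> (\<forall>i. transpose (\<epsilon> i) = - \<epsilon> i) \<and>
        (\<forall>i j. \<xi> i (\<epsilon> j) = (if i = j then 1 else 0)))"

text \<open>
  The identification \<open>\<Lambda>\<^sup>2 \<cong> so(TX)\<close> is \<open>\<omega> \<mapsto> J\<close> with \<open>\<omega>(u, v) = h(u, J v)\<close>.  The opposite sign would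
  reverse the orientation of \<open>\<Lambda>\<^sup>+\<close>; this is the choice for which the Levi-Civita connection on
  \<open>\<Lambda>\<^sup>+\<close> of the round \<open>S\<^sup>4\<close> is positive.  Indeed, in an oriented orthonormal coframe at a point put
  \<open>\<omega>\<^sub>1 = e\<^sub>1\<^sub>2 + e\<^sub>3\<^sub>4\<close>, \<open>\<omega>\<^sub>2 = e\<^sub>1\<^sub>3 - e\<^sub>2\<^sub>4\<close>, \<open>\<omega>\<^sub>3 = e\<^sub>1\<^sub>4 + e\<^sub>2\<^sub>3\<close>, with endomorphisms \<open>J\<^sub>i\<close>.  Then
  \<open>[J\<^sub>1, J\<^sub>2] = -2 J\<^sub>3\<close> and cyclically, so the forms \<open>-\<omega>\<^sub>i / 2\<close> are an oriented basis of \<open>\<Lambda>\<^sup>+\<close> and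
  \<open>\<epsilon>\<^sub>i = -ad J\<^sub>i / 2\<close> is an oriented basis of \<open>so(\<Lambda>\<^sup>+)\<close>.  The round metric has
  \<open>R(u, v) w = \<langle>v, w\<rangle> u - \<langle>u, w\<rangle> v\<close>, whose action on \<open>\<Lambda>\<^sup>+\<close> is
  \<open>F = (1/2) \<Sum> \<omega>\<^sub>i \<otimes> ad J\<^sub>i = \<Sum> (-\<omega>\<^sub>i) \<otimes> \<epsilon>\<^sub>i\<close>.
\<close>

definition sharp :: "real^4^4 \<Rightarrow> real^4^4 \<Rightarrow> real^4^4" where
  "sharp h \<omega> = matrix_inv h ** \<omega>"

definition oriented_form_basis :: "real^4^4 \<Rightarrow> real \<Rightarrow> (3 \<Rightarrow> real^4^4) \<Rightarrow> bool" where
  "oriented_form_basis h \<sigma> b \<longleftrightarrow>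
     (\<forall>i. b i \<in> self_dual_forms h \<sigma>) \<and> so3_basis (\<lambda>i. sharp h (b i))"

text \<open>
  \<open>M\<close> is the matrix of the curvature map with respect to oriented bases of \<open>so(E)\<^sup>*\<close> and of its image;
  the sign of \<open>det M\<close> depends on neither the bases nor the representative \<open>h\<close> of the conformal
  structure.
\<close>

definition curvature_matrix :: "(4 \<Rightarrow> real^4 \<Rightarrow> real^3^3) \<Rightarrow> real^4 \<Rightarrow> real^3^3 \<Rightarrow> bool" where
  "curvature_matrix A x M \<longleftrightarrow> (\<exists>\<sigma> h \<xi> b.
     induces_structure A x \<sigma> h \<and> so3_dual_basis \<xi> \<and> oriented_form_basis h \<sigma> b \<and>
     (\<forall>j. curvature_map A x (\<xi> j) = (\<Sum>i\<in>UNIV. M $ i $ j *\<^sub>R b i)))"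

definition positive_definite_at :: "(4 \<Rightarrow> real^4 \<Rightarrow> real^3^3) \<Rightarrow> real^4 \<Rightarrow> bool" where
  "positive_definite_at A x \<longleftrightarrow> definite_at A x \<and> (\<exists>M. curvature_matrix A x M \<and> det M > 0)"

definition negative_definite_at :: "(4 \<Rightarrow> real^4 \<Rightarrow> real^3^3) \<Rightarrow> real^4 \<Rightarrow> bool" where
  "negative_definite_at A x \<longleftrightarrow> definite_at A x \<and> (\<exists>M. curvature_matrix A x M \<and> det M < 0)"


section \<open>The Levi-Civita connections on the bundles of self-dual and anti-self-dual forms\<close>

text \<open>
  \<open>A\<close> is the connection induced by the Levi-Civita connection of \<open>g\<close> on \<open>\<Lambda>\<^sup>\<plusminus>\<close> (\<open>\<sigma> = \<plusminus>1\<close>), in the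
  orthonormal frame \<open>e\<close> over \<open>V\<close>: \<open>\<nabla>\<^sub>k e\<^sub>b = \<Sum>\<^sub>a (A\<^sub>k)\<^sub>a\<^sub>b e\<^sub>a\<close>.
\<close>

definition levi_civita_on_forms ::
  "(real^4 \<Rightarrow> real^4^4) \<Rightarrow> real \<Rightarrow> (real^4) set \<Rightarrow> (3 \<Rightarrow> real^4 \<Rightarrow> real^4^4) \<Rightarrow>
   (4 \<Rightarrow> real^4 \<Rightarrow> real^3^3) \<Rightarrow> bool" where
  "levi_civita_on_forms g \<sigma> V e A \<longleftrightarrow>
     (\<forall>a. smooth_on V (e a) \<and> (\<forall>y\<in>V. e a y \<in> self_dual_forms (g y) \<sigma>)) \<and>
     (\<forall>y\<in>V. \<forall>a b. form_inner (g y) (e a y) (e b y) = (if a = b then 1 else 0)) \<and>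
     so3_connection_on V A \<and>
     (\<forall>y\<in>V. \<forall>k b. nabla_form g k (e b) y = (\<Sum>a\<in>UNIV. A k y $ a $ b *\<^sub>R e a y))"

text \<open>
  Being positive or negative definite is invariant under changes of the chart and of the frame (also
  under orientation-reversing ones, since \<open>-1\<close> acts trivially on \<open>so(3)\<close>), so it may be tested in
  any one local frame around each point.
\<close>

definition positive_definite_on_forms :: "real \<Rightarrow> 'a riemannian_data \<Rightarrow> bool" where
  "positive_definite_on_forms \<sigma> X \<longleftrightarrow> (\<forall>c\<in>atlas X. \<forall>x\<in>chart_image c.
     \<exists>V e A. open V \<and> x \<in> V \<and> V \<subseteq> chart_image c \<and>
       levi_civita_on_forms (metric_of X c) \<sigma> V e A \<and> positive_definite_at A x)"

definition negative_definite_on_forms :: "real \<Rightarrow> 'a riemannian_data \<Rightarrow> bool" where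
  "negative_definite_on_forms \<sigma> X \<longleftrightarrow> (\<forall>c\<in>atlas X. \<forall>x\<in>chart_image c.
     \<exists>V e A. open V \<and> x \<in> V \<and> V \<subseteq> chart_image c \<and>
       levi_civita_on_forms (metric_of X c) \<sigma> V e A \<and> negative_definite_at A x)"

end

theory Submission
  imports Defs
begin

text \<open>
  At a point of an oriented Riemannian four-manifold split the two-forms as
  \<open>\<Lambda>\<^sup>+ \<oplus> \<Lambda>\<^sup>-\<close>. The curvature operator is symmetric, with blocks \<open>\<alpha>\<close> on \<open>\<Lambda>\<^sup>+\<close>, \<open>\<gamma>\<close> on
  \<open>\<Lambda>\<^sup>-\<close> and \<open>\<beta>\<close> between them, and the first Bianchi identity says that \<open>\<alpha>\<close> and \<open>\<gamma>\<close> have the same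
  trace. The planes in the tangent space are, up to scale, the decomposable two-forms, which are the sums
  \<open>a + b\<close> of \<open>a \<in> \<Lambda>\<^sup>+\<close> and \<open>b \<in> \<Lambda>\<^sup>-\<close> of equal length; with unit vectors \<open>a\<close>, \<open>b\<close> and a suitable
  normalisation the sectional curvature is \<open>\<alpha>(a,a) + 2 \<beta>(a,b) + \<gamma>(b,b)\<close>.

  The curvature of \<open>\<Lambda>\<^sup>+\<close>, as a map from \<open>so(\<Lambda>\<^sup>+)\<^sup>* \<cong> \<Lambda>\<^sup>+\<close> to the two-forms, is the first block column
  \<open>a \<mapsto> \<alpha> a + \<beta>\<^sup>T a\<close>. Hence its image is definite as soon as \<open>\<bar>\<beta>\<^sup>T a\<bar> < \<bar>\<alpha> a\<bar>\<close> for all \<open>a \<noteq> 0\<close>, and then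
  the connection has the sign of \<open>det \<alpha>\<close> (\<open>definite_if_contraction\<close>). Indeed, if the wedge product is positive
  definite on a 3-space \<open>W\<close> of two-forms, then \<open>W\<close> is the space of self-dual forms of a metric: a basis
  of \<open>W\<close> that is orthonormal for the wedge product generates the quaternions, and in an adapted basis
  of the tangent space it becomes the standard basis of \<open>\<Lambda>\<^sup>+\<close>
  (\<open>wedge_orthonormal_normal_form\<close>).

  Suppose that all sectional curvatures lie in \<open>[m, M]\<close> with \<open>m > 0\<close>, and that \<open>\<alpha>(a,a) + t \<beta>(a,b) \<le> 0\<close>
  for unit vectors \<open>a\<close>, \<open>b\<close> and some \<open>t \<in> [0, 1]\<close>. Averaging the curvatures of the planes \<open>a \<plusminus> b\<close> gives
  \<open>m \<le> \<alpha>(a,a) + 2 t \<beta>(a,b) + \<gamma>(b,b) \<le> \<gamma>(b,b) - \<alpha>(a,a)\<close>. Extend \<open>a\<close> and \<open>b\<close> to orthonormal bases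
  \<open>a, a\<^sub>2, a\<^sub>3\<close> and \<open>b, b\<^sub>2, b\<^sub>3\<close>. Comparing traces, with \<open>m \<le> \<alpha>(a,a) + \<gamma>(b\<^sub>j,b\<^sub>j)\<close> and
  \<open>\<alpha>(a\<^sub>j,a\<^sub>j) + \<gamma>(b,b) \<le> M\<close>, one finds
  \<open>m + 2 (m - \<alpha>(a,a)) \<le> \<alpha>(a\<^sub>2,a\<^sub>2) + \<alpha>(a\<^sub>3,a\<^sub>3) \<le> 2 (M - m - \<alpha>(a,a))\<close>, that is \<open>5 m \<le> 2 M\<close>. So
  \<open>m/M > 2/5\<close> forces \<open>\<alpha>(a,a) > \<bar>\<beta>(a,b)\<bar>\<close> (\<open>pinched_positive\<close>), which contains both the contraction
  property and \<open>det \<alpha> > 0\<close>. Negative curvature is the same statement for the negative of the curvature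
  tensor, and \<open>\<Lambda>\<^sup>-\<close> is treated by an orthonormal frame of the opposite orientation.

  All inequalities above are equalities when \<open>\<beta> = 0\<close>, \<open>\<alpha>\<close> is a multiple of \<open>diag(0, 3, 3)\<close> and
  \<open>\<gamma>\<close> the same multiple of \<open>diag(2, 2, 2)\<close>. Then the pinching constant is exactly \<open>2/5\<close>, but \<open>\<alpha>\<close> has
  a kernel, so the connection on \<open>\<Lambda>\<^sup>+\<close> is not definite. A metric on a small ball with this curvature
  tensor at the centre shows that \<open>2/5\<close> is optimal, because by continuity the pinching constant of a
  small ball around the centre exceeds any given \<open>K < 2/5\<close>.
\<close>

section \<open>Smooth functions\<close>

lemma frechet_derivative_cong_open:
  fixes f g :: "'a::real_normed_vector \<Rightarrow> 'b::real_normed_vector"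
  assumes S: "open S" "x \<in> S" and eq: "\<And>y. y \<in> S \<Longrightarrow> f y = g y"
  shows "frechet_derivative f (at x) = frechet_derivative g (at x)"
    and "f differentiable (at x) \<longleftrightarrow> g differentiable (at x)"
proof -
  have *: "(f has_derivative D) (at x) \<longleftrightarrow> (g has_derivative D) (at x)" for D
    using S eq has_derivative_transform_within_open[of f D x UNIV S g]
      has_derivative_transform_within_open[of g D x UNIV S f] by auto
  show "frechet_derivative f (at x) = frechet_derivative g (at x)"
    unfolding frechet_derivative_def * ..
  show "f differentiable (at x) \<longleftrightarrow> g differentiable (at x)"
    unfolding differentiable_def * ..
qed

lemma times_differentiable_on_cong:
  assumes S: "open S" and eq: "\<And>y. y \<in> S \<Longrightarrow> f y = g y"
  shows "times_differentiable_on n S f \<longleftrightarrow> times_differentiable_on n S g"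
  using eq
proof (induction n arbitrary: f g)
  case 0
    then show ?case by (metis times_differentiable_on.simps(1) continuous_on_cong)
next
  case (Suc n)
  have "times_differentiable_on n S (\<lambda>x. frechet_derivative f (at x) v) \<longleftrightarrow>
      times_differentiable_on n S (\<lambda>x. frechet_derivative g (at x) v)" for v
    by (rule Suc.IH) (use frechet_derivative_cong_open(1)[OF S, of _ f g] Suc.prems in simp)
  moreover have "f differentiable (at x) \<longleftrightarrow> g differentiable (at x)" if "x \<in> S" for x
    using frechet_derivative_cong_open(2)[OF S that] Suc.prems by blast
  ultimately show ?case by simp
qed

lemma smooth_on_cong:
  "open S \<Longrightarrow> (\<And>y. y \<in> S \<Longrightarrow> f y = g y) \<Longrightarrow> smooth_on S f \<longleftrightarrow> smooth_on S g"
  unfolding smooth_on_def using times_differentiable_on_cong by blast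

lemma times_differentiable_on_SucD:
  "times_differentiable_on (Suc n) S f \<Longrightarrow> times_differentiable_on n S f"
proof (induction n arbitrary: f)
  case 0
  then show ?case
    by (auto intro!: continuous_at_imp_continuous_on differentiable_imp_continuous_within)
qed simp

lemma times_differentiable_on_subset:
  "times_differentiable_on n S f \<Longrightarrow> T \<subseteq> S \<Longrightarrow> times_differentiable_on n T f"
  by (induction n arbitrary: f) (auto intro: continuous_on_subset)

lemma smooth_on_subset: "smooth_on S f \<Longrightarrow> T \<subseteq> S \<Longrightarrow> smooth_on T f"
  unfolding smooth_on_def using times_differentiable_on_subset by blast

lemma smooth_on_has_derivative:
  assumes "smooth_on S f" "x \<in> S"
  shows "(f has_derivative frechet_derivative f (at x)) (at x)"
proof -
  have "times_differentiable_on (Suc 0) S f"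
    using assms(1) unfolding smooth_on_def by blast
  then show ?thesis using assms(2) by (simp add: frechet_derivative_works)
qed

lemma smooth_on_continuous_on: "smooth_on S f \<Longrightarrow> continuous_on S f"
  unfolding smooth_on_def using times_differentiable_on.simps(1) by blast

lemma smooth_on_frechet_derivative:
  "smooth_on S f \<Longrightarrow> smooth_on S (\<lambda>x. frechet_derivative f (at x) v)"
  unfolding smooth_on_def using times_differentiable_on.simps(2) by blast

lemma smooth_on_pd: "smooth_on S f \<Longrightarrow> smooth_on S (pd i f)"
  using smooth_on_frechet_derivative[of S f "axis i 1"] by (simp add: pd_def[abs_def])

lemma frechet_derivative_eqI:
  "(f has_derivative D) (at x) \<Longrightarrow> frechet_derivative f (at x) = D"
  using frechet_derivative_at by force

lemma times_differentiable_on_const: "times_differentiable_on n S (\<lambda>_. c)"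
  by (induction n arbitrary: c) (auto simp: frechet_derivative_eqI[OF has_derivative_const])

lemma times_differentiable_on_linear:
  assumes S: "open S" and T: "bounded_linear T" and f: "times_differentiable_on n S f"
  shows "times_differentiable_on n S (\<lambda>x. T (f x))"
  using f
proof (induction n arbitrary: f)
  case 0
  then show ?case using T by (simp add: bounded_linear.continuous_on)
next
  case (Suc n)
  have D: "((\<lambda>x. T (f x)) has_derivative (\<lambda>v. T (frechet_derivative f (at x) v))) (at x)" 
    if "x \<in> S" for x
    using Suc.prems that by (intro bounded_linear.has_derivative[OF T]) (simp add: frechet_derivative_works)
  have "times_differentiable_on n S (\<lambda>x. frechet_derivative (\<lambda>x. T (f x)) (at x) v)" for v
    using Suc.IH[of "\<lambda>x. frechet_derivative f (at x) v"] Suc.prems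
    by (subst times_differentiable_on_cong[OF S, where g = "\<lambda>x. T (frechet_derivative f (at x) v)"])
       (auto simp: frechet_derivative_eqI[OF D])
  then show ?case using D by (auto simp: differentiable_def)
qed

lemma times_differentiable_on_add:
  assumes S: "open S"
    and f: "times_differentiable_on n S f" and g: "times_differentiable_on n S g"
  shows "times_differentiable_on n S (\<lambda>x. f x + g x)"
  using f g
proof (induction n arbitrary: f g)
  case 0
  then show ?case by (simp add: continuous_on_add)
next
  case (Suc n)
  have D: "((\<lambda>x. f x + g x) has_derivative
      (\<lambda>v. frechet_derivative f (at x) v + frechet_derivative g (at x) v)) (at x)" 
    if "x \<in> S" for x
    using Suc.prems that by (intro has_derivative_add) (simp_all add: frechet_derivative_works)
  have "times_differentiable_on n S (\<lambda>x. frechet_derivative (\<lambda>x. f x + g x) (at x) v)" for v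
    using Suc.IH[of "\<lambda>x. frechet_derivative f (at x) v" "\<lambda>x. frechet_derivative g (at x) v"] Suc.prems
    by (subst times_differentiable_on_cong[OF S,
          where g = "\<lambda>x. frechet_derivative f (at x) v + frechet_derivative g (at x) v"])
       (auto simp: frechet_derivative_eqI[OF D])
  then show ?case using D by (auto simp: differentiable_def)
qed

lemma times_differentiable_on_bilinear:
  assumes S: "open S" and B: "bounded_bilinear B"
    and f: "times_differentiable_on n S f" and g: "times_differentiable_on n S g"
  shows "times_differentiable_on n S (\<lambda>x. B (f x) (g x))"
  using f g
proof (induction n arbitrary: f g)
  case 0
  then show ?case using B by (simp add: bounded_bilinear.continuous_on)
next
  case (Suc n)
  let ?D = "\<lambda>x v. B (f x) (frechet_derivative g (at x) v) + B (frechet_derivative f (at x) v) (g x)"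
  have D: "((\<lambda>x. B (f x) (g x)) has_derivative ?D x) (at x)" if "x \<in> S" for x
    using Suc.prems that by (intro bounded_bilinear.FDERIV[OF B]) (simp_all add: frechet_derivative_works)
  have "times_differentiable_on n S (\<lambda>x. ?D x v)" for v
    using Suc.prems times_differentiable_on_SucD[OF Suc.prems(1)] times_differentiable_on_SucD[OF Suc.prems(2)]
    by (intro times_differentiable_on_add[OF S] Suc.IH) auto
  then have "times_differentiable_on n S (\<lambda>x. frechet_derivative (\<lambda>x. B (f x) (g x)) (at x) v)" for v
    by (subst times_differentiable_on_cong[OF S, where g = "\<lambda>x. ?D x v"])
       (auto simp: frechet_derivative_eqI[OF D])
  then show ?case using D by (auto simp: differentiable_def)
qed

lemma smooth_on_const: "smooth_on S (\<lambda>_. c)"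
  by (simp add: smooth_on_def times_differentiable_on_const)

lemma smooth_on_linear:
  "open S \<Longrightarrow> bounded_linear T \<Longrightarrow> smooth_on S f \<Longrightarrow> smooth_on S (\<lambda>x. T (f x))"
  by (simp add: smooth_on_def times_differentiable_on_linear)

lemma smooth_on_add:
  "open S \<Longrightarrow> smooth_on S f \<Longrightarrow> smooth_on S g \<Longrightarrow> smooth_on S (\<lambda>x. f x + g x)"
  by (simp add: smooth_on_def times_differentiable_on_add)

lemma smooth_on_bilinear:
  "open S \<Longrightarrow> bounded_bilinear B \<Longrightarrow> smooth_on S f \<Longrightarrow> smooth_on S g \<Longrightarrow>
    smooth_on S (\<lambda>x. B (f x) (g x))"
  by (simp add: smooth_on_def times_differentiable_on_bilinear)

lemma smooth_on_id: "open S \<Longrightarrow> smooth_on S (\<lambda>x. x)"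
proof -
  have "times_differentiable_on n S (\<lambda>x::'a. x)" for n
    by (cases n) (auto simp: frechet_derivative_eqI[OF has_derivative_ident] times_differentiable_on_const)
  then show ?thesis by (simp add: smooth_on_def)
qed

lemma smooth_on_minus: "open S \<Longrightarrow> smooth_on S f \<Longrightarrow> smooth_on S (\<lambda>x. - f x)"
  by (intro smooth_on_linear[of S uminus]) (simp_all add: bounded_linear_minus bounded_linear_ident)

lemma smooth_on_diff:
  "open S \<Longrightarrow> smooth_on S f \<Longrightarrow> smooth_on S g \<Longrightarrow> smooth_on S (\<lambda>x. f x - g x)"
  using smooth_on_add[of S f "\<lambda>x. - g x"] smooth_on_minus[of S g] by simp

lemma smooth_on_sum:
  "open S \<Longrightarrow> (\<And>i. i \<in> I \<Longrightarrow> smooth_on S (f i)) \<Longrightarrow> smooth_on S (\<lambda>x. \<Sum>i\<in>I. f i x)"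
  by (induction I rule: infinite_finite_induct) (auto intro: smooth_on_const smooth_on_add)

lemmas smooth_on_scaleR = smooth_on_bilinear[OF _ bounded_bilinear_scaleR]
lemmas smooth_on_mult = smooth_on_bilinear[OF _ bounded_bilinear_mult]
lemmas smooth_on_inner = smooth_on_bilinear[OF _ bounded_bilinear_inner]

lemma smooth_on_nth: "open S \<Longrightarrow> smooth_on S f \<Longrightarrow> smooth_on S (\<lambda>x. f x $ i)"
  by (rule smooth_on_linear[OF _ bounded_linear_vec_nth])

lemma smooth_on_vec_lambda:
  fixes f :: "'n::finite \<Rightarrow> 'a::real_normed_vector \<Rightarrow> 'b::euclidean_space"
  assumes S: "open S" and f: "\<And>i. smooth_on S (f i)"
  shows "smooth_on S (\<lambda>x. \<chi> i. f i x)"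
proof -
  have eq: "(\<chi> i. f i x) = (\<Sum>i\<in>UNIV. axis i (f i x))" for x
    by (simp add: vec_eq_iff axis_def sum.delta')
  have "linear (axis i :: 'b \<Rightarrow> 'b^'n)" for i
    by (rule linearI) (auto simp: vec_eq_iff axis_def)
  then show ?thesis unfolding eq
    by (intro smooth_on_sum S smooth_on_linear[OF S _ f]) (simp add: linear_conv_bounded_linear)
qed

lemma bounded_bilinear_matrix_mult:
  "bounded_bilinear ((**) :: real^'n^'m \<Rightarrow> real^'k^'n \<Rightarrow> real^'k^'m)"
  by (simp add: bilinear_conv_bounded_bilinear[symmetric] bilinear_def linear_iff
      matrix_add_ldistrib matrix_matrix_mult_def vec_eq_iff sum.distrib sum_distrib_left algebra_simps)

lemma bounded_bilinear_matrix_vector_mult: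
  "bounded_bilinear ((*v) :: real^'n^'m \<Rightarrow> real^'n \<Rightarrow> real^'m)"
  by (simp add: bilinear_conv_bounded_bilinear[symmetric] bilinear_def linear_iff
      matrix_vector_mult_def vec_eq_iff sum.distrib sum_distrib_left algebra_simps)

lemma bounded_linear_transpose: "bounded_linear (transpose :: real^'n^'m \<Rightarrow> real^'m^'n)"
  by (simp add: linear_conv_bounded_linear[symmetric] linear_iff transpose_def vec_eq_iff)

lemmas smooth_on_matrix_mult = smooth_on_bilinear[OF _ bounded_bilinear_matrix_mult]
lemmas smooth_on_matrix_vector_mult = smooth_on_bilinear[OF _ bounded_bilinear_matrix_vector_mult]
lemmas smooth_on_transpose = smooth_on_linear[OF _ bounded_linear_transpose]

text \<open>
  The function \<open>h = f\<^sup>-\<^sup>1\<^sup>/\<^sup>2\<close> satisfies \<open>dh = - (1/2) h\<^sup>3 df\<close>, so each order of differentiability of \<open>h\<close>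
  gives the next one. This is the only non-polynomial operation in the Gram-Schmidt process.
\<close>

lemma smooth_on_inverse_sqrt:
  fixes f :: "'a::real_normed_vector \<Rightarrow> real"
  assumes S: "open S" and f: "smooth_on S f" and pos: "\<And>x. x \<in> S \<Longrightarrow> f x > 0"
  shows "smooth_on S (\<lambda>x. inverse (sqrt (f x)))"
proof -
  define h where "h x = inverse (sqrt (f x))" for x
  let ?D = "\<lambda>x v. - (1/2) * (h x * (h x * (h x * frechet_derivative f (at x) v)))"
  have D: "(h has_derivative ?D x) (at x)" if x: "x \<in> S" for x
  proof -
    have "sqrt (f x) \<noteq> 0" "f x > 0" using pos[OF x] by auto
    then show ?thesis unfolding h_def
      by (auto intro!: derivative_eq_intros smooth_on_has_derivative[OF f x] simp: field_simps)
  qed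
  have "times_differentiable_on n S h" for n
  proof (induction n)
    case 0
    show ?case using D
      by (auto intro!: continuous_at_imp_continuous_on has_derivative_continuous)
  next
    case (Suc n)
    have "times_differentiable_on n S (\<lambda>x. frechet_derivative f (at x) v)" for v
      using smooth_on_frechet_derivative[OF f] by (simp add: smooth_on_def)
    then have "times_differentiable_on n S (\<lambda>x. ?D x v)" for v
      using Suc by (intro times_differentiable_on_bilinear[OF S bounded_bilinear_mult]
          times_differentiable_on_const)
    then have "times_differentiable_on n S (\<lambda>x. frechet_derivative h (at x) v)" for v
      by (subst times_differentiable_on_cong[OF S, where g = "\<lambda>x. ?D x v"])
         (auto simp: frechet_derivative_eqI[OF D])
    then show ?case using D by (auto simp: differentiable_def)
  qed
  then show ?thesis by (simp add: smooth_on_def h_def[abs_def])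
qed

text \<open>
  The left-hand side is symmetric in \<open>v\<close> and \<open>w\<close>, whereas the mean value theorem, applied first in
  the direction \<open>v\<close> and then in the direction \<open>w\<close>, produces a second derivative in this order.
\<close>

lemma second_difference_mean_value:
  fixes f :: "'a::real_normed_vector \<Rightarrow> real"
  assumes f: "smooth_on (ball x r) f" and s: "s > 0" "s * (norm v + norm w) < r"
  shows "\<exists>y\<in>ball x r. f (x + s *\<^sub>R v + s *\<^sub>R w) - f (x + s *\<^sub>R v) - f (x + s *\<^sub>R w) + f x
    = s * s * frechet_derivative (\<lambda>y. frechet_derivative f (at y) v) (at y) w"
proof -
  have mem: "x + a *\<^sub>R v + b *\<^sub>R w \<in> ball x r" if "0 \<le> a" "a \<le> s" "0 \<le> b" "b \<le> s" for a b
  proof -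
    have "dist x (x + a *\<^sub>R v + b *\<^sub>R w) = norm (a *\<^sub>R v + b *\<^sub>R w)"
      by (simp add: dist_norm norm_minus_commute algebra_simps)
    also have "\<dots> \<le> a * norm v + b * norm w"
      using norm_triangle_ineq[of "a *\<^sub>R v" "b *\<^sub>R w"] that by simp
    also have "\<dots> \<le> s * norm v + s * norm w"
      using that by (intro add_mono mult_right_mono) auto
    also have "\<dots> < r" using s by (simp add: algebra_simps)
    finally show ?thesis by simp
  qed
  define G where "G y = frechet_derivative f (at y) v" for y
  have smG: "smooth_on (ball x r) G"
    unfolding G_def by (rule smooth_on_frechet_derivative[OF f])
  have line: "DERIV (\<lambda>t. F (p + t *\<^sub>R u)) t :> frechet_derivative F (at (p + t *\<^sub>R u)) u"
    if F: "smooth_on (ball x r) F" and m: "p + t *\<^sub>R u \<in> ball x r"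
    for F :: "'a \<Rightarrow> real" and p u t
  proof -
    have lin: "linear (frechet_derivative F (at (p + t *\<^sub>R u)))"
      by (rule linear_frechet_derivative)
         (use smooth_on_has_derivative[OF F m] in \<open>auto simp: differentiable_def\<close>)
    have "((\<lambda>t. F (p + t *\<^sub>R u)) has_derivative
        (\<lambda>h. frechet_derivative F (at (p + t *\<^sub>R u)) (h *\<^sub>R u))) (at t)"
      by (rule has_derivative_compose[of "\<lambda>t. p + t *\<^sub>R u" _ t UNIV F, OF _ smooth_on_has_derivative[OF F m]])
         (auto intro!: derivative_eq_intros)
    then show ?thesis
      by (simp add: has_field_derivative_def linear_scale[OF lin] mult_commute_abs)
  qed
  obtain a where a: "0 < a" "a < s" and
    eq1: "(\<lambda>t. f (x + s *\<^sub>R w + t *\<^sub>R v) - f (x + t *\<^sub>R v)) s - (\<lambda>t. f (x + s *\<^sub>R w + t *\<^sub>R v) - f (x + t *\<^sub>R v)) 0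
      = (s - 0) * (G (x + s *\<^sub>R w + a *\<^sub>R v) - G (x + a *\<^sub>R v))"
  proof -
    have "\<exists>z>0. z < s \<and> (\<lambda>t. f (x + s *\<^sub>R w + t *\<^sub>R v) - f (x + t *\<^sub>R v)) s - (\<lambda>t. f (x + s *\<^sub>R w + t *\<^sub>R v) - f (x + t *\<^sub>R v)) 0
      = (s - 0) * (G (x + s *\<^sub>R w + z *\<^sub>R v) - G (x + z *\<^sub>R v))"
    proof (rule MVT2[OF s(1)], unfold G_def, intro DERIV_diff line[OF f])
      fix t assume "0 \<le> t" "t \<le> s"
      then show "x + s *\<^sub>R w + t *\<^sub>R v \<in> ball x r" "x + t *\<^sub>R v \<in> ball x r"
        using mem[of t s] mem[of t 0] s by (simp_all add: algebra_simps)
    qed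
    then show thesis using that by blast
  qed
  obtain b where b: "0 < b" "b < s" and
    eq2: "G (x + a *\<^sub>R v + s *\<^sub>R w) - G (x + a *\<^sub>R v + 0 *\<^sub>R w)
      = (s - 0) * frechet_derivative G (at (x + a *\<^sub>R v + b *\<^sub>R w)) w"
  proof -
    have "\<exists>z>0. z < s \<and> G (x + a *\<^sub>R v + s *\<^sub>R w) - G (x + a *\<^sub>R v + 0 *\<^sub>R w)
      = (s - 0) * frechet_derivative G (at (x + a *\<^sub>R v + z *\<^sub>R w)) w"
    proof (rule MVT2[OF s(1)], intro line[OF smG])
      fix t assume "0 \<le> t" "t \<le> s"
      then show "x + a *\<^sub>R v + t *\<^sub>R w \<in> ball x r" using mem[of a t] a by simp
    qed
    then show thesis using that by blast
  qed
  have "f (x + s *\<^sub>R v + s *\<^sub>R w) - f (x + s *\<^sub>R v) - f (x + s *\<^sub>R w) + f x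
      = s * (G (x + a *\<^sub>R v + s *\<^sub>R w) - G (x + a *\<^sub>R v))"
    using eq1 by (simp add: algebra_simps)
  also have "\<dots> = s * s * frechet_derivative G (at (x + a *\<^sub>R v + b *\<^sub>R w)) w"
    using eq2 by simp
  finally show ?thesis
    using mem[of a b] a b unfolding G_def[abs_def] by (intro bexI[of _ "x + a *\<^sub>R v + b *\<^sub>R w"]) auto
qed

text \<open>
  Both mixed derivatives are taken, at two points close to \<open>x\<close>, to the same second difference;
  continuity lets the points tend to \<open>x\<close>.
\<close>

lemma symmetric_second_derivative_real:
  fixes f :: "'a::real_normed_vector \<Rightarrow> real"
  assumes S: "open S" and f: "smooth_on S f" and x: "x \<in> S"
  shows "frechet_derivative (\<lambda>y. frechet_derivative f (at y) v) (at x) w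
       = frechet_derivative (\<lambda>y. frechet_derivative f (at y) w) (at x) v" (is "?a x = ?b x")
proof -
  have *: "\<bar>?a x - ?b x\<bar> \<le> 0 + e" if e: "e > 0" for e
  proof -
    have cont: "isCont ?a x" "isCont ?b x"
      using S x f by (auto intro!: continuous_on_interior[of S] smooth_on_continuous_on
          smooth_on_frechet_derivative simp: interior_open)
    have e2: "e/2 > 0" using e by simp
    obtain d1 where d1: "d1 > 0" "\<And>y. dist y x < d1 \<Longrightarrow> dist (?a y) (?a x) < e/2"
      using cont(1) e2 unfolding continuous_at_eps_delta by blast
    obtain d2 where d2: "d2 > 0" "\<And>y. dist y x < d2 \<Longrightarrow> dist (?b y) (?b x) < e/2"
      using cont(2) e2 unfolding continuous_at_eps_delta by blast
    note d = d1(1) d2(1) d1(2)[unfolded dist_real_def] d2(2)[unfolded dist_real_def]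
    obtain d3 where d3: "d3 > 0" "ball x d3 \<subseteq> S" using S x open_contains_ball by blast
    define r where "r = min d3 (min d1 d2)"
    have r: "r > 0" using d d3 by (simp add: r_def)
    have fr: "smooth_on (ball x r) f"
      by (rule smooth_on_subset[OF f]) (use d3 in \<open>force simp: r_def\<close>)
    define s where "s = r / (2 * (norm v + norm w + 1))"
    have den: "2 * (norm v + norm w + 1) > 0" by (intro mult_pos_pos add_nonneg_pos add_nonneg_nonneg) auto
    have s: "s > 0" using r den by (simp add: s_def)
    have "s * (norm v + norm w) = r * ((norm v + norm w) / (2 * (norm v + norm w + 1)))"
      by (simp add: s_def)
    also have "\<dots> < r * 1"
      using r den by (intro mult_strict_left_mono) (simp_all add: divide_less_eq)
    finally have s2: "s * (norm v + norm w) < r" by simp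
    obtain y where y: "y \<in> ball x r"
      "f (x + s *\<^sub>R v + s *\<^sub>R w) - f (x + s *\<^sub>R v) - f (x + s *\<^sub>R w) + f x = s * s * ?a y"
      using second_difference_mean_value[OF fr s s2] by blast
    obtain z where z: "z \<in> ball x r"
      "f (x + s *\<^sub>R w + s *\<^sub>R v) - f (x + s *\<^sub>R w) - f (x + s *\<^sub>R v) + f x = s * s * ?b z"
      using second_difference_mean_value[OF fr s, of w v] s2 by (auto simp: add.commute)
    have "s * s * ?a y = s * s * ?b z" using y(2) z(2) by (simp add: algebra_simps)
    then have "?a y = ?b z" using s by simp
    moreover have "\<bar>?a y - ?a x\<bar> < e/2" "\<bar>?b z - ?b x\<bar> < e/2"
      using y(1) z(1) d(3)[of y] d(4)[of z] by (auto simp: r_def dist_commute)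
    ultimately show ?thesis by linarith
  qed
  have "\<bar>?a x - ?b x\<bar> \<le> 0" by (rule field_le_epsilon) (rule *)
  then show ?thesis by simp
qed

lemma frechet_derivative_linear_comp:
  assumes "bounded_linear T" "smooth_on S f" "x \<in> S"
  shows "frechet_derivative (\<lambda>x. T (f x)) (at x) v = T (frechet_derivative f (at x) v)"
  using frechet_derivative_eqI[OF bounded_linear.has_derivative[OF assms(1) smooth_on_has_derivative[OF assms(2,3)]]]
  by simp

lemma symmetric_second_derivative:
  fixes f :: "'a::real_normed_vector \<Rightarrow> 'b::real_inner"
  assumes S: "open S" and f: "smooth_on S f" and x: "x \<in> S"
  shows "frechet_derivative (\<lambda>y. frechet_derivative f (at y) v) (at x) w
       = frechet_derivative (\<lambda>y. frechet_derivative f (at y) w) (at x) v"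
proof (rule vector_eq_rdot[THEN iffD1], intro allI)
  fix z
  let ?T = "\<lambda>y::'b. y \<bullet> z"
  have T: "bounded_linear ?T" by (rule bounded_linear_inner_left)
  have eq: "frechet_derivative (\<lambda>y. frechet_derivative (\<lambda>y. ?T (f y)) (at y) v) (at x) w
     = ?T (frechet_derivative (\<lambda>y. frechet_derivative f (at y) v) (at x) w)" for v w
  proof -
    have "frechet_derivative (\<lambda>y. frechet_derivative (\<lambda>y. ?T (f y)) (at y) v) (at x)
      = frechet_derivative (\<lambda>y. ?T (frechet_derivative f (at y) v)) (at x)"
      using S x by (rule frechet_derivative_cong_open) (rule frechet_derivative_linear_comp[OF T f])
    then show ?thesis
      using frechet_derivative_linear_comp[OF T smooth_on_frechet_derivative[OF f] x] by simp
  qed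
  show "?T (frechet_derivative (\<lambda>y. frechet_derivative f (at y) v) (at x) w)
     = ?T (frechet_derivative (\<lambda>y. frechet_derivative f (at y) w) (at x) v)"
    unfolding eq[symmetric]
    by (rule symmetric_second_derivative_real[OF S smooth_on_linear[OF S T f] x])
qed

lemma pd_commute:
  fixes f :: "real^4 \<Rightarrow> 'b::real_inner"
  shows "open S \<Longrightarrow> smooth_on S f \<Longrightarrow> x \<in> S \<Longrightarrow> pd i (pd j f) x = pd j (pd i f) x"
  unfolding pd_def[abs_def] using symmetric_second_derivative by blast

lemma pd_cong: "open S \<Longrightarrow> x \<in> S \<Longrightarrow> (\<And>y. y \<in> S \<Longrightarrow> f y = g y) \<Longrightarrow> pd i f x = pd i g x"
  unfolding pd_def using frechet_derivative_cong_open(1) by metis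

lemma pd_linear: "bounded_linear T \<Longrightarrow> smooth_on S f \<Longrightarrow> x \<in> S \<Longrightarrow> pd i (\<lambda>x. T (f x)) x = T (pd i f x)"
  unfolding pd_def by (rule frechet_derivative_linear_comp)

lemma pd_bilinear:
  assumes "bounded_bilinear B" "smooth_on S f" "smooth_on S g" "x \<in> S"
  shows "pd i (\<lambda>x. B (f x) (g x)) x = B (pd i f x) (g x) + B (f x) (pd i g x)"
  using frechet_derivative_eqI[OF bounded_bilinear.FDERIV[OF assms(1)
      smooth_on_has_derivative[OF assms(2,4)] smooth_on_has_derivative[OF assms(3,4)]]]
  by (simp add: pd_def)

lemma pd_add:
  assumes "smooth_on S f" "smooth_on S g" "x \<in> S"
  shows "pd i (\<lambda>x. f x + g x) x = pd i f x + pd i g x"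
  using frechet_derivative_eqI[OF has_derivative_add[OF
      smooth_on_has_derivative[OF assms(1,3)] smooth_on_has_derivative[OF assms(2,3)]]]
  by (simp add: pd_def)

lemma pd_sum:
  assumes "\<And>a. a \<in> I \<Longrightarrow> smooth_on S (f a)" "x \<in> S"
  shows "pd i (\<lambda>x. \<Sum>a\<in>I. f a x) x = (\<Sum>a\<in>I. pd i (f a) x)"
  using frechet_derivative_eqI[OF has_derivative_sum[of I, OF smooth_on_has_derivative[OF assms(1) assms(2)]]]
  by (simp add: pd_def)

lemma pd_const: "pd i (\<lambda>_. c) x = 0"
  by (simp add: pd_def frechet_derivative_eqI[OF has_derivative_const])

lemmas pd_matrix_mult = pd_bilinear[OF bounded_bilinear_matrix_mult]
lemmas pd_transpose = pd_linear[OF bounded_linear_transpose]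

lemma pd_nth2: "smooth_on S f \<Longrightarrow> x \<in> S \<Longrightarrow> pd i (\<lambda>x. f x $ l $ k) x = pd i f x $ l $ k"
  by (rule pd_linear[where T = "\<lambda>m. m $ l $ k"])
     (simp_all add: bounded_linear_compose[OF bounded_linear_vec_nth bounded_linear_vec_nth])

section \<open>Smooth orthonormal frames\<close>

text \<open>
  The Gram-Schmidt process, one standard basis vector at a time. The vector constructed for the index
  \<open>n\<close> has the component 1 at \<open>n\<close> before it is normalised, because the earlier vectors are supported on
  the earlier indices; so it does not vanish, and its norm can be divided by.
\<close>

lemma gram_schmidt_smooth:
  fixes g :: "'a::real_normed_vector \<Rightarrow> real^'n^'n"
  assumes U: "open U" and g: "smooth_on U g" and pd: "\<And>y. y \<in> U \<Longrightarrow> pos_def_matrix (g y)"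
  shows "\<exists>E :: 'a \<Rightarrow> real^'n^'n. smooth_on U E \<and> (\<forall>y\<in>U. transpose (E y) ** g y ** E y = mat 1)"
proof -
  define ip where "ip y a b = a \<bullet> (g y *v b)" for y a b
  have sym: "ip y a b = ip y b a" if "y \<in> U" for y a b
  proof -
    have "transpose (g y) = g y" using pd[OF that] by (simp add: pos_def_matrix_def)
    then show ?thesis unfolding ip_def by (metis dot_lmul_matrix inner_commute vector_transpose_matrix)
  qed
  have ip_lin: "ip y (a + b) c = ip y a c + ip y b c" "ip y (r *\<^sub>R a) c = r * ip y a c"
    "ip y (a - b) c = ip y a c - ip y b c"
    "ip y c (a + b) = ip y c a + ip y c b" "ip y c (r *\<^sub>R a) = r * ip y c a"
    "ip y c (a - b) = ip y c a - ip y c b" for y a b c r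
    by (simp_all add: ip_def inner_add_left inner_diff_left inner_add_right inner_diff_right
        matrix_vector_right_distrib matrix_vector_mult_diff_distrib matrix_vector_mult_scaleR)
  have ip_sum: "ip y (sum f J) c = (\<Sum>j\<in>J. ip y (f j) c)" for y c f and J :: "'n set"
    by (simp add: ip_def inner_sum_left)
  have sm_ip: "smooth_on U (\<lambda>y. ip y (a y) (b y))" if "smooth_on U a" "smooth_on U b" for a b
    unfolding ip_def by (intro smooth_on_inner smooth_on_matrix_vector_mult U g that)
  have "\<exists>u. (\<forall>i\<in>I. smooth_on U (u i)) \<and> (\<forall>y\<in>U. \<forall>i\<in>I.
      (\<forall>j\<in>I. ip y (u i y) (u j y) = (if i = j then 1 else 0)) \<and> (\<forall>k. k \<notin> I \<longrightarrow> u i y $ k = 0))"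
    if "finite I" for I :: "'n set"
    using that
  proof induction
    case (insert n I)
    then obtain u where u: "\<And>i. i \<in> I \<Longrightarrow> smooth_on U (u i)"
      and orth: "\<And>y i j. y \<in> U \<Longrightarrow> i \<in> I \<Longrightarrow> j \<in> I \<Longrightarrow> ip y (u i y) (u j y) = (if i = j then 1 else 0)"
      and supp: "\<And>y i k. y \<in> U \<Longrightarrow> i \<in> I \<Longrightarrow> k \<notin> I \<Longrightarrow> u i y $ k = 0"
      by blast
    define w where "w y = axis n 1 - (\<Sum>j\<in>I. ip y (axis n 1) (u j y) *\<^sub>R u j y)" for y
    define c where "c y = inverse (sqrt (ip y (w y) (w y)))" for y
    define v where "v = (\<lambda>i. if i = n then (\<lambda>y. c y *\<^sub>R w y) else u i)"
    have w: "smooth_on U w" unfolding w_def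
      by (intro smooth_on_diff smooth_on_sum smooth_on_scaleR sm_ip smooth_on_const u U)
    have wn: "w y $ n = 1" if "y \<in> U" for y
      using supp[OF that _ insert(2)] by (simp add: w_def axis_def)
    have pos: "ip y (w y) (w y) > 0" if "y \<in> U" for y
    proof -
      have "w y \<noteq> 0" using wn[OF that] by auto
      then show ?thesis using pd[OF that] by (simp add: ip_def pos_def_matrix_def)
    qed
    have wu: "ip y (w y) (u i y) = 0" if "y \<in> U" "i \<in> I" for y i
    proof -
      have "(\<Sum>j\<in>I. ip y (axis n 1) (u j y) * ip y (u j y) (u i y))
          = (\<Sum>j\<in>I. if j = i then ip y (axis n 1) (u j y) else 0)"
        using orth[OF that(1) _ that(2)] by (intro sum.cong) auto
      then show ?thesis using insert(1) that by (simp add: w_def ip_lin ip_sum)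
    qed
    have cc: "c y * c y * ip y (w y) (w y) = 1" if "y \<in> U" for y
      using pos[OF that] by (simp add: c_def flip: inverse_mult_distrib)
    have "smooth_on U (v i)" if "i \<in> insert n I" for i
      unfolding v_def using that u w
      by (auto simp: c_def intro!: smooth_on_scaleR smooth_on_inverse_sqrt sm_ip pos U)
    moreover have "ip y (v i y) (v j y) = (if i = j then 1 else 0)"
      if "y \<in> U" "i \<in> insert n I" "j \<in> insert n I" for y i j
      using that insert(2) wu[OF that(1)] orth[OF that(1)] cc[OF that(1)] sym[OF that(1)]
      by (auto simp: v_def ip_lin mult.assoc)
    moreover have "v i y $ k = 0" if "y \<in> U" "i \<in> insert n I" "k \<notin> insert n I" for y i k
      using that supp[OF that(1)] by (auto simp: v_def w_def axis_def)
    ultimately show ?case by (intro exI[of _ v]) blast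
  qed simp
  from this[of UNIV] have "\<exists>u. (\<forall>i::'n. smooth_on U (u i)) \<and>
    (\<forall>y\<in>U. \<forall>i j. ip y (u i y) (u j y) = (if i = j then 1 else 0))"
    by (simp split del: if_split)
  then obtain u where *: "(\<forall>i::'n. smooth_on U (u i)) \<and>
    (\<forall>y\<in>U. \<forall>i j. ip y (u i y) (u j y) = (if i = j then 1 else 0))" ..
  then have u: "smooth_on U (u i)"
    and orth: "y \<in> U \<Longrightarrow> ip y (u i y) (u j y) = (if i = j then 1 else 0)" for i j :: 'n and y
    by blast+
  define E :: "'a \<Rightarrow> real^'n^'n" where "E y = (\<chi> k i. u i y $ k)" for y
  have "smooth_on U E" unfolding E_def
    by (intro smooth_on_vec_lambda smooth_on_nth u U)
  moreover have "transpose (E y) ** g y ** E y = mat 1" if "y \<in> U" for y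
  proof -
    have "(transpose (E y) ** g y ** E y) $ i $ j = ip y (u i y) (u j y)" for i j
      unfolding matrix_mul_assoc[symmetric] by (simp add: ip_def E_def matrix_matrix_mult_def transpose_def
          inner_vec_def matrix_vector_mult_def)
    then show ?thesis using orth[OF that] by (simp add: vec_eq_iff mat_def)
  qed
  ultimately show ?thesis by blast
qed

section \<open>The Levi-Civita connection and its curvature\<close>

lemmas matrix_mult_linear [simp] =
  bounded_bilinear.diff_left[OF bounded_bilinear_matrix_mult]
  bounded_bilinear.diff_right[OF bounded_bilinear_matrix_mult]
  bounded_bilinear.add_left[OF bounded_bilinear_matrix_mult]
  bounded_bilinear.add_right[OF bounded_bilinear_matrix_mult]
  bounded_bilinear.minus_left[OF bounded_bilinear_matrix_mult]
  bounded_bilinear.minus_right[OF bounded_bilinear_matrix_mult]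
  bounded_bilinear.scaleR_left[OF bounded_bilinear_matrix_mult]
  bounded_bilinear.scaleR_right[OF bounded_bilinear_matrix_mult]
  bounded_bilinear.zero_left[OF bounded_bilinear_matrix_mult]
  bounded_bilinear.zero_right[OF bounded_bilinear_matrix_mult]

lemma transpose_linear [simp]:
  fixes A B :: "real^'n^'m"
  shows "transpose (A + B) = transpose A + transpose B"
    "transpose (A - B) = transpose A - transpose B"
    "transpose (- A) = - transpose A"
    "transpose (c *\<^sub>R A) = c *\<^sub>R transpose A"
    "transpose (0 :: real^'n^'m) = 0"
  by (simp_all add: transpose_def vec_eq_iff)

lemma matrix_inv_eqI:
  fixes A :: "real^'n^'n"
  assumes "A ** B = mat 1"
  shows "matrix_inv A = B"
proof -
  have BA: "B ** A = mat 1" using assms matrix_left_right_inverse by blast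
  then have "\<exists>C. A ** C = mat 1 \<and> C ** A = mat 1" using assms by blast
  then have "A ** matrix_inv A = mat 1 \<and> matrix_inv A ** A = mat 1"
    unfolding matrix_inv_def by (rule someI_ex)
  then have "matrix_inv A = matrix_inv A ** (A ** B)" "matrix_inv A ** A = mat 1" using assms by simp_all
  then show ?thesis by (simp add: matrix_mul_assoc)
qed

text \<open>
  The columns of \<open>E\<close> are an orthonormal frame and the rows of \<open>P\<close> are the dual coframe. Since
  \<open>P = E\<^sup>T h\<close>, the inverses of \<open>E\<close> and of \<open>h\<close> are polynomials in \<open>E\<close> and \<open>h\<close>, hence smooth.
\<close>

lemma coframe_of_orthonormal_frame:
  fixes h E :: "real^'n^'n"
  assumes h: "transpose h = h" and E: "transpose E ** h ** E = mat 1"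
  defines "P \<equiv> transpose E ** h"
  shows "P ** E = mat 1" "E ** P = mat 1" "h = transpose P ** P" "matrix_inv h = E ** transpose E"
proof -
  show PE: "P ** E = mat 1" using E by (simp add: P_def)
  then show EP: "E ** P = mat 1" using matrix_left_right_inverse by blast
  have PT: "transpose P = h ** E" by (simp add: P_def matrix_transpose_mul h)
  then have "transpose P ** P = h ** (E ** P)" by (simp add: matrix_mul_assoc)
  then show hP: "h = transpose P ** P" by (simp add: EP)
  have "h ** (E ** transpose E) = transpose P ** (P ** E) ** transpose E"
    by (simp add: hP matrix_mul_assoc)
  also have "\<dots> = transpose (E ** P)" by (simp add: PE matrix_transpose_mul)
  finally show "matrix_inv h = E ** transpose E" by (intro matrix_inv_eqI) (simp add: EP)
qed

lemma pos_def_matrix_inv: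
  fixes h :: "real^'n^'n"
  assumes "pos_def_matrix h"
  shows "h ** matrix_inv h = mat 1"
proof -
  have "\<exists>E :: real^'n \<Rightarrow> real^'n^'n. smooth_on UNIV E \<and> (\<forall>y\<in>UNIV. transpose (E y) ** h ** E y = mat 1)"
    by (rule gram_schmidt_smooth) (simp_all add: assms smooth_on_const)
  then obtain E :: "real^'n^'n" where E: "transpose E ** h ** E = mat 1" by blast
  have "transpose h = h" using assms by (simp add: pos_def_matrix_def)
  from coframe_of_orthonormal_frame[OF this E]
  show ?thesis
    by (metis matrix_mul_assoc matrix_mul_lid matrix_transpose_mul transpose_mat)
qed

lemma smooth_on_levi_civita:
  assumes U: "open U" and g: "smooth_on U g" and pd: "\<And>y. y \<in> U \<Longrightarrow> pos_def_matrix (g y)"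
  shows "smooth_on U (levi_civita g i)"
proof -
  obtain E :: "real^4 \<Rightarrow> real^4^4" where E: "smooth_on U E" "\<And>y. y \<in> U \<Longrightarrow> transpose (E y) ** g y ** E y = mat 1"
    using gram_schmidt_smooth[OF U g] pd by blast
  have inv: "matrix_inv (g y) = E y ** transpose (E y)" if "y \<in> U" for y
    using pd[OF that] by (intro coframe_of_orthonormal_frame(4)[OF _ E(2)[OF that]]) (simp add: pos_def_matrix_def)
  have smi: "smooth_on U (\<lambda>y. matrix_inv (g y))"
  proof -
    have "smooth_on U (\<lambda>y. E y ** transpose (E y))"
      by (intro smooth_on_matrix_mult smooth_on_transpose U E)
    then show ?thesis
      using smooth_on_cong[OF U, of "\<lambda>y. matrix_inv (g y)" "\<lambda>y. E y ** transpose (E y)"] inv by simp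
  qed
  have s1: "smooth_on U (\<lambda>x. matrix_inv (g x) $ l $ m)" for l m
    by (intro smooth_on_nth U smi)
  have s2: "smooth_on U (\<lambda>x. pd i (\<lambda>y. g y $ k $ m) x)" for i k m
    by (intro smooth_on_pd smooth_on_nth U g)
  have s3: "smooth_on U (\<lambda>x. pd i (\<lambda>y. g y $ k $ m) x + pd k (\<lambda>y. g y $ i $ m) x - pd m (\<lambda>y. g y $ i $ k) x)" for k m
    by (intro smooth_on_diff smooth_on_add U s2)
  have s4: "smooth_on U (\<lambda>x. (\<Sum>m\<in>UNIV. matrix_inv (g x) $ l $ m *
      (pd i (\<lambda>y. g y $ k $ m) x + pd k (\<lambda>y. g y $ i $ m) x - pd m (\<lambda>y. g y $ i $ k) x)) * (1/2))" for l k
    by (rule smooth_on_mult[OF U smooth_on_sum[OF U smooth_on_mult[OF U s1 s3]] smooth_on_const])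
  have "smooth_on U (\<lambda>x. \<chi> l k. (\<Sum>m\<in>UNIV. matrix_inv (g x) $ l $ m *
      (pd i (\<lambda>y. g y $ k $ m) x + pd k (\<lambda>y. g y $ i $ m) x - pd m (\<lambda>y. g y $ i $ k) x)) * (1/2))"
    by (intro smooth_on_vec_lambda U s4)
  then show ?thesis by (simp add: levi_civita_def[abs_def])
qed

context
  fixes U :: "(real^4) set" and g :: "real^4 \<Rightarrow> real^4^4"
  assumes U: "open U" and g: "smooth_on U g" and posdef: "\<And>y. y \<in> U \<Longrightarrow> pos_def_matrix (g y)"
begin

lemma metric_symmetric: "y \<in> U \<Longrightarrow> g y $ a $ b = g y $ b $ a"
proof -
  assume "y \<in> U"
  then have "transpose (g y) $ b $ a = g y $ b $ a"
    using posdef by (simp add: pos_def_matrix_def)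
  then show ?thesis by (simp add: transpose_def)
qed

lemma pd_metric_symmetric: "y \<in> U \<Longrightarrow> pd i g y $ a $ b = pd i g y $ b $ a"
  using pd_cong[OF U, of y "\<lambda>y. g y $ a $ b" "\<lambda>y. g y $ b $ a" i] metric_symmetric
  by (simp add: pd_nth2[OF g])

lemma levi_civita_torsion_free:
  assumes "y \<in> U"
  shows "levi_civita g i y $ l $ k = levi_civita g k y $ l $ i"
  using assms pd_metric_symmetric[OF assms]
  by (simp add: levi_civita_def pd_nth2[OF g] algebra_simps)

text \<open>
  The Koszul formula. Unlike the definition it has no inverse matrix, so that it can be
  differentiated directly.
\<close>

lemma levi_civita_lowered:
  assumes y: "y \<in> U"
  shows "(g y ** levi_civita g i y) $ m $ k = (pd i g y $ k $ m + pd k g y $ i $ m - pd m g y $ i $ k) / 2"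
proof -
  define s where "s k m = (pd i g y $ k $ m + pd k g y $ i $ m - pd m g y $ i $ k) / 2" for k m
  have "levi_civita g i y = matrix_inv (g y) ** (\<chi> m k. s k m)"
    by (simp add: levi_civita_def matrix_matrix_mult_def s_def pd_nth2[OF g y] sum_divide_distrib)
  then have "g y ** levi_civita g i y = (\<chi> m k. s k m)"
    by (simp add: matrix_mul_assoc pos_def_matrix_inv[OF posdef[OF y]])
  then show ?thesis by (simp add: s_def)
qed

lemma levi_civita_metric:
  assumes y: "y \<in> U"
  shows "pd i g y = transpose (levi_civita g i y) ** g y + g y ** levi_civita g i y"
proof -
  have tr: "transpose (levi_civita g i y) ** g y = transpose (g y ** levi_civita g i y)"
    using posdef[OF y] by (simp add: matrix_transpose_mul pos_def_matrix_def)
  have "(transpose (levi_civita g i y) ** g y + g y ** levi_civita g i y) $ n $ k = pd i g y $ n $ k" for n k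
    unfolding tr using pd_metric_symmetric[OF y, of i n k]
    by (simp add: transpose_def levi_civita_lowered[OF y] field_simps)
  then show ?thesis by (simp add: vec_eq_iff)
qed

end

lemma curvature_skew: "curvature A x i j = - curvature A x j i"
  by (simp add: curvature_def bracket_def)

text \<open>
  Differentiating the structure equation \<open>\<nabla>\<^sub>k e\<^sub>b = \<Sum>\<^sub>a (A\<^sub>k)\<^sub>a\<^sub>b e\<^sub>a\<close> once more and using that second
  partial derivatives commute, the commutator of covariant derivatives can be computed in two ways:
  through the connection matrices \<open>A\<close> of the frame and through the connection \<open>G\<close> of the tangent
  bundle, whose curvature acts on bilinear forms as a derivation.
\<close>

lemma curvature_in_frame:
  fixes e :: "'m::finite \<Rightarrow> real^4 \<Rightarrow> real^4^4" and A :: "4 \<Rightarrow> real^4 \<Rightarrow> real^'m^'m"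
    and G :: "4 \<Rightarrow> real^4 \<Rightarrow> real^4^4"
  assumes V: "open V" "x \<in> V" and e: "\<And>b. smooth_on V (e b)"
    and A: "\<And>k. smooth_on V (A k)" and G: "\<And>k. smooth_on V (G k)"
    and eq: "\<And>y k b. y \<in> V \<Longrightarrow> pd k (e b) y =
      (\<Sum>a\<in>UNIV. A k y $ a $ b *\<^sub>R e a y) + (transpose (G k y) ** e b y + e b y ** G k y)"
  shows "(\<Sum>a\<in>UNIV. curvature A x i j $ a $ b *\<^sub>R e a x)
    = - (transpose (curvature G x i j) ** e b x + e b x ** curvature G x i j)"
proof -
  define T where "T M w = transpose M ** w + w ** M" for M w :: "real^4^4"
  have T: "bounded_bilinear T"
    by (simp add: bilinear_conv_bounded_bilinear[symmetric] bilinear_def linear_iff T_def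
      transpose_def matrix_matrix_mult_def vec_eq_iff sum.distrib sum_distrib_left algebra_simps)
  interpret T: bounded_bilinear T by (rule T)
  have eq': "pd k (e b) y = (\<Sum>a\<in>UNIV. A k y $ a $ b *\<^sub>R e a y) + T (G k y) (e b y)" if "y \<in> V" for k b y
    using eq[OF that] by (simp add: T_def)
  have second: "pd i (pd j (e b)) x =
      (\<Sum>a\<in>UNIV. pd i (A j) x $ a $ b *\<^sub>R e a x) + (\<Sum>c\<in>UNIV. (A i x ** A j x) $ c $ b *\<^sub>R e c x)
      + (\<Sum>a\<in>UNIV. A j x $ a $ b *\<^sub>R T (G i x) (e a x)) + T (pd i (G j) x) (e b x)
      + (\<Sum>a\<in>UNIV. A i x $ a $ b *\<^sub>R T (G j x) (e a x)) + T (G j x) (T (G i x) (e b x))" for i j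
  proof -
    have sm: "smooth_on V (\<lambda>y. A j y $ a $ b)" for a
      by (intro smooth_on_nth V A)
    have "pd i (pd j (e b)) x = pd i (\<lambda>y. (\<Sum>a\<in>UNIV. A j y $ a $ b *\<^sub>R e a y) + T (G j y) (e b y)) x"
      using V by (rule pd_cong) (rule eq')
    also have "\<dots> = pd i (\<lambda>y. \<Sum>a\<in>UNIV. A j y $ a $ b *\<^sub>R e a y) x + pd i (\<lambda>y. T (G j y) (e b y)) x"
      by (rule pd_add[of V]) (intro smooth_on_sum smooth_on_scaleR smooth_on_bilinear[OF V(1) T] sm V e G)+
    also have "pd i (\<lambda>y. T (G j y) (e b y)) x = T (pd i (G j) x) (e b x) + T (G j x) (pd i (e b) x)"
      by (rule pd_bilinear[OF T G e V(2)])
    also have "pd i (\<lambda>y. \<Sum>a\<in>UNIV. A j y $ a $ b *\<^sub>R e a y) x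
        = (\<Sum>a\<in>UNIV. pd i (\<lambda>y. A j y $ a $ b *\<^sub>R e a y) x)"
      by (rule pd_sum[of _ V]) (intro smooth_on_scaleR sm V e)+
    also have "\<dots> = (\<Sum>a\<in>UNIV. pd i (A j) x $ a $ b *\<^sub>R e a x + A j x $ a $ b *\<^sub>R pd i (e a) x)"
      by (intro sum.cong refl) (simp add: pd_bilinear[OF bounded_bilinear_scaleR sm e V(2)] pd_nth2[OF A V(2)])
    also have "\<dots> = (\<Sum>a\<in>UNIV. pd i (A j) x $ a $ b *\<^sub>R e a x)
        + (\<Sum>a\<in>UNIV. \<Sum>c\<in>UNIV. (A i x $ c $ a * A j x $ a $ b) *\<^sub>R e c x)
        + (\<Sum>a\<in>UNIV. A j x $ a $ b *\<^sub>R T (G i x) (e a x))"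
      by (simp add: eq'[OF V(2)] sum.distrib scaleR_add_right scaleR_sum_right mult.commute)
    also have "(\<Sum>a\<in>UNIV. \<Sum>c\<in>UNIV. (A i x $ c $ a * A j x $ a $ b) *\<^sub>R e c x)
        = (\<Sum>c\<in>UNIV. (A i x ** A j x) $ c $ b *\<^sub>R e c x)"
      by (subst sum.swap) (simp add: matrix_matrix_mult_def scaleR_sum_left)
    also have "T (G j x) (pd i (e b) x) = (\<Sum>a\<in>UNIV. A i x $ a $ b *\<^sub>R T (G j x) (e a x)) + T (G j x) (T (G i x) (e b x))"
      by (simp add: eq'[OF V(2)] T.add_right T.sum_right T.scaleR_right)
    finally show ?thesis by (simp add: algebra_simps)
  qed
  have comm: "T (G j x) (T (G i x) w) - T (G i x) (T (G j x) w) = T (bracket (G i x) (G j x)) w" for w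
    by (simp add: T_def bracket_def matrix_transpose_mul matrix_mul_assoc)
  have "pd i (pd j (e b)) x = pd j (pd i (e b)) x"
    by (rule pd_commute[OF V(1) e V(2)])
  then have "(\<Sum>a\<in>UNIV. (pd i (A j) x $ a $ b - pd j (A i) x $ a $ b + (A i x ** A j x) $ a $ b - (A j x ** A i x) $ a $ b) *\<^sub>R e a x)
     = - (T (pd i (G j) x) (e b x) - T (pd j (G i) x) (e b x) + (T (G j x) (T (G i x) (e b x)) - T (G i x) (T (G j x) (e b x))))"
    unfolding second by (simp add: scaleR_add_left scaleR_diff_left sum.distrib sum_subtractf algebra_simps)
  then show ?thesis
    unfolding comm
    by (simp add: curvature_def bracket_def T_def algebra_simps)
qed

context
  fixes U :: "(real^4) set" and g :: "real^4 \<Rightarrow> real^4^4"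
  assumes U: "open U" and g: "smooth_on U g" and posdef: "\<And>y. y \<in> U \<Longrightarrow> pos_def_matrix (g y)"
begin

text \<open>
  The metric is a parallel bilinear form, that is a frame of rank one with vanishing connection
  matrix; so the curvature acts trivially on it.
\<close>

lemma levi_civita_curvature_skew:
  assumes x: "x \<in> U"
  shows "transpose (curvature (levi_civita g) x i j) ** g x + g x ** curvature (levi_civita g) x i j = 0"
proof -
  have "(\<Sum>a\<in>UNIV. curvature (\<lambda>_ _. 0 :: real^1^1) x i j $ a $ 1 *\<^sub>R g x)
    = - (transpose (curvature (levi_civita g) x i j) ** g x + g x ** curvature (levi_civita g) x i j)"
    by (rule curvature_in_frame[OF U x])
       (simp_all add: g smooth_on_const smooth_on_levi_civita[OF U g posdef] levi_civita_metric[OF U g posdef])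
  moreover have "curvature (\<lambda>_ _. 0 :: real^1^1) x i j = 0"
    by (simp add: curvature_def pd_const bracket_def matrix_matrix_mult_def vec_eq_iff)
  ultimately show ?thesis by (simp add: neg_eq_iff_add_eq_0)
qed

lemma levi_civita_first_bianchi:
  assumes x: "x \<in> U"
  shows "curvature (levi_civita g) x i j $ l $ k + curvature (levi_civita g) x j k $ l $ i
    + curvature (levi_civita g) x k i $ l $ j = 0"
proof -
  note sm = smooth_on_levi_civita[OF U g posdef]
  have d: "pd i (levi_civita g j) x $ l $ k = pd i (levi_civita g k) x $ l $ j" for i j k l
    using pd_cong[OF U x, of "\<lambda>y. levi_civita g j y $ l $ k" "\<lambda>y. levi_civita g k y $ l $ j" i]
      levi_civita_torsion_free[OF U g posdef] by (simp add: pd_nth2[OF sm x])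
  have b: "bracket (levi_civita g i x) (levi_civita g j x) $ l $ k
    = (\<Sum>m\<in>UNIV. levi_civita g i x $ l $ m * levi_civita g j x $ m $ k)
    - (\<Sum>m\<in>UNIV. levi_civita g j x $ l $ m * levi_civita g i x $ m $ k)" for i j k
    by (simp add: bracket_def matrix_matrix_mult_def)
  note t = levi_civita_torsion_free[OF U g posdef x]
  show ?thesis
    by (simp add: curvature_def b t[of j _ k] t[of i _ k] t[of j _ i] d[of i j l k] d[of j i l k] d[of k i l j])
qed

end

section \<open>Curvature in an orthonormal frame\<close>

lemma inner_transpose_mult: "x \<bullet> (transpose A *v y) = (A *v x) \<bullet> (y :: real^'n)"
  by (metis dot_lmul_matrix transpose_matrix_vector transpose_transpose)

lemma matrix_vector_minus: "(- A) *v (x :: real^'n) = - (A *v x)"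
  by (simp add: matrix_vector_mult_def vec_eq_iff sum_negf)

lemma inner_skew:
  fixes A :: "real^'n^'n"
  assumes "transpose A = - A"
  shows "x \<bullet> (A *v y) = - (y \<bullet> (A *v x))"
proof -
  have "x \<bullet> (A *v y) = (transpose A *v x) \<bullet> y"
    using inner_transpose_mult[of x "transpose A" y] by simp
  then show ?thesis by (simp add: assms matrix_vector_minus inner_commute)
qed

text \<open>
  The squared area of the parallelogram spanned by \<open>u\<close> and \<open>v\<close>.
\<close>

definition gram_det :: "real^'n \<Rightarrow> real^'n \<Rightarrow> real" where
  "gram_det u v = (u \<bullet> u) * (v \<bullet> v) - (u \<bullet> v)\<^sup>2"

lemma gram_det_pos:
  assumes "u \<noteq> v" "independent {u, v}"
  shows "gram_det u v > 0"
proof -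
  have u: "u \<noteq> 0" using assms(2) dependent_zero[of "{u, v}"] by auto
  define w where "w = (u \<bullet> u) *\<^sub>R v - (u \<bullet> v) *\<^sub>R u"
  have "w \<noteq> 0"
  proof
    assume "w = 0"
    then have "(1 / (u \<bullet> u)) *\<^sub>R ((u \<bullet> u) *\<^sub>R v) = (1 / (u \<bullet> u)) *\<^sub>R ((u \<bullet> v) *\<^sub>R u)"
      by (simp only: w_def right_minus_eq)
    then have "v = ((u \<bullet> v) / (u \<bullet> u)) *\<^sub>R u"
      using u by simp
    then have "v \<in> span {u}" by (metis span_base span_scale singletonI)
    then show False using assms by (simp add: insert_commute[of u] independent_insert)
  qed
  then have "0 < w \<bullet> w" by simp
  also have "w \<bullet> w = (u \<bullet> u) * gram_det u v"
    by (simp add: w_def gram_det_def inner_diff_left inner_diff_right inner_commute power2_eq_square algebra_simps)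
  finally show ?thesis using u by (metis inner_gt_zero_iff zero_less_mult_pos)
qed

text \<open>
  \<open>\<rho> p q\<close> is the endomorphism \<open>R(e\<^sub>p, e\<^sub>q)\<close> in an orthonormal frame, so \<open>\<rho> p q $ k $ l\<close> is
  \<open>\<langle>R(e\<^sub>p, e\<^sub>q) e\<^sub>l, e\<^sub>k\<rangle>\<close>.
\<close>

definition algebraic_curvature :: "(4 \<Rightarrow> 4 \<Rightarrow> real^4^4) \<Rightarrow> bool" where
  "algebraic_curvature \<rho> \<longleftrightarrow> (\<forall>p q. \<rho> p q = - \<rho> q p) \<and> (\<forall>p q. transpose (\<rho> p q) = - \<rho> p q) \<and>
     (\<forall>p q k l. \<rho> p q $ k $ l + \<rho> q l $ k $ p + \<rho> l p $ k $ q = 0)"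

text \<open>The numerator \<open>\<langle>R(u, v) v, u\<rangle>\<close> of the sectional curvature.\<close>

definition sec_num :: "(4 \<Rightarrow> 4 \<Rightarrow> real^4^4) \<Rightarrow> real^4 \<Rightarrow> real^4 \<Rightarrow> real" where
  "sec_num \<rho> u v = (\<Sum>p\<in>UNIV. \<Sum>q\<in>UNIV. u $ p * v $ q * (u \<bullet> (\<rho> p q *v v)))"

definition curvature_op :: "(real^4 \<Rightarrow> real^4^4) \<Rightarrow> real^4 \<Rightarrow> real^4 \<Rightarrow> real^4 \<Rightarrow> real^4^4" where
  "curvature_op g x u v = (\<Sum>i\<in>UNIV. \<Sum>j\<in>UNIV. (u $ i * v $ j) *\<^sub>R curvature (levi_civita g) x i j)"

lemma curvature_op_bilinear: "bilinear (curvature_op g x)"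
  by (simp add: bilinear_def linear_iff curvature_op_def sum.distrib scaleR_sum_right algebra_simps)

lemma curvature_op_swap: "curvature_op g x u v = - curvature_op g x v u"
proof -
  have "curvature_op g x u v = (\<Sum>j\<in>UNIV. \<Sum>i\<in>UNIV. (u $ i * v $ j) *\<^sub>R curvature (levi_civita g) x i j)"
    unfolding curvature_op_def by (rule sum.swap)
  also have "\<dots> = (\<Sum>j\<in>UNIV. \<Sum>i\<in>UNIV. - ((v $ j * u $ i) *\<^sub>R curvature (levi_civita g) x j i))"
    by (intro sum.cong refl) (subst curvature_skew, simp add: mult.commute)
  finally show ?thesis by (simp add: curvature_op_def sum_negf)
qed

lemma matrix_vector_mult_sum_left: "(\<Sum>i\<in>I. A i) *v (x :: real^'n) = (\<Sum>i\<in>I. A i *v x)"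
  by (induction I rule: infinite_finite_induct) (simp_all add: matrix_vector_mult_add_rdistrib)

lemma scaleR_matrix_vector: "(c *\<^sub>R A) *v (x :: real^'n) = c *\<^sub>R (A *v x)"
  by (simp add: matrix_vector_mult_def vec_eq_iff sum_distrib_left mult.assoc)

lemma riemann_eq: "riemann g x u v w = curvature_op g x u v *v w"
  by (simp add: riemann_def curvature_op_def matrix_vector_mult_sum_left scaleR_matrix_vector)

text \<open>
  The columns of \<open>E\<close> are the frame and \<open>P\<close> is the inverse of \<open>E\<close>.
\<close>

definition frame_curvature ::
  "(real^4 \<Rightarrow> real^4^4) \<Rightarrow> real^4 \<Rightarrow> real^4^4 \<Rightarrow> real^4^4 \<Rightarrow> 4 \<Rightarrow> 4 \<Rightarrow> real^4^4" where
  "frame_curvature g x E P p q = P ** curvature_op g x (column p E) (column q E) ** E"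

lemma matrix_vector_eq_sum_columns: "A *v (u :: real^'n) = (\<Sum>p\<in>UNIV. u $ p *\<^sub>R column p A)"
  by (simp add: matrix_mult_sum scalar_mult_eq_scaleR)

lemma curvature_op_frame:
  "curvature_op g x (E *v u) (E *v v)
    = (\<Sum>p\<in>UNIV. \<Sum>q\<in>UNIV. (u $ p * v $ q) *\<^sub>R curvature_op g x (column p E) (column q E))"
  unfolding matrix_vector_eq_sum_columns
  using curvature_op_bilinear[of g x]
  by (simp add: bilinear_sum sum.cartesian_product bilinear_lmul bilinear_rmul)

lemma sum3_rotate:
  "(\<Sum>i\<in>UNIV. \<Sum>j\<in>UNIV. \<Sum>k\<in>UNIV. f i j k) = (\<Sum>j\<in>(UNIV :: 'a::finite set). \<Sum>k\<in>(UNIV :: 'b::finite set). \<Sum>i\<in>(UNIV :: 'c::finite set). (f i j k :: real))"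
  by (simp add: sum.swap[of _ "UNIV :: 'c set"])

context
  fixes U :: "(real^4) set" and g :: "real^4 \<Rightarrow> real^4^4" and x :: "real^4"
  assumes U: "open U" and g: "smooth_on U g" and posdef: "\<And>y. y \<in> U \<Longrightarrow> pos_def_matrix (g y)"
    and x: "x \<in> U"
begin

lemma curvature_op_skew:
  "transpose (curvature_op g x u v) ** g x + g x ** curvature_op g x u v = 0"
proof -
  have tr: "transpose (\<Sum>i\<in>I. F i) = (\<Sum>i\<in>I. transpose (F i))" for F :: "4 \<Rightarrow> real^4^4" and I
    by (induction I rule: infinite_finite_induct) simp_all
  have "transpose (curvature_op g x u v) ** g x + g x ** curvature_op g x u v
    = (\<Sum>i\<in>UNIV. \<Sum>j\<in>UNIV. (u $ i * v $ j) *\<^sub>R (transpose (curvature (levi_civita g) x i j) ** g x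
        + g x ** curvature (levi_civita g) x i j))"
    by (simp add: curvature_op_def tr bounded_bilinear.sum_left[OF bounded_bilinear_matrix_mult]
        bounded_bilinear.sum_right[OF bounded_bilinear_matrix_mult] sum.distrib scaleR_add_right)
  then show ?thesis by (simp add: levi_civita_curvature_skew[OF U g posdef x])
qed

lemma curvature_op_bianchi:
  "curvature_op g x u v *v w + curvature_op g x v w *v u + curvature_op g x w u *v v = 0"
proof -
  define C where "C i j l k = curvature (levi_civita g) x i j $ l $ k" for i j l k
  have comp: "(curvature_op g x u v *v w) $ l = (\<Sum>i\<in>UNIV. \<Sum>j\<in>UNIV. \<Sum>k\<in>UNIV. u $ i * v $ j * w $ k * C i j l k)"
    for u v w l
    by (simp add: curvature_op_def matrix_vector_mult_sum_left scaleR_matrix_vector C_def)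
       (simp add: matrix_vector_mult_def sum_distrib_left algebra_simps)
  have "(curvature_op g x v w *v u) $ l = (\<Sum>i\<in>UNIV. \<Sum>j\<in>UNIV. \<Sum>k\<in>UNIV. u $ i * v $ j * w $ k * C j k l i)" for l
    unfolding comp by (subst (2) sum3_rotate) (simp add: algebra_simps)
  moreover have "(curvature_op g x w u *v v) $ l = (\<Sum>i\<in>UNIV. \<Sum>j\<in>UNIV. \<Sum>k\<in>UNIV. u $ i * v $ j * w $ k * C k i l j)" for l
    unfolding comp by (subst sum3_rotate) (simp add: algebra_simps)
  ultimately have "(curvature_op g x u v *v w + curvature_op g x v w *v u + curvature_op g x w u *v v) $ l
    = (\<Sum>i\<in>UNIV. \<Sum>j\<in>UNIV. \<Sum>k\<in>UNIV. u $ i * v $ j * w $ k * (C i j l k + C j k l i + C k i l j))" for l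
    by (simp add: comp sum.distrib distrib_left)
  then show ?thesis
    by (simp add: C_def levi_civita_first_bianchi[OF U g posdef x] vec_eq_iff)
qed

context
  fixes E P :: "real^4^4"
  assumes PE: "P ** E = mat 1" and gP: "g x = transpose P ** P"
begin

lemma algebraic_curvature_frame: "algebraic_curvature (frame_curvature g x E P)"
  unfolding algebraic_curvature_def
proof (intro conjI allI)
  fix p q k l
  show "frame_curvature g x E P p q = - frame_curvature g x E P q p"
    unfolding frame_curvature_def by (subst curvature_op_swap) simp
  let ?R = "curvature_op g x (column p E) (column q E)"
  have "transpose E ** (transpose ?R ** g x + g x ** ?R) ** E = 0"
    by (simp add: curvature_op_skew)
  then have "transpose E ** transpose ?R ** transpose P ** (P ** E)
    + transpose (P ** E) ** (P ** ?R ** E) = 0"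
    by (simp add: gP matrix_mul_assoc matrix_transpose_mul)
  then have "transpose (P ** ?R ** E) + P ** ?R ** E = 0"
    by (simp add: PE matrix_transpose_mul matrix_mul_assoc)
  then show "transpose (frame_curvature g x E P p q) = - frame_curvature g x E P p q"
    by (simp add: frame_curvature_def eq_neg_iff_add_eq_0)
  have comp: "frame_curvature g x E P p q $ k $ l
      = (P *v (curvature_op g x (column p E) (column q E) *v column l E)) $ k" for p q l
    by (simp add: frame_curvature_def matrix_mul_assoc[symmetric])
       (simp add: matrix_matrix_mult_def matrix_vector_mult_def column_def)
  show "frame_curvature g x E P p q $ k $ l + frame_curvature g x E P q l $ k $ p
    + frame_curvature g x E P l p $ k $ q = 0"
    unfolding comp vector_add_component[symmetric] matrix_vector_right_distrib[symmetric]
    by (simp add: curvature_op_bianchi)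
qed

lemma metric_in_frame: "(E *v u) \<bullet> (g x *v (E *v v)) = u \<bullet> v"
  unfolding gP matrix_vector_mul_assoc[of "transpose P" P, symmetric] inner_transpose_mult
  by (simp add: matrix_vector_mul_assoc PE)

lemma sectional_in_frame:
  "sectional g x (E *v u) (E *v v) = sec_num (frame_curvature g x E P) u v / gram_det u v"
proof -
  have EP: "E ** P = mat 1" using PE matrix_left_right_inverse by blast
  have "curvature_op g x (E *v u) (E *v v) *v (E *v v)
    = E *v ((P ** curvature_op g x (E *v u) (E *v v) ** E) *v v)"
    by (simp add: matrix_vector_mul_assoc matrix_mul_assoc EP)
  also have "P ** curvature_op g x (E *v u) (E *v v) ** E
      = (\<Sum>p\<in>UNIV. \<Sum>q\<in>UNIV. (u $ p * v $ q) *\<^sub>R frame_curvature g x E P p q)"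
    by (simp add: curvature_op_frame frame_curvature_def
        bounded_bilinear.sum_left[OF bounded_bilinear_matrix_mult]
        bounded_bilinear.sum_right[OF bounded_bilinear_matrix_mult])
  finally have R: "riemann g x (E *v u) (E *v v) (E *v v)
    = E *v ((\<Sum>p\<in>UNIV. \<Sum>q\<in>UNIV. (u $ p * v $ q) *\<^sub>R frame_curvature g x E P p q) *v v)"
    by (simp add: riemann_eq)
  have "riemann g x (E *v u) (E *v v) (E *v v) \<bullet> (g x *v (E *v u)) = sec_num (frame_curvature g x E P) u v"
    unfolding R metric_in_frame
    by (simp add: sec_num_def matrix_vector_mult_sum_left
        scaleR_matrix_vector inner_sum_left inner_commute[of u])
  then show ?thesis
    by (simp add: sectional_def Let_def metric_in_frame gram_det_def)
qed

text \<open>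
  The frame identifies the tangent space with Euclidean space, and it permutes the bases of planes.
  From here on curvature at a point is a problem about \<open>algebraic_curvature\<close> tensors.
\<close>

lemma sectional_curvatures_in_frame:
  "sectional_curvatures g x = {sec_num (frame_curvature g x E P) u v / gram_det u v |u v.
     u \<noteq> v \<and> independent {u, v}}"
proof -
  have EP: "E ** P = mat 1" using PE matrix_left_right_inverse by blast
  have inv: "E *v (P *v u) = u" "P *v (E *v u) = u" for u
    by (simp_all add: matrix_vector_mul_assoc PE EP)
  have inj: "inj ((*v) A) \<Longrightarrow> u \<noteq> v \<and> independent {u, v} \<Longrightarrow> A *v u \<noteq> A *v v \<and> independent {A *v u, A *v v}"
    for A :: "real^4^4" and u v
    using linear_independent_injective_image[of "(*v) A" "{u, v}"] inj_on_subset[of "(*v) A" UNIV]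
    by (auto simp: inj_eq)
  have injE: "inj ((*v) E)" "inj ((*v) P)" using inv by (metis injI)+
  show ?thesis
  proof (intro equalityI subsetI)
    fix k assume "k \<in> sectional_curvatures g x"
    then obtain u v where uv: "k = sectional g x u v" "u \<noteq> v \<and> independent {u, v}"
      unfolding sectional_curvatures_def by blast
    then show "k \<in> {sec_num (frame_curvature g x E P) u v / gram_det u v |u v. u \<noteq> v \<and> independent {u, v}}"
      using sectional_in_frame[of "P *v u" "P *v v"] inj[OF injE(2) uv(2)] inv by auto
  next
    fix k assume "k \<in> {sec_num (frame_curvature g x E P) u v / gram_det u v |u v. u \<noteq> v \<and> independent {u, v}}"
    then obtain u v where uv: "k = sec_num (frame_curvature g x E P) u v / gram_det u v"
      "u \<noteq> v \<and> independent {u, v}" by blast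
    then show "k \<in> sectional_curvatures g x"
      using inj[OF injE(1) uv(2)] unfolding sectional_curvatures_def uv(1) sectional_in_frame[symmetric]
      by blast
  qed
qed

end

end

section \<open>Two-forms in dimension four\<close>

lemma vector_4 [simp]:
  "(vector [w,x,y,z] :: ('a::zero)^4) $ 1 = w"
  "(vector [w,x,y,z] :: ('a::zero)^4) $ 2 = x"
  "(vector [w,x,y,z] :: ('a::zero)^4) $ 3 = y"
  "(vector [w,x,y,z] :: ('a::zero)^4) $ 4 = z"
  unfolding vector_def by simp_all

lemma det_4: "det (A :: real^4^4) =
    A$1$1 * (A$2$2 * (A$3$3 * A$4$4 - A$3$4 * A$4$3) - A$2$3 * (A$3$2 * A$4$4 - A$3$4 * A$4$2) + A$2$4 * (A$3$2 * A$4$3 - A$3$3 * A$4$2))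
  - A$1$2 * (A$2$1 * (A$3$3 * A$4$4 - A$3$4 * A$4$3) - A$2$3 * (A$3$1 * A$4$4 - A$3$4 * A$4$1) + A$2$4 * (A$3$1 * A$4$3 - A$3$3 * A$4$1))
  + A$1$3 * (A$2$1 * (A$3$2 * A$4$4 - A$3$4 * A$4$2) - A$2$2 * (A$3$1 * A$4$4 - A$3$4 * A$4$1) + A$2$4 * (A$3$1 * A$4$2 - A$3$2 * A$4$1))
  - A$1$4 * (A$2$1 * (A$3$2 * A$4$3 - A$3$3 * A$4$2) - A$2$2 * (A$3$1 * A$4$3 - A$3$3 * A$4$1) + A$2$3 * (A$3$1 * A$4$2 - A$3$2 * A$4$1))"
proof -
  have f1234: "finite {2::4, 3, 4}" "1 \<notin> {2::4, 3, 4}" by auto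
  have f234: "finite {3::4, 4}" "2 \<notin> {3::4, 4}" by auto
  have f34: "finite {4::4}" "3 \<notin> {4::4}" by auto
  have f4: "finite ({} :: 4 set)" "4 \<notin> ({} :: 4 set)" by auto
  show ?thesis
    unfolding det_def UNIV_4
    unfolding sum_over_permutations_insert[OF f1234]
    unfolding sum_over_permutations_insert[OF f234]
    unfolding sum_over_permutations_insert[OF f34]
    unfolding sum_over_permutations_insert[OF f4]
    unfolding permutes_sing
    by (simp add: sign_swap_id permutation_swap_id permutation_compose sign_compose sign_id
      swap_id_eq algebra_simps)
qed

text \<open>
  With the standard two-forms \<open>e\<^sub>i\<^sub>j\<close>, these are \<open>a\<^sub>1 (e\<^sub>1\<^sub>2 + e\<^sub>3\<^sub>4) + a\<^sub>2 (e\<^sub>1\<^sub>3 - e\<^sub>2\<^sub>4) + a\<^sub>3 (e\<^sub>1\<^sub>4 + e\<^sub>2\<^sub>3)\<close> and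
  \<open>a\<^sub>1 (e\<^sub>1\<^sub>2 - e\<^sub>3\<^sub>4) + a\<^sub>2 (e\<^sub>1\<^sub>3 + e\<^sub>2\<^sub>4) + a\<^sub>3 (e\<^sub>1\<^sub>4 - e\<^sub>2\<^sub>3)\<close>, the self-dual and the anti-self-dual forms
  of Euclidean space. As matrices they are two commuting copies of the imaginary quaternions.
\<close>

definition sd :: "real^3 \<Rightarrow> real^4^4" where
  "sd a = vector [vector [0, a$1, a$2, a$3], vector [- a$1, 0, a$3, - a$2],
     vector [- a$2, - a$3, 0, a$1], vector [- a$3, a$2, - a$1, 0]]"

definition asd :: "real^3 \<Rightarrow> real^4^4" where
  "asd a = vector [vector [0, a$1, a$2, a$3], vector [- a$1, 0, - a$3, a$2],
     vector [- a$2, a$3, 0, - a$1], vector [- a$3, - a$2, a$1, 0]]"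

text \<open>
  The Euclidean Hodge star. On skew matrices it is also the adjoint with respect to the Pfaffian:
  \<open>w ** hodge w\<close> is minus the Pfaffian of \<open>w\<close> times the identity.
\<close>

definition hodge :: "real^4^4 \<Rightarrow> real^4^4" where
  "hodge w = vector [vector [0, w$3$4, - w$2$4, w$2$3], vector [- w$3$4, 0, w$1$4, - w$1$3],
     vector [w$2$4, - w$1$4, 0, w$1$2], vector [- w$2$3, w$1$3, - w$1$2, 0]]"

lemmas forms_expand = sd_def asd_def hodge_def wedge_def inner_vec_def sum_4 sum_3
  vec_eq_iff forall_4 forall_3 matrix_matrix_mult_def transpose_def mat_def

lemma two_form_components:
  assumes "two_form w"
  shows "w $ i $ i = 0" "w $ j $ i = - w $ i $ j"
proof -
  have *: "transpose w $ i $ j = - w $ i $ j" for i j using assms by (simp add: two_form_def)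
  show "w $ j $ i = - w $ i $ j" "w $ i $ i = 0"
    using *[of i j] *[of i i] by (simp_all add: transpose_def)
qed

lemma two_form_split:
  assumes "two_form w"
  obtains a b where "w = sd a + asd b"
proof
  note c = two_form_components[OF assms]
  show "w = sd (vector [(w$1$2 + w$3$4)/2, (w$1$3 - w$2$4)/2, (w$1$4 + w$2$3)/2])
      + asd (vector [(w$1$2 - w$3$4)/2, (w$1$3 + w$2$4)/2, (w$1$4 - w$2$3)/2])"
    using c(2)[of 2 1] c(2)[of 3 1] c(2)[of 4 1] c(2)[of 3 2] c(2)[of 4 2] c(2)[of 4 3] c(1)
    by (simp add: forms_expand field_simps)
qed

lemma two_form_sd [simp]: "two_form (sd a)" and two_form_asd [simp]: "two_form (asd a)"
  by (simp_all add: two_form_def forms_expand)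

lemma two_form_lin [simp]:
  "two_form v \<Longrightarrow> two_form w \<Longrightarrow> two_form (v + w)" "two_form w \<Longrightarrow> two_form (c *\<^sub>R w)"
  "two_form w \<Longrightarrow> two_form (transpose E ** w ** E)" "two_form (0 :: real^4^4)"
  by (simp_all add: two_form_def matrix_transpose_mul matrix_mul_assoc)

lemma linear_sd: "linear sd" and linear_asd: "linear asd" and linear_hodge: "linear hodge"
  by (simp_all add: linear_iff forms_expand algebra_simps)

lemma inner_sd_sd: "sd a \<bullet> sd b = 4 * (a \<bullet> b)" and inner_asd_asd: "asd a \<bullet> asd b = 4 * (a \<bullet> b)"
  and inner_sd_asd: "sd a \<bullet> asd b = 0" and inner_asd_sd: "asd a \<bullet> sd b = 0"
  by (simp_all add: forms_expand)

lemma hodge_sd: "hodge (sd a) = sd a" and hodge_asd: "hodge (asd a) = - asd a"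
  by (simp_all add: forms_expand)

lemma wedge_eq_inner_hodge: "two_form v \<Longrightarrow> wedge v w = (v \<bullet> hodge w) / 2"
proof -
  assume "two_form v"
  then obtain a b where v: "v = sd a + asd b" by (rule two_form_split)
  show "wedge v w = (v \<bullet> hodge w) / 2"
    unfolding v by (simp add: forms_expand field_simps)
qed

lemma wedge_linear: "wedge (u + v) w = wedge u w + wedge v w" "wedge u (v + w) = wedge u v + wedge u w"
  "wedge (c *\<^sub>R u) w = c * wedge u w" "wedge u (c *\<^sub>R w) = c * wedge u w"
  "wedge (- u) w = - wedge u w" "wedge u (- w) = - wedge u w"
  by (simp_all add: wedge_def algebra_simps)

lemma wedge_sd: "wedge (sd a) (sd b) = 2 * (a \<bullet> b)" "wedge (asd a) (asd b) = - 2 * (a \<bullet> b)"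
  "wedge (sd a) (asd b) = 0" "wedge (asd a) (sd b) = 0"
  by (simp_all add: forms_expand algebra_simps)

lemma sd_mult: "sd a ** sd b = - ((a \<bullet> b) *\<^sub>R mat 1) - sd (cross3 a b)"
  and asd_mult: "asd a ** asd b = - ((a \<bullet> b) *\<^sub>R mat 1) + asd (cross3 a b)"
  and sd_asd_commute: "sd a ** asd b = asd b ** sd a"
  by (simp_all add: forms_expand cross3_def algebra_simps)

text \<open>
  For \<open>v = w\<close> this is the identity between a skew matrix and its Pfaffian adjoint, \<open>wedge w w / 2\<close>
  being the Pfaffian; polarisation turns wedge-orthogonal forms into anticommuting matrices.
\<close>

lemma hodge_polar:
  assumes "two_form v" "two_form w"
  shows "v ** hodge w + w ** hodge v = - (wedge v w *\<^sub>R mat 1)"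
    "hodge v ** w + hodge w ** v = - (wedge v w *\<^sub>R mat 1)"
proof -
  obtain a b c d where vw: "v = sd a + asd b" "w = sd c + asd d"
    using assms two_form_split by metis
  show "v ** hodge w + w ** hodge v = - (wedge v w *\<^sub>R mat 1)"
    "hodge v ** w + hodge w ** v = - (wedge v w *\<^sub>R mat 1)"
    by (simp_all add: vw forms_expand algebra_simps)
qed

text \<open>
  The coefficients of the left-hand side, as a bilinear form in \<open>v\<close> and \<open>w\<close>, are sums of products of
  complementary \<open>2 \<times> 2\<close> minors of \<open>E\<close>. By Laplace expansion such a sum is a determinant with rows
  chosen from \<open>E\<close>, which vanishes unless all four rows occur.
\<close>

lemma wedge_pullback:
  assumes "two_form v" "two_form w"
  shows "wedge (transpose E ** v ** E) (transpose E ** w ** E) = det E * wedge v w"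
proof -
  define m where "m i j p q = E$i$p * E$j$q - E$j$p * E$i$q" for i j p q
  have pb: "(transpose E ** v ** E) $ p $ q = v$1$2 * m 1 2 p q + v$1$3 * m 1 3 p q + v$1$4 * m 1 4 p q
     + v$2$3 * m 2 3 p q + v$2$4 * m 2 4 p q + v$3$4 * m 3 4 p q" if "two_form v" for v p q
  proof -
    note c = two_form_components[OF that]
    show ?thesis
      using c(2)[of 2 1] c(2)[of 3 1] c(2)[of 4 1] c(2)[of 3 2] c(2)[of 4 2] c(2)[of 4 3] c(1)
      by (simp add: m_def matrix_matrix_mult_def transpose_def sum_4 algebra_simps)
  qed
  \<comment> \<open>Laplace expansion of the determinant with rows \<open>i, j, k, l\<close> of \<open>E\<close>.\<close>
  define L where "L i j k l = m i j 1 2 * m k l 3 4 - m i j 1 3 * m k l 2 4 + m i j 1 4 * m k l 2 3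
     + m i j 2 3 * m k l 1 4 - m i j 2 4 * m k l 1 3 + m i j 3 4 * m k l 1 2" for i j k l
  have L1: "L i j k l = L k l i j" for i j k l by (simp add: L_def)
  have L0: "L i j i l = 0" "L i j k j = 0" "L i j k i = 0" "L i j j l = 0" for i j k l
    by (simp_all add: L_def m_def algebra_simps)
  have Ld: "L 1 2 3 4 = det E" "L 1 3 2 4 = - det E" "L 1 4 2 3 = det E"
    by (simp_all add: L_def m_def det_4 algebra_simps)
  then have Ld': "L 3 4 1 2 = det E" "L 2 4 1 3 = - det E" "L 2 3 1 4 = det E"
    using L1 by metis+
  have "wedge (transpose E ** v ** E) (transpose E ** w ** E) =
    v$1$2 * (w$1$2 * L 1 2 1 2 + w$1$3 * L 1 2 1 3 + w$1$4 * L 1 2 1 4 + w$2$3 * L 1 2 2 3 + w$2$4 * L 1 2 2 4 + w$3$4 * L 1 2 3 4)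
  + v$1$3 * (w$1$2 * L 1 3 1 2 + w$1$3 * L 1 3 1 3 + w$1$4 * L 1 3 1 4 + w$2$3 * L 1 3 2 3 + w$2$4 * L 1 3 2 4 + w$3$4 * L 1 3 3 4)
  + v$1$4 * (w$1$2 * L 1 4 1 2 + w$1$3 * L 1 4 1 3 + w$1$4 * L 1 4 1 4 + w$2$3 * L 1 4 2 3 + w$2$4 * L 1 4 2 4 + w$3$4 * L 1 4 3 4)
  + v$2$3 * (w$1$2 * L 2 3 1 2 + w$1$3 * L 2 3 1 3 + w$1$4 * L 2 3 1 4 + w$2$3 * L 2 3 2 3 + w$2$4 * L 2 3 2 4 + w$3$4 * L 2 3 3 4)
  + v$2$4 * (w$1$2 * L 2 4 1 2 + w$1$3 * L 2 4 1 3 + w$1$4 * L 2 4 1 4 + w$2$3 * L 2 4 2 3 + w$2$4 * L 2 4 2 4 + w$3$4 * L 2 4 3 4)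
  + v$3$4 * (w$1$2 * L 3 4 1 2 + w$1$3 * L 3 4 1 3 + w$1$4 * L 3 4 1 4 + w$2$3 * L 3 4 2 3 + w$2$4 * L 3 4 2 4 + w$3$4 * L 3 4 3 4)"
    unfolding wedge_def pb[OF assms(1)] pb[OF assms(2)] L_def by (simp add: algebra_simps)
  then show ?thesis
    unfolding L0 Ld Ld' by (simp add: wedge_def algebra_simps)
qed

section \<open>Self-dual forms and conformal structures\<close>

lemma inner_matrix_mult_left: "(A ** B) \<bullet> C = B \<bullet> (transpose A ** (C :: real^'n^'m))"
  for A :: "real^'k^'m"
proof -
  have "(A ** B) \<bullet> C = (\<Sum>i\<in>UNIV. \<Sum>j\<in>UNIV. \<Sum>k\<in>UNIV. A $ i $ k * B $ k $ j * C $ i $ j)"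
    by (simp add: inner_vec_def matrix_matrix_mult_def sum_distrib_right)
  also have "\<dots> = (\<Sum>i\<in>UNIV. \<Sum>k\<in>UNIV. \<Sum>j\<in>UNIV. A $ i $ k * B $ k $ j * C $ i $ j)"
    by (intro sum.cong refl) (rule sum.swap)
  also have "\<dots> = (\<Sum>k\<in>UNIV. \<Sum>i\<in>UNIV. \<Sum>j\<in>UNIV. A $ i $ k * B $ k $ j * C $ i $ j)"
    by (rule sum.swap)
  also have "\<dots> = (\<Sum>k\<in>UNIV. \<Sum>j\<in>UNIV. \<Sum>i\<in>UNIV. A $ i $ k * B $ k $ j * C $ i $ j)"
    by (intro sum.cong refl) (rule sum.swap)
  finally show ?thesis
    by (simp add: inner_vec_def matrix_matrix_mult_def transpose_def sum_distrib_left algebra_simps)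
qed

lemma inner_transpose_transpose: "transpose A \<bullet> transpose B = A \<bullet> (B :: real^'n^'m)"
  unfolding inner_vec_def transpose_def by (simp add: sum.swap[of _ "UNIV :: 'n set"])

lemma inner_matrix_mult_right: "(A ** B) \<bullet> C = A \<bullet> ((C :: real^'n^'m) ** transpose B)"
  for B :: "real^'n^'k"
  using inner_matrix_mult_left[of "transpose B" "transpose A" "transpose C"]
  by (simp add: matrix_transpose_mul[symmetric] inner_transpose_transpose)
     (metis inner_transpose_transpose matrix_transpose_mul transpose_transpose)

lemma form_inner_eq: "form_inner h v w = (v \<bullet> (matrix_inv h ** w ** transpose (matrix_inv h))) / 2"
proof -
  have "(\<Sum>i\<in>UNIV. \<Sum>j\<in>UNIV. \<Sum>k\<in>UNIV. \<Sum>l\<in>UNIV. matrix_inv h $ i $ k * matrix_inv h $ j $ l * v$i$j * w$k$l)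
    = (\<Sum>i\<in>UNIV. \<Sum>j\<in>UNIV. \<Sum>l\<in>UNIV. \<Sum>k\<in>UNIV. matrix_inv h $ i $ k * matrix_inv h $ j $ l * v$i$j * w$k$l)"
    by (rule sum.cong[OF refl], rule sum.cong[OF refl], rule sum.swap)
  then show ?thesis
    by (simp add: form_inner_def inner_vec_def matrix_matrix_mult_def transpose_def sum_distrib_left
        sum_distrib_right algebra_simps)
qed

lemma independent_range_linear_axis:
  fixes f :: "real^'n \<Rightarrow> 'b::real_vector"
  assumes "linear f" "inj f"
  shows "independent (range (\<lambda>i. f (axis i 1)))"
proof -
  have "range (\<lambda>i. axis i 1 :: real^'n) \<subseteq> Basis" by (auto simp: axis_in_Basis_iff)
  then have "independent (range (\<lambda>i. axis i 1 :: real^'n))"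
    using independent_Basis independent_mono by blast
  then have "independent (f ` range (\<lambda>i. axis i 1))"
    using assms by (intro linear_independent_injective_image) (auto intro: inj_on_subset)
  then show ?thesis by (simp add: image_image)
qed

context
  fixes P E :: "real^4^4"
  assumes PE: "P ** E = mat 1"
begin

lemma inverse_right: "E ** P = mat 1"
  using PE matrix_left_right_inverse by blast

lemma matrix_inv_pullback: "matrix_inv (transpose P ** P) = E ** transpose E"
proof (rule matrix_inv_eqI)
  have "transpose P ** P ** (E ** transpose E) = transpose P ** (P ** E) ** transpose E"
    by (simp add: matrix_mul_assoc)
  then show "transpose P ** P ** (E ** transpose E) = mat 1"
    by (simp add: PE matrix_transpose_mul[symmetric] inverse_right)
qed

lemma pullback_inverse:
  "transpose P ** (transpose E ** w ** E) ** P = w" "transpose E ** (transpose P ** w ** P) ** E = w"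
proof -
  have "transpose P ** (transpose E ** w ** E) ** P = transpose (E ** P) ** w ** (E ** P)"
    "transpose E ** (transpose P ** w ** P) ** E = transpose (P ** E) ** w ** (P ** E)"
    by (simp_all add: matrix_transpose_mul matrix_mul_assoc)
  then show "transpose P ** (transpose E ** w ** E) ** P = w" "transpose E ** (transpose P ** w ** P) ** E = w"
    by (simp_all add: PE inverse_right)
qed

lemma form_inner_pullback:
  "form_inner (transpose P ** P) (transpose P ** v ** P) (transpose P ** w ** P) = (v \<bullet> w) / 2"
proof -
  have "E ** transpose E ** (transpose P ** w ** P) ** transpose (E ** transpose E)
    = E ** (transpose E ** (transpose P ** w ** P) ** E) ** transpose E"
    by (simp add: matrix_transpose_mul matrix_mul_assoc)
  also have "\<dots> = E ** w ** transpose E" by (simp add: pullback_inverse)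
  finally have "form_inner (transpose P ** P) (transpose P ** v ** P) (transpose P ** w ** P)
    = (v \<bullet> ((P ** E) ** w ** transpose (P ** E))) / 2"
    by (simp add: form_inner_eq matrix_inv_pullback inner_matrix_mult_right[of _ P] inner_matrix_mult_left[of "transpose P"]
        matrix_transpose_mul matrix_mul_assoc)
  then show ?thesis by (simp add: PE)
qed

lemma det_pullback_nonzero: "det P \<noteq> 0"
  using arg_cong[OF PE, of det] by (auto simp: det_mul)

lemma pos_def_pullback: "pos_def_matrix (transpose P ** P)"
proof -
  have "v \<bullet> ((transpose P ** P) *v v) > 0" if "v \<noteq> 0" for v
  proof -
    have "E *v (P *v v) = v" by (simp add: matrix_vector_mul_assoc inverse_right)
    then have "P *v v \<noteq> 0" using that by auto
    then show ?thesis
      unfolding matrix_vector_mul_assoc[symmetric] inner_transpose_mult by simp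
  qed
  then show ?thesis by (simp add: pos_def_matrix_def matrix_transpose_mul)
qed

text \<open>
  Both sides are transported by \<open>P\<close> from Euclidean space. An orientation-reversing \<open>P\<close> takes the
  standard self-dual forms to the self-dual forms of the opposite orientation, so one standard model
  serves for both signs \<open>\<sigma>\<close>.
\<close>

lemma self_dual_forms_pullback:
  assumes \<sigma>: "\<sigma> \<in> {1, -1}" "\<sigma> * det P > 0"
  shows "self_dual_forms (transpose P ** P) \<sigma> = range (\<lambda>a. transpose P ** sd a ** P)"
proof -
  have vol: "\<sigma> * sqrt (det (transpose P ** P)) = det P"
    using \<sigma> by (auto simp: det_mul zero_less_mult_iff)
  have sd_iff: "(\<forall>v. two_form v \<longrightarrow> wedge v w = (v \<bullet> w) / 2) \<longleftrightarrow> w \<in> range sd" if "two_form w" for w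
  proof -
    obtain a b where w: "w = sd a + asd b" using two_form_split[OF \<open>two_form w\<close>] by blast
    have hw: "hodge w = sd a - asd b"
      by (simp add: w linear_add[OF linear_hodge] hodge_sd hodge_asd)
    have "wedge v w = (v \<bullet> w) / 2 \<longleftrightarrow> v \<bullet> asd b = 0" if "two_form v" for v
    proof -
      have "wedge v w - (v \<bullet> w) / 2 = - (v \<bullet> asd b)"
        unfolding wedge_eq_inner_hodge[OF that] hw
        by (simp add: w inner_diff_right inner_add_right field_simps)
      then show ?thesis by linarith
    qed
    then have *: "(\<forall>v. two_form v \<longrightarrow> wedge v w = (v \<bullet> w) / 2) \<longleftrightarrow> (\<forall>v. two_form v \<longrightarrow> v \<bullet> asd b = 0)"
      by blast
    show ?thesis
    proof
      assume "\<forall>v. two_form v \<longrightarrow> wedge v w = (v \<bullet> w) / 2"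
      then have "asd b \<bullet> asd b = 0" unfolding * by simp
      then show "w \<in> range sd" by (simp add: w)
    next
      assume "w \<in> range sd"
      then obtain c where "w = sd c" by blast
      then have "hodge w = w" by (simp add: hodge_sd)
      then have "asd b = - asd b" using hw w by (simp add: algebra_simps)
      then show "\<forall>v. two_form v \<longrightarrow> wedge v w = (v \<bullet> w) / 2" unfolding *
        by (metis eq_neg_iff_add_eq_0 inner_zero_right scaleR_2 scaleR_eq_0_iff zero_neq_numeral)
    qed
  qed
  have pb: "transpose P ** w ** P \<in> self_dual_forms (transpose P ** P) \<sigma> \<longleftrightarrow> w \<in> range sd" if w: "two_form w" for w
  proof -
    have all: "(\<forall>v. two_form v \<longrightarrow> Q v) \<longleftrightarrow> (\<forall>v. two_form v \<longrightarrow> Q (transpose P ** v ** P))" for Q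
      by (metis pullback_inverse(1) two_form_lin(3))
    have "transpose P ** w ** P \<in> self_dual_forms (transpose P ** P) \<sigma> \<longleftrightarrow>
      (\<forall>v. two_form v \<longrightarrow> wedge v (transpose P ** w ** P)
        = form_inner (transpose P ** P) v (transpose P ** w ** P) * det P)"
      using w by (simp add: self_dual_forms_def is_hodge_star_def vol)
    also have "\<dots> \<longleftrightarrow> (\<forall>v. two_form v \<longrightarrow> wedge v w = (v \<bullet> w) / 2)"
      by (subst all) (use w det_pullback_nonzero in \<open>auto simp: wedge_pullback form_inner_pullback\<close>)
    finally show ?thesis using sd_iff[OF w] by simp
  qed
  show ?thesis
  proof (intro equalityI subsetI)
    fix w assume w: "w \<in> self_dual_forms (transpose P ** P) \<sigma>"
    then have tf: "two_form (transpose E ** w ** E)" by (simp add: self_dual_forms_def)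
    from w pb[OF tf] obtain a where "transpose E ** w ** E = sd a" by (auto simp: pullback_inverse)
    then have "w = transpose P ** sd a ** P" using pullback_inverse(1)[of w] by simp
    then show "w \<in> range (\<lambda>a. transpose P ** sd a ** P)" by blast
  next
    fix w assume "w \<in> range (\<lambda>a. transpose P ** sd a ** P)"
    then show "w \<in> self_dual_forms (transpose P ** P) \<sigma>" using pb by auto
  qed
qed

text \<open>
  Raising an index turns the pullback of forms into the conjugation of endomorphisms, which preserves
  brackets. The factor \<open>- 1/2\<close> normalises \<open>[sd a, sd b] = - 2 sd (a \<times> b)\<close>.
\<close>

lemma oriented_form_basis_pullback:
  assumes \<sigma>: "\<sigma> \<in> {1, -1}" "\<sigma> * det P > 0"
  shows "oriented_form_basis (transpose P ** P) \<sigma> (\<lambda>i. - (1/2) *\<^sub>R (transpose P ** sd (axis i 1) ** P))"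
proof -
  define f where "f a = - (1/2) *\<^sub>R (E ** sd a ** P)" for a
  have f: "linear f"
    by (simp add: f_def linear_iff linear_add[OF linear_sd] linear_scale[OF linear_sd] scaleR_add_right)
  have "a = 0" if "f a = 0" for a
  proof -
    have "E ** sd a ** P = 0" using that by (simp add: f_def)
    then have "P ** (E ** sd a ** P) ** E = 0" by simp
    then have "(P ** E) ** sd a ** (P ** E) = 0" by (simp add: matrix_mul_assoc)
    then have "sd a = 0" by (simp add: PE)
    then show ?thesis using inner_sd_sd[of a a] by simp
  qed
  then have inj: "inj f" using f linear_injective_0 by blast
  have br: "bracket (f a) (f b) = f (cross3 a b)" for a b
  proof -
    have "E ** sd a ** P ** (E ** sd b ** P) = E ** (sd a ** sd b) ** P" for a b
    proof -
      have "E ** sd a ** P ** (E ** sd b ** P) = E ** sd a ** (P ** E) ** sd b ** P"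
        by (simp add: matrix_mul_assoc)
      then show ?thesis by (simp add: PE matrix_mul_assoc)
    qed
    then have "bracket (f a) (f b) = (1/4) *\<^sub>R (E ** (sd a ** sd b - sd b ** sd a) ** P)"
      by (simp add: bracket_def f_def scaleR_diff_right)
    also have "sd a ** sd b - sd b ** sd a = (-2) *\<^sub>R sd (cross3 a b)"
      by (simp add: sd_mult inner_commute cross_skew[of b a] linear_neg[OF linear_sd] algebra_simps scaleR_2)
    finally show ?thesis by (simp add: f_def)
  qed
  have sharp: "sharp (transpose P ** P) (- (1/2) *\<^sub>R (transpose P ** sd a ** P)) = f a" for a
  proof -
    have "E ** transpose E ** (transpose P ** sd a ** P) = E ** (transpose (P ** E)) ** sd a ** P"
      by (simp add: matrix_transpose_mul matrix_mul_assoc)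
    then show ?thesis by (simp add: sharp_def matrix_inv_pullback PE f_def)
  qed
  have "so3_basis (\<lambda>i. f (axis i 1))"
    unfolding so3_basis_def br
    using independent_range_linear_axis[OF f inj]
    by (simp add: cross_basis inj_def inj_eq[OF inj] axis_eq_axis)
  moreover have "- (1/2) *\<^sub>R (transpose P ** sd a ** P) \<in> self_dual_forms (transpose P ** P) \<sigma>" for a
    unfolding self_dual_forms_pullback[OF \<sigma>]
    by (rule range_eqI[of _ _ "- (1/2) *\<^sub>R a"]) (simp add: linear_scale[OF linear_sd] linear_neg[OF linear_sd])
  ultimately show ?thesis
    unfolding oriented_form_basis_def sharp by blast
qed

end

text \<open>
  For \<open>G = B B\<^sup>T\<close> the difference \<open>det (1 + G) - det G\<close> is 1 plus the trace and the principal
  \<open>2 \<times> 2\<close> minors of \<open>G\<close>, which are nonnegative.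
\<close>

lemma det_gram_gt:
  fixes A B :: "real^3^3"
  assumes "A ** transpose A = mat 1 + B ** transpose B"
  shows "(det B)\<^sup>2 < (det A)\<^sup>2"
proof -
  define G where "G = B ** transpose B"
  have G: "G $ i $ j = B $ i \<bullet> B $ j" for i j
    by (simp add: G_def matrix_matrix_mult_def transpose_def inner_vec_def)
  have diag: "G $ i $ i \<ge> 0" for i by (simp add: G)
  have minor: "G $ i $ j * G $ i $ j \<le> G $ i $ i * G $ j $ j" for i j
    using Cauchy_Schwarz_ineq[of "B $ i" "B $ j"] by (simp add: G power2_eq_square)
  have sym: "G $ i $ j = G $ j $ i" for i j by (simp add: G inner_commute)
  have "(det A)\<^sup>2 = det (mat 1 + G)"
    using arg_cong[OF assms, of det] by (simp add: det_mul G_def power2_eq_square)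
  also have "\<dots> = 1 + (G$1$1 + G$2$2 + G$3$3) + (G$1$1 * G$2$2 - G$1$2 * G$1$2)
      + (G$1$1 * G$3$3 - G$1$3 * G$1$3) + (G$2$2 * G$3$3 - G$2$3 * G$2$3) + det G"
    by (simp add: det_3 mat_def sym[of 2 1] sym[of 3 1] sym[of 3 2] algebra_simps)
  finally have "(det A)\<^sup>2 \<ge> 1 + det G"
    using diag[of 1] diag[of 2] diag[of 3] minor[of 1 2] minor[of 1 3] minor[of 2 3] by linarith
  moreover have "det G = (det B)\<^sup>2" by (simp add: G_def det_mul power2_eq_square)
  ultimately show ?thesis by simp
qed

text \<open>
  For the standard self-dual forms the product is the identity matrix. For wedge-orthonormal forms it
  is, up to a factor, the metric that makes the forms self-dual; its trace decides the sign of this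
  factor. The mixed terms have trace zero, since the product of two imaginary quaternions of one copy
  and one of the other has no scalar part.
\<close>

lemma trace_triple_forms:
  fixes p q :: "3 \<Rightarrow> real^3"
  defines "w \<equiv> \<lambda>i. sd (p i) + asd (q i)"
  shows "trace (- (w 1 ** hodge (w 3) ** w 2)) = 4 * (det (\<chi> i. p i) + det (\<chi> i. q i))"
  unfolding w_def linear_add[OF linear_hodge] hodge_sd hodge_asd
  by (simp add: matrix_mul_assoc sd_mult asd_mult) 
     (simp add: trace_def forms_expand det_3 cross3_def algebra_simps)

text \<open>
  The forms \<open>w i\<close> have inverses \<open>- s i\<close> and anticommute in the sense \<open>w i s j = - w j s i\<close> for \<open>i \<noteq> j\<close>, so the
  endomorphisms \<open>s 3 w 2\<close>, \<open>s 1 w 3\<close>, \<open>s 2 w 1\<close> satisfy the quaternion relations up to sign. The rows of \<open>f\<close> are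
  \<open>u\<close> and its images under the negatives of these endomorphisms, as for the standard forms, where
  the first column of \<open>sd (axis i 1)\<close> is the negative of a standard basis vector.
\<close>

lemma quaternionic_basis:
  fixes w :: "3 \<Rightarrow> real^4^4" and u :: "real^4"
  assumes tf: "\<And>i. two_form (w i)" and wd: "\<And>i j. wedge (w i) (w j) = (if i = j then 2 else 0)"
  defines "s \<equiv> \<lambda>i. hodge (w i)"
  defines "c \<equiv> u \<bullet> (- (w 1 ** s 3 ** w 2) *v u)"
  defines "f \<equiv> (vector [u, - (s 3 *v (w 2 *v u)), - (s 1 *v (w 3 *v u)), - (s 2 *v (w 1 *v u))] :: real^4^4)"
  shows "f ** w i ** transpose f = c *\<^sub>R sd (axis i 1)"
proof -
  define h where "h = w 1 *v (- (s 3 *v (w 2 *v u)))"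
  have c: "u \<bullet> h = c"
    by (simp add: c_def h_def matrix_vector_mul_assoc[symmetric] matrix_vector_minus linear_neg)
  have inv: "w i *v (s i *v y) = - y" "s i *v (w i *v y) = - y" for i y
  proof -
    have "w i ** s i + w i ** s i = - (2 *\<^sub>R mat 1)" "s i ** w i + s i ** w i = - (2 *\<^sub>R mat 1)"
      using hodge_polar[OF tf[of i] tf[of i]] wd[of i i] by (simp_all add: s_def)
    then have "2 *\<^sub>R (w i ** s i) = 2 *\<^sub>R (- mat 1)" "2 *\<^sub>R (s i ** w i) = 2 *\<^sub>R (- mat 1)"
      by (simp_all add: scaleR_2)
    then have "w i ** s i = - mat 1" "s i ** w i = - mat 1"
      unfolding real_vector.scale_cancel_left by simp_all
    then show "w i *v (s i *v y) = - y" "s i *v (w i *v y) = - y"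
      by (simp_all add: matrix_vector_mul_assoc matrix_vector_minus)
  qed
  have anti: "w i *v (s j *v y) = - (w j *v (s i *v y))" if "i \<noteq> j" for i j y
  proof -
    have "w i ** s j + w j ** s i = 0"
      using hodge_polar(1)[OF tf[of i] tf[of j]] wd[of i j] that by (simp add: s_def)
    then have "w i ** s j = - (w j ** s i)" by (simp add: eq_neg_iff_add_eq_0)
    then show ?thesis by (simp add: matrix_vector_mul_assoc matrix_vector_minus)
  qed
  have neg: "A *v (- y) = - (A *v y)" for A :: "real^4^4" and y
    by (simp add: linear_neg)
  define f1 f2 f3 where f123: "f1 = - (s 3 *v (w 2 *v u))" "f2 = - (s 1 *v (w 3 *v u))" "f3 = - (s 2 *v (w 1 *v u))"
  have wf: "w 1 *v f1 = h" "w 1 *v f2 = w 3 *v u" "w 1 *v f3 = - (w 2 *v u)"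
    "w 2 *v f1 = - (w 3 *v u)" "w 2 *v f2 = h" "w 2 *v f3 = w 1 *v u"
    "w 3 *v f1 = w 2 *v u" "w 3 *v f2 = - (w 1 *v u)" "w 3 *v f3 = h"
  proof -
    show "w 1 *v f1 = h" by (simp add: f123 h_def)
    show "w 1 *v f2 = w 3 *v u" "w 2 *v f3 = w 1 *v u" "w 3 *v f1 = w 2 *v u"
      by (simp_all add: f123 neg inv)
    show "w 1 *v f3 = - (w 2 *v u)" "w 2 *v f1 = - (w 3 *v u)" "w 3 *v f2 = - (w 1 *v u)"
      using anti[of 1 2] anti[of 2 3] anti[of 3 1] by (simp_all add: f123 neg inv)
    have h: "h = w 3 *v (s 1 *v (w 2 *v u))"
      using anti[of 1 3] by (simp add: h_def neg)
    have santi: "s i *v (w j *v y) = - (s j *v (w i *v y))" if "i \<noteq> j" for i j y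
    proof -
      have "s i ** w j + s j ** w i = 0"
        using hodge_polar(2)[OF tf[of i] tf[of j]] wd[of i j] that by (simp add: s_def)
      then have "s i ** w j = - (s j ** w i)" by (simp add: eq_neg_iff_add_eq_0)
      then show ?thesis by (simp add: matrix_vector_mul_assoc matrix_vector_minus)
    qed
    show "w 3 *v f3 = h" using santi[of 1 2] by (simp add: h f123 neg)
    have "h = w 1 *v (s 2 *v (w 3 *v u))" using santi[of 2 3] by (simp add: h_def neg)
    then show "w 2 *v f2 = h" using anti[of 1 2] by (simp add: f123 neg)
  qed
  have sk: "x \<bullet> (w i *v y) = - (y \<bullet> (w i *v x))" for x y i
    using tf[of i] by (intro inner_skew) (simp add: two_form_def)
  have sk0: "x \<bullet> (w i *v x) = 0" for x i using sk[of x i x] by simp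
  have f: "f $ 1 = u" "f $ 2 = f1" "f $ 3 = f2" "f $ 4 = f3" by (simp_all add: f_def f123)
  have entry: "(f ** w i ** transpose f) $ a $ b = f $ a \<bullet> (w i *v f $ b)" for i a b
    unfolding matrix_mul_assoc[symmetric]
    by (simp add: matrix_matrix_mult_def transpose_def inner_vec_def matrix_vector_mult_def)
  have e: "u \<bullet> (w i *v f1) = (if i = 1 then c else 0)" "u \<bullet> (w i *v f2) = (if i = 2 then c else 0)"
    "u \<bullet> (w i *v f3) = (if i = 3 then c else 0)" for i
    using exhaust_3[of i] wf c sk0 by auto
  have e': "f1 \<bullet> (w i *v u) = (if i = 1 then - c else 0)" "f2 \<bullet> (w i *v u) = (if i = 2 then - c else 0)"
    "f3 \<bullet> (w i *v u) = (if i = 3 then - c else 0)" for i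
    using e[of i] sk[of _ i u] by auto
  have e2: "f1 \<bullet> (w i *v f2) = (if i = 3 then c else 0)" "f1 \<bullet> (w i *v f3) = (if i = 2 then - c else 0)"
    "f2 \<bullet> (w i *v f3) = (if i = 1 then c else 0)" for i
  proof -
    have "f1 \<bullet> (w 2 *v f2) = 0" using sk[of f1 2 f2] wf e' by simp
    moreover have "f1 \<bullet> (w 3 *v f3) = 0" using sk[of f1 3 f3] wf e' by simp
    moreover have "f2 \<bullet> (w 3 *v f3) = 0" using sk[of f2 3 f3] wf e' by simp
    moreover have "f1 \<bullet> (w 1 *v f2) = 0" "f1 \<bullet> (w 3 *v f2) = c" "f1 \<bullet> (w 1 *v f3) = 0"
      "f1 \<bullet> (w 2 *v f3) = - c" "f2 \<bullet> (w 1 *v f3) = c" "f2 \<bullet> (w 2 *v f3) = 0"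
      using wf e' by simp_all
    ultimately show "f1 \<bullet> (w i *v f2) = (if i = 3 then c else 0)" "f1 \<bullet> (w i *v f3) = (if i = 2 then - c else 0)"
      "f2 \<bullet> (w i *v f3) = (if i = 1 then c else 0)"
      using exhaust_3[of i] by auto
  qed
  have e2': "f2 \<bullet> (w i *v f1) = (if i = 3 then - c else 0)" "f3 \<bullet> (w i *v f1) = (if i = 2 then c else 0)"
    "f3 \<bullet> (w i *v f2) = (if i = 1 then - c else 0)" for i
    using e2[of i] sk[of f2 i f1] sk[of f3 i f1] sk[of f3 i f2] by auto
  show ?thesis
    unfolding vec_eq_iff forall_4 entry f e e' e2 e2' sk0
    using exhaust_3[of i] by (auto simp: sd_def axis_def)
qed

text \<open>
  In a quaternionic basis the forms become standard up to the factor \<open>c\<close>. The hypothesis on the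
  determinant makes the trace of \<open>trace_triple_forms\<close> positive, because wedge-orthonormality says that
  the self-dual parts have a larger determinant than the anti-self-dual parts. Hence some coordinate
  vector \<open>u\<close> has \<open>c > 0\<close>, and \<open>c\<close> can be absorbed by rescaling.
\<close>

lemma wedge_orthonormal_normal_form:
  fixes p q :: "3 \<Rightarrow> real^3"
  defines "w \<equiv> \<lambda>i. sd (p i) + asd (q i)"
  assumes wd: "\<And>i j. wedge (w i) (w j) = (if i = j then 2 else 0)" and det: "det (\<chi> i. p i) > 0"
  shows "\<exists>P E. P ** E = mat 1 \<and> det P > 0 \<and> (\<forall>i. w i = transpose P ** sd (axis i 1) ** P)"
proof -
  have tf: "two_form (w i)" for i by (simp add: w_def)
  define A B where "A = (\<chi> i. p i)" and "B = (\<chi> i. q i)"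
  have "p i \<bullet> p j - q i \<bullet> q j = (if i = j then 1 else 0)" for i j
    using wd[of i j] by (simp add: w_def wedge_linear wedge_sd split: if_splits)
  then have "A ** transpose A = mat 1 + B ** transpose B"
    by (simp add: vec_eq_iff matrix_matrix_mult_def transpose_def A_def B_def mat_def inner_vec_def algebra_simps)
  then have "(det B)\<^sup>2 < (det A)\<^sup>2" by (rule det_gram_gt)
  then have "\<bar>det B\<bar> < det A" using det power2_less_imp_less[of "\<bar>det B\<bar>" "det A"] by (simp add: A_def)
  then have "det A + det B > 0" by linarith
  define H where "H = - (w 1 ** hodge (w 3) ** w 2)"
  have "trace H > 0"
    using trace_triple_forms[of p q] \<open>det A + det B > 0\<close> by (simp add: H_def w_def A_def B_def)
  then obtain k where k: "H $ k $ k > 0"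
    unfolding trace_def by (meson not_le sum_nonpos)
  define c where "c = axis k 1 \<bullet> (H *v axis k 1)"
  have c: "c > 0"
    using k by (simp add: c_def matrix_vector_mult_basis inner_axis' column_def)
  obtain f where f: "\<And>i. f ** w i ** transpose f = c *\<^sub>R sd (axis i 1)"
    using quaternionic_basis[of w "axis k 1", OF tf wd] unfolding c_def H_def by blast
  have "wedge (transpose (transpose f) ** w 1 ** transpose f) (transpose (transpose f) ** w 1 ** transpose f)
      = det (transpose f) * wedge (w 1) (w 1)"
    by (rule wedge_pullback[OF tf tf])
  then have "det f = c\<^sup>2"
    by (simp add: f wedge_linear wedge_sd wd inner_axis_axis power2_eq_square)
  then have "det f \<noteq> 0" using c by simp
  then obtain f' where f': "f ** f' = mat 1" "f' ** f = mat 1"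
    using invertible_det_nz[of f] by (auto simp: invertible_def)
  define P E where "P = sqrt c *\<^sub>R transpose f'" and "E = (1 / sqrt c) *\<^sub>R transpose f"
  have PE: "P ** E = mat 1"
    using c f' by (simp add: P_def E_def matrix_transpose_mul[symmetric])
  have wP: "w i = transpose P ** sd (axis i 1) ** P" for i
  proof -
    have "transpose P ** sd (axis i 1) ** P = f' ** (c *\<^sub>R sd (axis i 1)) ** transpose f'"
      using c by (simp add: P_def)
    also have "\<dots> = (f' ** f) ** w i ** transpose (f' ** f)"
      unfolding f[symmetric] by (simp add: matrix_transpose_mul matrix_mul_assoc)
    finally show ?thesis by (simp add: f')
  qed
  have "wedge (w 1) (w 1) = det P * wedge (sd (axis 1 1)) (sd (axis 1 1))"
    unfolding wP by (rule wedge_pullback) simp_all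
  then have "det P = 1" by (simp add: wd wedge_sd inner_axis_axis)
  then show ?thesis using PE wP by (intro exI[of _ P] exI[of _ E]) simp
qed

section \<open>A criterion for definiteness\<close>

text \<open>
  The standard isomorphism of \<open>\<real>\<^sup>3\<close> with \<open>so(3)\<close>: the matrix of \<open>x \<mapsto> a \<times> x\<close>.
\<close>

definition cross_matrix :: "real^3 \<Rightarrow> real^3^3" where
  "cross_matrix a = vector [vector [0, - a$3, a$2], vector [a$3, 0, - a$1], vector [- a$2, a$1, 0]]"

definition cross_coord :: "3 \<Rightarrow> real^3^3 \<Rightarrow> real" where
  "cross_coord i F = (vector [F$3$2, F$1$3, F$2$1] :: real^3) $ i"

lemma linear_cross_matrix: "linear cross_matrix"
  by (simp add: linear_iff cross_matrix_def vec_eq_iff forall_3)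

lemma cross_coord_cross_matrix: "cross_coord i (cross_matrix a) = a $ i"
  using exhaust_3[of i] by (auto simp: cross_coord_def cross_matrix_def)

lemma linear_cross_coord: "linear (cross_coord i)"
  using exhaust_3[of i] by (auto simp: linear_iff cross_coord_def)

lemma so3_dual_basis_cross_coord: "so3_dual_basis cross_coord"
proof -
  let ?e = "\<lambda>i. cross_matrix (axis i 1)"
  have inj: "inj cross_matrix"
    by (rule injI) (metis cross_coord_cross_matrix vec_eq_iff)
  then have "independent (range ?e)"
    by (rule independent_range_linear_axis[OF linear_cross_matrix])
  moreover have "inj ?e"
    using inj by (intro injI) (simp add: inj_eq axis_eq_axis)
  moreover have "bracket (?e 1) (?e 2) = ?e 3" "bracket (?e 2) (?e 3) = ?e 1" "bracket (?e 3) (?e 1) = ?e 2"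
    by (simp_all add: bracket_def matrix_matrix_mult_def cross_matrix_def vec_eq_iff forall_3 sum_3 axis_def)
  ultimately have "so3_basis ?e" by (simp add: so3_basis_def)
  moreover have "transpose (?e i) = - ?e i" for i
    by (simp add: cross_matrix_def transpose_def vec_eq_iff forall_3)
  ultimately show ?thesis
    unfolding so3_dual_basis_def
    by (intro conjI allI exI[of _ ?e] linear_cross_coord) (auto simp: cross_coord_cross_matrix axis_def)
qed

text \<open>
  In the basis of \<open>so(3)\<close> given by \<open>cross_matrix\<close> the curvature is a triple \<open>\<phi>\<close> of two-forms.
\<close>

lemma curvature_image_cross:
  assumes F: "\<And>i j. curvature A x i j = (-2) *\<^sub>R cross_matrix (\<chi> c. \<phi> c $ i $ j)"
  shows "linear \<xi> \<Longrightarrow> curvature_map A x \<xi> = (\<Sum>c\<in>UNIV. (- 2 * \<xi> (cross_matrix (axis c 1))) *\<^sub>R \<phi> c)"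
    and "curvature_image A x = range (\<lambda>y :: real^3. \<Sum>c\<in>UNIV. y $ c *\<^sub>R \<phi> c)"
proof -
  have *: "curvature_map A x \<xi> = (\<Sum>c\<in>UNIV. (- 2 * \<xi> (cross_matrix (axis c 1))) *\<^sub>R \<phi> c)" if \<xi>: "linear \<xi>" for \<xi>
  proof -
    have key: "\<xi> (cross_matrix y) = (\<Sum>c\<in>UNIV. y $ c * \<xi> (cross_matrix (axis c 1)))" for y
    proof -
      have "cross_matrix y = cross_matrix (\<Sum>c\<in>UNIV. y $ c *\<^sub>R axis c 1)"
        using basis_expansion[of y] by (simp add: scalar_mult_eq_scaleR)
      then show ?thesis
        by (simp add: linear_sum[OF linear_cross_matrix] linear_scale[OF linear_cross_matrix]
            linear_sum[OF \<xi>] linear_scale[OF \<xi>])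
    qed
    have "curvature_map A x \<xi> $ i $ j = (\<Sum>c\<in>UNIV. (- 2 * \<xi> (cross_matrix (axis c 1))) *\<^sub>R \<phi> c) $ i $ j"
      for i j
      using key[of "\<chi> c. \<phi> c $ i $ j"]
      by (simp add: curvature_map_def F linear_scale[OF \<xi>] linear_neg[OF \<xi>] sum_distrib_left sum_negf algebra_simps)
    then show ?thesis by (simp add: vec_eq_iff)
  qed
  then show "linear \<xi> \<Longrightarrow> curvature_map A x \<xi> = (\<Sum>c\<in>UNIV. (- 2 * \<xi> (cross_matrix (axis c 1))) *\<^sub>R \<phi> c)" .
  have lin: "linear (\<lambda>F. \<Sum>c\<in>UNIV. - (1/2) * y $ c * cross_coord c F)" for y :: "real^3"
    using linear_cross_coord by (simp add: linear_iff sum.distrib sum_distrib_left algebra_simps sum_negf add_divide_distrib)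
  have val: "curvature_map A x (\<lambda>F. \<Sum>c\<in>UNIV. - (1/2) * y $ c * cross_coord c F) = (\<Sum>c\<in>UNIV. y $ c *\<^sub>R \<phi> c)"
    for y :: "real^3"
    unfolding *[OF lin] by (simp add: cross_coord_cross_matrix sum_3 axis_def)
  show "curvature_image A x = range (\<lambda>y :: real^3. \<Sum>c\<in>UNIV. y $ c *\<^sub>R \<phi> c)"
  proof (intro equalityI subsetI)
    fix w assume "w \<in> curvature_image A x"
    then obtain \<xi> where "linear \<xi>" "w = curvature_map A x \<xi>" by (auto simp: curvature_image_def)
    then show "w \<in> range (\<lambda>y :: real^3. \<Sum>c\<in>UNIV. y $ c *\<^sub>R \<phi> c)"
      by (intro range_eqI[of _ _ "\<chi> c. - 2 * \<xi> (cross_matrix (axis c 1))"]) (simp add: *)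
  next
    fix w assume "w \<in> range (\<lambda>y :: real^3. \<Sum>c\<in>UNIV. y $ c *\<^sub>R \<phi> c)"
    then obtain y :: "real^3" where "w = (\<Sum>c\<in>UNIV. y $ c *\<^sub>R \<phi> c)" by blast
    then show "w \<in> curvature_image A x"
      using lin[of y] unfolding curvature_image_def val[of y, symmetric] by blast
  qed
qed

text \<open>
  The image of the curvature map is the pullback of the span of the forms
  \<open>sd (\<alpha> c) + asd (\<beta> c)\<close>. The contraction property says that the wedge product is positive definite
  on this span, so a change of basis \<open>L\<close> as in \<open>gram_schmidt_smooth\<close> makes the forms
  wedge-orthonormal, and by the normal form they are then the standard self-dual forms of a metric.
  With respect to the resulting oriented bases the curvature map has the matrix \<open>4 L\<^sup>-\<^sup>1\<close>, and \<open>L\<close> has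
  been chosen with determinant of the same sign as that of \<open>\<alpha>\<close>.
\<close>

lemma definite_if_contraction:
  fixes A :: "4 \<Rightarrow> real^4 \<Rightarrow> real^3^3" and \<alpha> \<beta> :: "3 \<Rightarrow> real^3"
  assumes F: "\<And>i j. curvature A x i j = (-2) *\<^sub>R cross_matrix (\<chi> c. \<phi> c $ i $ j)"
    and \<phi>: "\<And>c. \<phi> c = transpose P ** (sd (\<alpha> c) + asd (\<beta> c)) ** P"
    and PE: "P ** E = mat 1" and \<sigma>: "\<sigma> \<in> {1, -1}" "\<sigma> * det P > 0"
    and contraction: "\<And>y :: real^3. y \<noteq> 0 \<Longrightarrow>
      norm (\<Sum>c\<in>UNIV. y $ c *\<^sub>R \<beta> c) < norm (\<Sum>c\<in>UNIV. y $ c *\<^sub>R \<alpha> c)"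
  shows "definite_at A x" "\<exists>M. curvature_matrix A x M \<and> det M * det (\<chi> c. \<alpha> c) > 0"
proof -
  define a where "a y = (\<Sum>c\<in>UNIV. y $ c *\<^sub>R \<alpha> c)" for y :: "real^3"
  define b where "b y = (\<Sum>c\<in>UNIV. y $ c *\<^sub>R \<beta> c)" for y :: "real^3"
  have lin: "linear a" "linear b"
    by (simp_all add: linear_iff a_def b_def scaleR_add_left sum.distrib scaleR_sum_right)
  define G :: "real^3^3" where "G = (\<chi> c d. \<alpha> c \<bullet> \<alpha> d - \<beta> c \<bullet> \<beta> d)"
  have G: "y \<bullet> (G *v z) = a y \<bullet> a z - b y \<bullet> b z" for y z
    by (simp add: inner_vec_def[of y] G_def matrix_vector_mult_def a_def b_def inner_sum_left inner_sum_right)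
       (simp add: sum_3 algebra_simps)
  have "pos_def_matrix G"
  proof -
    have "y \<bullet> (G *v y) > 0" if "y \<noteq> 0" for y
    proof -
      have "(norm (b y))\<^sup>2 < (norm (a y))\<^sup>2"
        using contraction[OF that] unfolding a_def b_def by (intro power_strict_mono) auto
      then show ?thesis by (simp add: G power2_norm_eq_inner)
    qed
    moreover have "transpose G = G" by (simp add: transpose_def G_def inner_commute)
    ultimately show ?thesis by (simp add: pos_def_matrix_def)
  qed
  then have "\<exists>L :: real^4 \<Rightarrow> real^3^3. smooth_on UNIV L \<and> (\<forall>y\<in>UNIV. transpose (L y) ** G ** L y = mat 1)"
    by (intro gram_schmidt_smooth) (simp_all add: smooth_on_const)
  then obtain L0 :: "real^3^3" where L0: "transpose L0 ** G ** L0 = mat 1" by blast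
  have a0: "det (\<chi> c. \<alpha> c) \<noteq> 0"
  proof
    assume "det (\<chi> c. \<alpha> c) = 0"
    then have "det (transpose (\<chi> c. \<alpha> c)) = 0" by (simp add: det_transpose)
    then have "\<not> invertible (transpose (\<chi> c. \<alpha> c))" by (simp add: invertible_det_nz)
    then obtain y where y: "y \<noteq> 0" "transpose (\<chi> c. \<alpha> c) *v y = 0"
      unfolding invertible_left_inverse matrix_left_invertible_ker by blast
    then have "a y = 0"
      by (simp add: a_def vec_eq_iff matrix_vector_mult_def transpose_def mult.commute)
    then show False using contraction[OF y(1)] by (simp add: a_def)
  qed
  have "det L0 \<noteq> 0" using arg_cong[OF L0, of det] by (auto simp: det_mul)
  moreover have "det (- L0) = - det L0" by (simp add: det_3)
  \<comment> \<open>In odd dimension a change of sign of \<open>L0\<close> changes the sign of its determinant.\<close>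
  ultimately obtain L where L: "transpose L ** G ** L = mat 1" and detL: "det L * det (\<chi> c. \<alpha> c) > 0"
  proof (cases "det L0 * det (\<chi> c. \<alpha> c) > 0")
    case False
    then have "det (- L0) * det (\<chi> c. \<alpha> c) > 0"
      using a0 \<open>det L0 \<noteq> 0\<close> \<open>det (- L0) = - det L0\<close> by (auto simp: mult_less_0_iff zero_less_mult_iff not_less)
    then show thesis using that[of "- L0"] L0 by simp
  qed (use that L0 in blast)
  obtain L' where L': "L ** L' = mat 1" "L' ** L = mat 1"
    using invertible_det_nz[of L] detL by (auto simp: invertible_def)
  define p where "p i = a (column i L)" for i
  define q where "q i = b (column i L)" for i
  define w where "w i = sd (p i) + asd (q i)" for i
  have w_sum: "w i = (\<Sum>c\<in>UNIV. L $ c $ i *\<^sub>R (sd (\<alpha> c) + asd (\<beta> c)))" for i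
    by (simp add: w_def p_def q_def a_def b_def column_def linear_sum[OF linear_sd] linear_sum[OF linear_asd]
        linear_scale[OF linear_sd] linear_scale[OF linear_asd] scaleR_add_right sum.distrib)
  have wd: "wedge (w i) (w j) = (if i = j then 2 else 0)" for i j
  proof -
    have "wedge (w i) (w j) = 2 * (column i L \<bullet> (G *v column j L))"
      by (simp add: w_def wedge_linear wedge_sd G p_def q_def)
    also have "column i L \<bullet> (G *v column j L) = (transpose L ** G ** L) $ i $ j"
      unfolding matrix_mul_assoc[symmetric]
      by (simp add: matrix_matrix_mult_def matrix_vector_mult_def inner_vec_def column_def transpose_def)
    finally show ?thesis by (simp add: L mat_def)
  qed
  have "(\<chi> i. p i) = transpose L ** (\<chi> c. \<alpha> c)"
    by (simp add: vec_eq_iff p_def a_def column_def matrix_matrix_mult_def transpose_def)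
  then have "det (\<chi> i. p i) > 0" using detL by (simp add: det_mul det_transpose)
  from wedge_orthonormal_normal_form[OF wd[unfolded w_def] this]
  obtain P' E' where P': "P' ** E' = mat 1" "det P' > 0" "\<And>i. w i = transpose P' ** sd (axis i 1) ** P'"
    unfolding w_def by blast
  define Q where "Q = P' ** P"
  have QE: "Q ** (E ** E') = mat 1"
  proof -
    have "Q ** (E ** E') = P' ** (P ** E) ** E'" by (simp add: Q_def matrix_mul_assoc)
    then show ?thesis by (simp add: PE P')
  qed
  have detQ: "\<sigma> * det Q > 0"
    using \<sigma> P'(2) by (auto simp: Q_def det_mul zero_less_mult_iff mult_less_0_iff)
  have pull_w: "transpose P ** w i ** P = transpose Q ** sd (axis i 1) ** Q" for i
    by (simp add: P'(3) Q_def matrix_transpose_mul matrix_mul_assoc)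
  have pull_w_sum: "transpose P ** w i ** P = (\<Sum>c\<in>UNIV. L $ c $ i *\<^sub>R \<phi> c)" for i
    by (simp add: w_sum \<phi> bounded_bilinear.sum_left[OF bounded_bilinear_matrix_mult]
        bounded_bilinear.sum_right[OF bounded_bilinear_matrix_mult] scaleR_add_right sum.distrib)
  have pull_sd: "transpose Q ** sd y ** Q = (\<Sum>c\<in>UNIV. (L *v y) $ c *\<^sub>R \<phi> c)" for y
  proof -
    have "y = (\<Sum>i\<in>UNIV. y $ i *\<^sub>R axis i 1)"
      using basis_expansion[of y] by (simp add: scalar_mult_eq_scaleR)
    then have "sd y = (\<Sum>i\<in>UNIV. y $ i *\<^sub>R sd (axis i 1))"
      by (metis (mono_tags, lifting) linear_scale[OF linear_sd] linear_sum[OF linear_sd] sum.cong)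
    then have "transpose Q ** sd y ** Q = (\<Sum>i\<in>UNIV. y $ i *\<^sub>R (transpose P ** w i ** P))"
      by (simp add: pull_w bounded_bilinear.sum_left[OF bounded_bilinear_matrix_mult]
        bounded_bilinear.sum_right[OF bounded_bilinear_matrix_mult])
    also have "\<dots> = (\<Sum>c\<in>UNIV. (L *v y) $ c *\<^sub>R \<phi> c)"
      unfolding pull_w_sum
      by (simp add: sum_3 matrix_vector_mult_def scaleR_add_left scaleR_add_right algebra_simps)
    finally show ?thesis .
  qed
  have image: "curvature_image A x = range (\<lambda>y. transpose Q ** sd y ** Q)"
  proof -
    have "(\<Sum>c\<in>UNIV. y $ c *\<^sub>R \<phi> c) = transpose Q ** sd (L' *v y) ** Q" for y
      by (simp add: pull_sd matrix_vector_mul_assoc L')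
    then show ?thesis
      unfolding curvature_image_cross(2)[OF F] by (auto simp: pull_sd) 
  qed
  have wedge_pull: "wedge (transpose Q ** sd y ** Q) (transpose Q ** sd y ** Q) = det Q * (2 * (y \<bullet> y))" for y
    by (simp add: wedge_pullback wedge_sd)
  have pos: "\<sigma> * wedge v v > 0" if v: "v \<in> curvature_image A x" "v \<noteq> 0" for v
  proof -
    obtain y where y: "v = transpose Q ** sd y ** Q" using v(1) image by blast
    then have "y \<noteq> 0" using v(2) linear_0[OF linear_sd] by auto
    then have "0 < \<sigma> * det Q * (2 * (y \<bullet> y))" by (intro mult_pos_pos[OF detQ]) simp
    then show ?thesis unfolding y wedge_pull by (simp add: mult.assoc)
  qed
  have lin_pull: "linear (\<lambda>y. transpose Q ** sd y ** Q)"
    by (simp add: linear_iff linear_add[OF linear_sd] linear_scale[OF linear_sd])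
  have inj_pull: "inj (\<lambda>y. transpose Q ** sd y ** Q)"
    unfolding linear_injective_0[OF lin_pull]
    using wedge_pull detQ by (metis inner_eq_zero_iff mult_eq_0_iff mult_zero_right less_irrefl wedge_linear(3)
        scaleR_zero_left zero_neq_numeral)
  have "dim (curvature_image A x) = 3"
    unfolding image using dim_image_eq[OF lin_pull, of UNIV] inj_pull by simp
  then show "definite_at A x"
    using pos \<sigma>(1) unfolding definite_at_def by auto
  have str: "induces_structure A x \<sigma> (transpose Q ** Q)"
    unfolding induces_structure_def
    using \<sigma>(1) pos pos_def_pullback[OF QE] self_dual_forms_pullback[OF QE \<sigma>(1) detQ] image by simp
  define M where "M = 4 *\<^sub>R L'"
  have "curvature_map A x (cross_coord j)
    = (\<Sum>i\<in>UNIV. M $ i $ j *\<^sub>R (- (1/2) *\<^sub>R (transpose Q ** sd (axis i 1) ** Q)))" for j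
  proof -
    have "curvature_map A x (cross_coord j) = (-2) *\<^sub>R \<phi> j"
      using exhaust_3[of j]
      by (auto simp: curvature_image_cross(1)[OF F linear_cross_coord] cross_coord_cross_matrix sum_3 axis_def)
    moreover have "\<phi> j = transpose Q ** sd (column j L') ** Q"
    proof -
      have "L *v column j L' = axis j 1"
        using L'(1) by (simp add: vec_eq_iff matrix_matrix_mult_def matrix_vector_mult_def column_def axis_def mat_def)
      then show ?thesis unfolding pull_sd using exhaust_3[of j] by (auto simp: sum_3 axis_def)
    qed
    moreover have "sd (column j L') = (\<Sum>i\<in>UNIV. L' $ i $ j *\<^sub>R sd (axis i 1))"
      by (simp add: forms_expand column_def axis_def)
    ultimately show ?thesis
      by (simp add: M_def bounded_bilinear.sum_left[OF bounded_bilinear_matrix_mult] sum_negf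
        bounded_bilinear.sum_right[OF bounded_bilinear_matrix_mult] scaleR_sum_right)
  qed
  then have "curvature_matrix A x M"
    unfolding curvature_matrix_def
    using str so3_dual_basis_cross_coord oriented_form_basis_pullback[OF QE \<sigma>(1) detQ] by blast
  moreover have "det M * det (\<chi> c. \<alpha> c) > 0"
  proof -
    have "det L * det L' = 1" using arg_cong[OF L'(1), of det] by (simp add: det_mul)
    moreover have "det M = 64 * det L'" by (simp add: M_def det_3)
    ultimately show ?thesis using detL
      by (smt (verit) mult_neg_neg mult_pos_pos zero_less_mult_iff)
  qed
  ultimately show "\<exists>M. curvature_matrix A x M \<and> det M * det (\<chi> c. \<alpha> c) > 0" by blast
qed

section \<open>Pinched curvature tensors\<close>

text \<open>
  The factor 16 makes \<open>curv_form \<rho> (sd a + asd b) (sd a + asd b)\<close> the sectional curvature of the plane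
  that corresponds to unit vectors \<open>a\<close> and \<open>b\<close>.
\<close>

definition curv_form :: "(4 \<Rightarrow> 4 \<Rightarrow> real^4^4) \<Rightarrow> real^4^4 \<Rightarrow> real^4^4 \<Rightarrow> real" where
  "curv_form \<rho> v w = (\<Sum>p\<in>UNIV. \<Sum>q\<in>UNIV. v $ p $ q * (\<rho> p q \<bullet> w)) / 16"

definition bivector :: "real^4 \<Rightarrow> real^4 \<Rightarrow> real^4^4" where
  "bivector u v = (\<chi> p q. u $ p * v $ q - v $ p * u $ q)"

lemma two_form_bivector [simp]: "two_form (bivector u v)"
  by (simp add: two_form_def bivector_def transpose_def vec_eq_iff)

lemma bivector_inner_bivector: "bivector u v \<bullet> bivector u v = 2 * gram_det u v"
  by (simp add: bivector_def gram_det_def inner_vec_def sum_4 power2_eq_square algebra_simps)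

lemma skew_inner_bivector:
  assumes "transpose A = - A"
  shows "A \<bullet> bivector u v = 2 * (u \<bullet> (A *v v))"
proof -
  have "A \<bullet> bivector u v = u \<bullet> (A *v v) - v \<bullet> (A *v u)"
    by (simp add: bivector_def inner_vec_def matrix_vector_mult_def sum_4 algebra_simps)
  then show ?thesis using inner_skew[OF assms, of v u] by simp
qed

lemma curv_form_linear:
  "curv_form \<rho> (u + v) w = curv_form \<rho> u w + curv_form \<rho> v w"
  "curv_form \<rho> v (u + w) = curv_form \<rho> v u + curv_form \<rho> v w"
  "curv_form \<rho> (c *\<^sub>R v) w = c * curv_form \<rho> v w"
  "curv_form \<rho> v (c *\<^sub>R w) = c * curv_form \<rho> v w"
  "curv_form \<rho> (- v) w = - curv_form \<rho> v w"
  "curv_form \<rho> v (- w) = - curv_form \<rho> v w"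
  "curv_form \<rho> (u - v) w = curv_form \<rho> u w - curv_form \<rho> v w"
  "curv_form \<rho> v (u - w) = curv_form \<rho> v u - curv_form \<rho> v w"
  by (simp_all add: curv_form_def inner_add_right inner_diff_right diff_divide_distrib sum_subtractf sum.distrib sum_distrib_left sum_negf algebra_simps add_divide_distrib)

lemma sec_num_bivector:
  assumes "\<And>p q. \<rho> p q = - \<rho> q p" "\<And>p q. transpose (\<rho> p q) = - \<rho> p q"
  shows "sec_num \<rho> u v = 4 * curv_form \<rho> (bivector u v) (bivector u v)"
proof -
  define S where "S p q = \<rho> p q \<bullet> bivector u v" for p q
  have S: "S p q = - S q p" for p q
    unfolding S_def by (subst assms(1)) simp
  have "4 * curv_form \<rho> (bivector u v) (bivector u v)
      = ((\<Sum>p\<in>UNIV. \<Sum>q\<in>UNIV. u $ p * v $ q * S p q) - (\<Sum>p\<in>UNIV. \<Sum>q\<in>UNIV. v $ p * u $ q * S p q)) / 4"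
    by (simp add: curv_form_def S_def[symmetric] sum_subtractf[symmetric])
       (simp add: bivector_def left_diff_distrib)
  also have "(\<Sum>p\<in>UNIV. \<Sum>q\<in>UNIV. v $ p * u $ q * S p q) = (\<Sum>q\<in>UNIV. \<Sum>p\<in>UNIV. - (u $ q * v $ p * S q p))"
    by (subst sum.swap, intro sum.cong refl, subst S) simp
  also have "\<dots> = - (\<Sum>p\<in>UNIV. \<Sum>q\<in>UNIV. u $ p * v $ q * S p q)"
    by (simp add: sum_negf)
  also have "(\<Sum>p\<in>UNIV. \<Sum>q\<in>UNIV. u $ p * v $ q * S p q) = 2 * sec_num \<rho> u v"
    by (simp add: sec_num_def S_def skew_inner_bivector[OF assms(2)] sum_distrib_left algebra_simps)
  finally show ?thesis by simp
qed

text \<open>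
  The sectional curvatures at a point are bounded; the same bound, applied to a difference of curvature
  tensors, controls how they vary with the point.
\<close>

lemma sec_num_bound:
  assumes "\<And>p q. \<rho> p q = - \<rho> q p" "\<And>p q. transpose (\<rho> p q) = - \<rho> p q"
  shows "\<bar>sec_num \<rho> u v\<bar> \<le> (\<Sum>p\<in>UNIV. \<Sum>q\<in>UNIV. norm (\<rho> p q)) / 2 * gram_det u v"
proof -
  let ?X = "bivector u v"
  have "\<bar>\<Sum>p\<in>UNIV. \<Sum>q\<in>UNIV. ?X $ p $ q * (\<rho> p q \<bullet> ?X)\<bar>
      \<le> (\<Sum>p\<in>UNIV. \<Sum>q\<in>UNIV. \<bar>?X $ p $ q * (\<rho> p q \<bullet> ?X)\<bar>)"
    by (intro order_trans[OF sum_abs] sum_mono order_refl)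
  also have "\<dots> \<le> (\<Sum>p\<in>UNIV. \<Sum>q\<in>UNIV. norm ?X * (norm (\<rho> p q) * norm ?X))"
    unfolding abs_mult
    by (intro sum_mono mult_mono Cauchy_Schwarz_ineq2)
       (auto intro: order_trans[OF component_le_norm_cart Finite_Cartesian_Product.norm_nth_le])
  also have "\<dots> = (\<Sum>p\<in>UNIV. \<Sum>q\<in>UNIV. norm (\<rho> p q)) * (2 * gram_det u v)"
    unfolding bivector_inner_bivector[symmetric]
    by (simp add: sum_distrib_left power2_norm_eq_inner[symmetric] power2_eq_square algebra_simps)
  finally show ?thesis by (simp add: sec_num_bivector[OF assms] curv_form_def)
qed

text \<open>
  The matrices \<open>sd a\<close> and \<open>asd b\<close> are commuting complex structures, so their difference annihilates the
  image of their sum \<open>K \<noteq> 0\<close>: they agree on some unit vector \<open>u\<close>. The plane of \<open>u\<close> and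
  \<open>v = sd a u = asd b u\<close> is the required one.
\<close>

lemma plane_of_unit_vectors:
  fixes a b :: "real^3"
  assumes "norm a = 1" "norm b = 1"
  obtains u v where "u \<bullet> u = 1" "v \<bullet> v = 1" "u \<bullet> v = 0" "bivector u v = - (1/2) *\<^sub>R (sd a + asd b)"
proof -
  define K where "K = sd a + asd b"
  have ab: "a \<bullet> a = 1" "b \<bullet> b = 1" using assms by (simp_all add: norm_eq_1)
  have "K \<bullet> K = 8"
    by (simp add: K_def inner_add_left inner_add_right inner_sd_sd inner_asd_asd inner_sd_asd inner_asd_sd ab)
  then have "K \<noteq> 0" by auto
  then obtain w where w: "K *v w \<noteq> 0"
    using matrix_eq[of K 0] by auto
  define u where "u = (1 / norm (K *v w)) *\<^sub>R (K *v w)"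
  have "norm u = 1" using w by (simp add: u_def)
  then have u: "u \<bullet> u = 1" by (simp add: norm_eq_1)
  define v where "v = sd a *v u"
  have "sd a ** K = asd b ** K"
    by (simp add: K_def sd_mult asd_mult ab sd_asd_commute cross_refl linear_0[OF linear_sd] linear_0[OF linear_asd])
  then have v2: "v = asd b *v u"
    by (simp add: v_def u_def matrix_vector_mul_assoc matrix_vector_mult_scaleR)
  have sk: "transpose (sd x) = - sd x" "transpose (asd x) = - asd x" for x
    using two_form_sd two_form_asd unfolding two_form_def by blast+
  have z: "u \<bullet> (sd x *v u) = 0" "u \<bullet> (asd x *v u) = 0" for x
    using inner_skew[OF sk(1)[of x], of u u] inner_skew[OF sk(2)[of x], of u u] by auto
  have s: "u \<bullet> (sd x *v v) = - (x \<bullet> a)" and s': "u \<bullet> (asd x *v v) = - (x \<bullet> b)" for x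
  proof -
    have "sd x *v v = (sd x ** sd a) *v u" by (simp add: v_def matrix_vector_mul_assoc)
    then show "u \<bullet> (sd x *v v) = - (x \<bullet> a)"
      by (simp add: sd_mult matrix_vector_mult_diff_rdistrib matrix_vector_minus scaleR_matrix_vector inner_diff_right z u)
    have "asd x *v v = (asd x ** asd b) *v u" by (simp add: v2 matrix_vector_mul_assoc)
    then show "u \<bullet> (asd x *v v) = - (x \<bullet> b)"
      by (simp add: asd_mult matrix_vector_mult_diff_rdistrib matrix_vector_minus scaleR_matrix_vector inner_diff_right z u)
  qed
  have "v \<bullet> v = - (u \<bullet> (sd a *v v))"
    using inner_skew[OF sk(1), of v a u] by (simp add: v_def inner_commute)
  then have vv: "v \<bullet> v = 1" by (simp add: s ab)
  obtain c d where cd: "bivector u v = sd c + asd d" using two_form_split two_form_bivector by blast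
  have "4 * (x \<bullet> c) = - 2 * (x \<bullet> a)" "4 * (x \<bullet> d) = - 2 * (x \<bullet> b)" for x
  proof -
    show "4 * (x \<bullet> c) = - 2 * (x \<bullet> a)"
      using skew_inner_bivector[OF sk(1)[of x], of u v] by (simp add: cd inner_add_right inner_sd_sd inner_sd_asd s)
    show "4 * (x \<bullet> d) = - 2 * (x \<bullet> b)"
      using skew_inner_bivector[OF sk(2)[of x], of u v] by (simp add: cd inner_add_right inner_asd_asd inner_asd_sd s')
  qed
  then have "x \<bullet> c = x \<bullet> (- (1/2) *\<^sub>R a)" "x \<bullet> d = x \<bullet> (- (1/2) *\<^sub>R b)" for x
    by (simp_all add: field_simps)
  then have "c = - (1/2) *\<^sub>R a" "d = - (1/2) *\<^sub>R b"
    by (metis vector_eq_ldot)+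
  then have "bivector u v = - (1/2) *\<^sub>R (sd a + asd b)"
    by (simp add: cd linear_scale[OF linear_sd] linear_scale[OF linear_asd] linear_neg[OF linear_sd] linear_neg[OF linear_asd] scaleR_add_right)
  then show thesis using that u vv z(1)[of a] by (simp add: v_def)
qed

lemma sum_orthogonal_basis:
  fixes f :: "real^'n \<Rightarrow> real^'n \<Rightarrow> real"
  assumes f: "bilinear f" and A: "orthogonal_matrix A"
  shows "(\<Sum>c\<in>UNIV. f (A *v axis c 1) (A *v axis c 1)) = (\<Sum>c\<in>UNIV. f (axis c 1) (axis c 1))"
proof -
  have exp: "f x y = (\<Sum>i\<in>UNIV. \<Sum>j\<in>UNIV. x $ i * y $ j * f (axis i 1) (axis j 1))" for x y
  proof -
    have "f x y = f (\<Sum>i\<in>UNIV. x $ i *\<^sub>R axis i 1) (\<Sum>j\<in>UNIV. y $ j *\<^sub>R axis j 1)"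
      using basis_expansion[of x] basis_expansion[of y] by (simp add: scalar_mult_eq_scaleR)
    then show ?thesis
      by (simp add: bilinear_sum[OF f] sum.cartesian_product bilinear_lmul[OF f] bilinear_rmul[OF f] mult.assoc mult.left_commute)
  qed
  have AA: "(\<Sum>c\<in>UNIV. A $ i $ c * A $ j $ c) = (if i = j then 1 else 0)" for i j
  proof -
    have "A ** transpose A = mat 1" using A by (simp add: orthogonal_matrix_def)
    then have "(A ** transpose A) $ i $ j = (if i = j then 1 else 0)" by (simp add: mat_def)
    then show ?thesis by (simp add: matrix_matrix_mult_def transpose_def)
  qed
  have "(\<Sum>c\<in>UNIV. f (A *v axis c 1) (A *v axis c 1))
    = (\<Sum>c\<in>UNIV. \<Sum>i\<in>UNIV. \<Sum>j\<in>UNIV. A $ i $ c * A $ j $ c * f (axis i 1) (axis j 1))"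
    by (subst exp) (simp add: matrix_vector_mult_basis column_def)
  also have "\<dots> = (\<Sum>i\<in>UNIV. \<Sum>j\<in>UNIV. (\<Sum>c\<in>UNIV. A $ i $ c * A $ j $ c) * f (axis i 1) (axis j 1))"
    by (subst sum3_rotate) (simp add: sum_distrib_right)
  also have "\<dots> = (\<Sum>i\<in>UNIV. f (axis i 1) (axis i 1))"
    by (simp add: AA if_distrib[of "\<lambda>x. x * _"] cong: if_cong)
  finally show ?thesis .
qed

context
  fixes \<rho> :: "4 \<Rightarrow> 4 \<Rightarrow> real^4^4"
  assumes \<rho>: "algebraic_curvature \<rho>"
begin

lemma curv_skew: "\<rho> p q = - \<rho> q p" "transpose (\<rho> p q) = - \<rho> p q" "\<rho> p q $ l $ k = - \<rho> p q $ k $ l"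
  "\<rho> p q $ k $ l = - \<rho> q p $ k $ l"
proof -
  show 1: "\<rho> p q = - \<rho> q p" and 2: "transpose (\<rho> p q) = - \<rho> p q" for p q
    using \<rho> unfolding algebraic_curvature_def by blast+
  show "\<rho> p q $ l $ k = - \<rho> p q $ k $ l" for k l
  proof -
    have "transpose (\<rho> p q) $ k $ l = (- \<rho> p q) $ k $ l" by (simp only: 2)
    then show ?thesis by (simp add: transpose_def)
  qed
  show "\<rho> p q $ k $ l = - \<rho> q p $ k $ l" by (subst 1) simp
qed

lemma curv_bianchi: "\<rho> p q $ k $ l + \<rho> q l $ k $ p + \<rho> l p $ k $ q = 0"
  using \<rho> unfolding algebraic_curvature_def by blast

lemma curv_pair_symmetric: "\<rho> p q $ k $ l = \<rho> k l $ p $ q"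
proof -
  have "\<rho> p q $ l $ k = - \<rho> p q $ k $ l" "\<rho> q k $ p $ l = - \<rho> q k $ l $ p"
    "\<rho> l q $ p $ k = \<rho> q l $ k $ p" "\<rho> p k $ q $ l = \<rho> k p $ l $ q"
    "\<rho> k l $ q $ p = - \<rho> k l $ p $ q" "\<rho> l p $ q $ k = - \<rho> l p $ k $ q"
    using curv_skew(3)[of p q l k] curv_skew(3)[of q k p l] curv_skew(3)[of k l q p] curv_skew(3)[of l p q k]
      curv_skew(3)[of l q p k] curv_skew(4)[of l q k p] curv_skew(3)[of p k q l] curv_skew(4)[of p k l q]
    by simp_all
  then show ?thesis
    using curv_bianchi[of p q k l] curv_bianchi[of p q l k] curv_bianchi[of q k p l] curv_bianchi[of p k q l]
    by linarith
qed

lemma curv_form_sym: "curv_form \<rho> v w = curv_form \<rho> w v"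
proof -
  have "(\<Sum>p\<in>UNIV. \<Sum>q\<in>UNIV. \<Sum>k\<in>UNIV. \<Sum>l\<in>UNIV. v $ p $ q * \<rho> p q $ k $ l * w $ k $ l)
      = (\<Sum>p\<in>UNIV. \<Sum>k\<in>UNIV. \<Sum>q\<in>UNIV. \<Sum>l\<in>UNIV. v $ p $ q * \<rho> p q $ k $ l * w $ k $ l)"
    by (rule sum.cong[OF refl], rule sum.swap)
  also have "\<dots> = (\<Sum>k\<in>UNIV. \<Sum>p\<in>UNIV. \<Sum>q\<in>UNIV. \<Sum>l\<in>UNIV. v $ p $ q * \<rho> p q $ k $ l * w $ k $ l)"
    by (rule sum.swap)
  also have "\<dots> = (\<Sum>k\<in>UNIV. \<Sum>p\<in>UNIV. \<Sum>l\<in>UNIV. \<Sum>q\<in>UNIV. v $ p $ q * \<rho> p q $ k $ l * w $ k $ l)"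
    by (rule sum.cong[OF refl], rule sum.cong[OF refl], rule sum.swap)
  also have "\<dots> = (\<Sum>k\<in>UNIV. \<Sum>l\<in>UNIV. \<Sum>p\<in>UNIV. \<Sum>q\<in>UNIV. v $ p $ q * \<rho> p q $ k $ l * w $ k $ l)"
    by (rule sum.cong[OF refl], rule sum.swap)
  also have "\<dots> = (\<Sum>k\<in>UNIV. \<Sum>l\<in>UNIV. \<Sum>p\<in>UNIV. \<Sum>q\<in>UNIV. w $ k $ l * \<rho> k l $ p $ q * v $ p $ q)"
    by (intro sum.cong refl) (simp add: curv_pair_symmetric mult.commute mult.left_commute)
  finally show ?thesis
    by (simp add: curv_form_def inner_vec_def sum_distrib_left mult.assoc)
qed

text \<open>
  The difference of the two traces is the cyclic sum of the first Bianchi identity.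
\<close>

lemma curv_form_trace:
  "(\<Sum>c\<in>UNIV. curv_form \<rho> (sd (axis c 1)) (sd (axis c 1))) = (\<Sum>c\<in>UNIV. curv_form \<rho> (asd (axis c 1)) (asd (axis c 1)))"
proof -
  note sk = curv_skew(1)[of 2 1] curv_skew(1)[of 3 1] curv_skew(1)[of 4 1] curv_skew(1)[of 3 2] curv_skew(1)[of 4 2]
    curv_skew(1)[of 4 3]
    curv_skew(3)[of _ _ 2 1] curv_skew(3)[of _ _ 3 1] curv_skew(3)[of _ _ 4 1] curv_skew(3)[of _ _ 3 2]
    curv_skew(3)[of _ _ 4 2] curv_skew(3)[of _ _ 4 3]
  have B: "\<rho> 1 2 $ 3 $ 4 - \<rho> 1 3 $ 2 $ 4 + \<rho> 1 4 $ 2 $ 3 = 0"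
    using curv_bianchi[of 1 2 3 4] curv_pair_symmetric[of 2 4 3 1] curv_skew(4)[of 3 1 2 4] curv_pair_symmetric[of 4 1 3 2]
      curv_skew(4)[of 3 2 4 1] curv_pair_symmetric[of 2 3 4 1] curv_skew(4)[of 4 1 2 3] by simp
  have "(\<Sum>c\<in>UNIV. curv_form \<rho> (sd (axis c 1)) (sd (axis c 1))) - (\<Sum>c\<in>UNIV. curv_form \<rho> (asd (axis c 1)) (asd (axis c 1)))
    = \<rho> 1 2 $ 3 $ 4 - \<rho> 1 3 $ 2 $ 4 + \<rho> 1 4 $ 2 $ 3"
    by (simp add: curv_form_def sum_4 sum_3 sd_def asd_def axis_def inner_vec_def sk
        curv_pair_symmetric[of 3 4 1 2] curv_pair_symmetric[of 2 4 1 3] curv_pair_symmetric[of 2 3 1 4] field_simps)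
  then show ?thesis unfolding B by simp
qed

text \<open>
  The heart of the matter. The letters \<open>\<alpha>\<close>, \<open>\<beta>\<close>, \<open>\<gamma>\<close> are the blocks of the curvature operator. The
  constant \<open>2/5\<close> comes out of a comparison of the traces of \<open>\<alpha>\<close> and \<open>\<gamma>\<close> in orthonormal bases that
  start with \<open>a\<close> and \<open>b\<close>.
\<close>

lemma pinched_positive:
  assumes lower: "\<And>a b. norm a = 1 \<Longrightarrow> norm b = 1 \<Longrightarrow> m \<le> curv_form \<rho> (sd a + asd b) (sd a + asd b)"
    and upper: "\<And>a b. norm a = 1 \<Longrightarrow> norm b = 1 \<Longrightarrow> curv_form \<rho> (sd a + asd b) (sd a + asd b) \<le> M"
    and pinch: "2 * M < 5 * m" and a: "norm a = 1" and b: "norm b \<le> 1"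
  shows "curv_form \<rho> (sd a) (sd a + asd b) > 0"
proof (rule ccontr)
  assume neg: "\<not> curv_form \<rho> (sd a) (sd a + asd b) > 0"
  obtain b0 t where b0: "norm b0 = 1" "b = t *\<^sub>R b0" "0 \<le> t" "t \<le> 1"
  proof (cases "b = 0")
    case True
    then show thesis using that[of "axis 1 1" 0] by simp
  next
    case False
    then show thesis using that[of "(1 / norm b) *\<^sub>R b" "norm b"] b by simp
  qed
  let ?\<alpha> = "\<lambda>x y. curv_form \<rho> (sd x) (sd y)" and ?\<gamma> = "\<lambda>x y. curv_form \<rho> (asd x) (asd y)"
  let ?\<beta> = "\<lambda>x y. curv_form \<rho> (sd x) (asd y)"
  have sec: "curv_form \<rho> (sd x + asd y) (sd x + asd y) = ?\<alpha> x x + 2 * ?\<beta> x y + ?\<gamma> y y" for x y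
    by (simp add: curv_form_linear curv_form_sym[of "asd y" "sd x"])
  have sec': "curv_form \<rho> (sd x + asd (- y)) (sd x + asd (- y)) = ?\<alpha> x x - 2 * ?\<beta> x y + ?\<gamma> y y" for x y
    by (simp add: curv_form_linear curv_form_sym[of "asd y" "sd x"] linear_neg[OF linear_asd])
  have lo: "m \<le> ?\<alpha> x x + ?\<gamma> y y" and hi: "?\<alpha> x x + ?\<gamma> y y \<le> M" if "norm x = 1" "norm y = 1" for x y
    using lower[of x y, unfolded sec] lower[of x "- y", unfolded sec']
      upper[of x y, unfolded sec] upper[of x "- y", unfolded sec'] that by simp_all
  have "bilinear ?\<alpha>" "bilinear ?\<gamma>"
    by (simp_all add: bilinear_def linear_iff curv_form_linear linear_add[OF linear_sd] linear_add[OF linear_asd]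
        linear_scale[OF linear_sd] linear_scale[OF linear_asd])
  obtain A B where A: "orthogonal_matrix A" "A *v axis 1 1 = a" and B: "orthogonal_matrix B" "B *v axis 1 1 = b0"
    using orthogonal_matrix_exists_basis[OF a] orthogonal_matrix_exists_basis[OF b0(1)] by metis
  define a2 a3 b2 b3 where ab: "a2 = A *v axis 2 1" "a3 = A *v axis 3 1" "b2 = B *v axis 2 1" "b3 = B *v axis 3 1"
  have unit: "norm a2 = 1" "norm a3 = 1" "norm b2 = 1" "norm b3 = 1"
  proof -
    have "norm (C *v axis i 1) = 1" if "orthogonal_matrix C" for C :: "real^3^3" and i
      using that inner_transpose_mult[of "axis i 1" C "C *v axis i 1"]
      by (simp add: norm_eq_1 matrix_vector_mul_assoc orthogonal_matrix_def inner_axis_axis)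
    then show "norm a2 = 1" "norm a3 = 1" "norm b2 = 1" "norm b3 = 1"
      using A(1) B(1) by (simp_all add: ab)
  qed
  have tr: "?\<alpha> a a + ?\<alpha> a2 a2 + ?\<alpha> a3 a3 = ?\<gamma> b0 b0 + ?\<gamma> b2 b2 + ?\<gamma> b3 b3"
    using sum_orthogonal_basis[OF \<open>bilinear ?\<alpha>\<close> A(1)] sum_orthogonal_basis[OF \<open>bilinear ?\<gamma>\<close> B(1)] curv_form_trace
    by (simp add: sum_3 A(2) B(2) ab)
  have "m \<le> ?\<alpha> a a + 2 * t * ?\<beta> a b0 + ?\<gamma> b0 b0"
  proof -
    \<comment> \<open>A convex combination of the bounds for the planes of \<open>a\<close> with \<open>b0\<close> and with \<open>- b0\<close>.\<close>
    have "(1 + t) / 2 * m + (1 - t) / 2 * m \<le> (1 + t) / 2 * (?\<alpha> a a + 2 * ?\<beta> a b0 + ?\<gamma> b0 b0)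
        + (1 - t) / 2 * (?\<alpha> a a - 2 * ?\<beta> a b0 + ?\<gamma> b0 b0)"
      using lower[of a b0, unfolded sec] lower[of a "- b0", unfolded sec'] a b0
      by (intro add_mono mult_left_mono) auto
    then show ?thesis by (simp add: field_simps)
  qed
  moreover have "?\<alpha> a a + t * ?\<beta> a b0 \<le> 0"
    using neg by (simp add: b0(2) curv_form_linear linear_scale[OF linear_asd])
  \<comment> \<open>Replace \<open>2 t \<beta>\<close> by the larger \<open>- 2 \<alpha>\<close>.\<close>
  ultimately have "?\<gamma> b0 b0 - ?\<alpha> a a \<ge> m" by linarith
  then show False
    using tr lo[OF a unit(3)] lo[OF a unit(4)] hi[OF unit(1) b0(1)] hi[OF unit(2) b0(1)] pinch by linarith
qed

text \<open>
  The first block column of the curvature operator.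
\<close>

lemma curvature_of_self_dual:
  "(\<chi> p q. (\<rho> p q \<bullet> sd y) / 4) = sd (\<chi> d. curv_form \<rho> (sd (axis d 1)) (sd y))
     + asd (\<chi> d. curv_form \<rho> (asd (axis d 1)) (sd y))"
proof -
  have S: "(\<rho> q p \<bullet> sd y) / 4 = - ((\<rho> p q \<bullet> sd y) / 4)" for p q
    by (subst curv_skew(1)) simp
  have "two_form (\<chi> p q. (\<rho> p q \<bullet> sd y) / 4)"
    unfolding two_form_def vec_eq_iff transpose_def
    by (intro allI, simp only: vec_lambda_beta vector_uminus_component, rule S)
  then obtain c d where cd: "(\<chi> p q. (\<rho> p q \<bullet> sd y) / 4) = sd c + asd d" by (rule two_form_split)
  define S where "S p q = \<rho> p q \<bullet> sd y" for p q
  have form: "curv_form \<rho> v (sd y) = (v \<bullet> (sd c + asd d)) / 4" for v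
    unfolding cd[symmetric] S_def[symmetric] curv_form_def
    by (simp add: inner_vec_def sum_divide_distrib)
  have "c = (\<chi> d. curv_form \<rho> (sd (axis d 1)) (sd y))" "d = (\<chi> d. curv_form \<rho> (asd (axis d 1)) (sd y))"
    by (simp_all add: vec_eq_iff form inner_add_right inner_sd_sd inner_sd_asd inner_asd_sd inner_asd_asd inner_axis')
  then show ?thesis using cd by simp
qed

text \<open>
  Since \<open>pinched_positive\<close> holds for all \<open>b\<close> of norm at most 1, it compares \<open>\<alpha>(y,y)\<close> with the norm of
  \<open>\<beta>\<^sup>T y\<close>, and \<open>\<alpha>(y,y)\<close> is at most the product of the norms of \<open>y\<close> and \<open>\<alpha> y\<close>.
\<close>

lemma pinched_contraction:
  assumes lower: "\<And>a b. norm a = 1 \<Longrightarrow> norm b = 1 \<Longrightarrow> m \<le> curv_form \<rho> (sd a + asd b) (sd a + asd b)"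
    and upper: "\<And>a b. norm a = 1 \<Longrightarrow> norm b = 1 \<Longrightarrow> curv_form \<rho> (sd a + asd b) (sd a + asd b) \<le> M"
    and pinch: "2 * M < 5 * m"
  defines "\<alpha> \<equiv> \<lambda>c. \<chi> d. curv_form \<rho> (sd (axis d 1)) (sd (axis c 1))"
    and "\<beta> \<equiv> \<lambda>c. \<chi> d. curv_form \<rho> (asd (axis d 1)) (sd (axis c 1))"
  shows "y \<noteq> 0 \<Longrightarrow> norm (\<Sum>c\<in>UNIV. y $ c *\<^sub>R \<beta> c) < norm (\<Sum>c\<in>UNIV. y $ c *\<^sub>R \<alpha> c)"
    and "det (\<chi> c. \<alpha> c) > 0"
proof -
  define a where "a y = (\<Sum>c\<in>UNIV. y $ c *\<^sub>R \<alpha> c)" for y :: "real^3"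
  define b where "b y = (\<Sum>c\<in>UNIV. y $ c *\<^sub>R \<beta> c)" for y :: "real^3"
  have sd_exp: "sd y = (\<Sum>c\<in>UNIV. y $ c *\<^sub>R sd (axis c 1))"
    and asd_exp: "asd y = (\<Sum>c\<in>UNIV. y $ c *\<^sub>R asd (axis c 1))" for y
    by (simp_all add: forms_expand axis_def)
  have a: "x \<bullet> a y = curv_form \<rho> (sd x) (sd y)" for x y
    unfolding sd_exp[of x] sd_exp[of y]
    by (simp add: a_def \<alpha>_def inner_vec_def sum_3 curv_form_linear algebra_simps)
  have b: "x \<bullet> b y = curv_form \<rho> (asd x) (sd y)" for x y
    unfolding asd_exp[of x] sd_exp[of y]
    by (simp add: b_def \<beta>_def inner_vec_def sum_3 curv_form_linear algebra_simps)
  have pos: "x \<bullet> b y < y \<bullet> a y" if "y \<noteq> 0" "norm x \<le> norm y" for x y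
  proof -
    let ?r = "norm y"
    have r: "?r > 0" using that by simp
    have "0 < curv_form \<rho> (sd ((1 / ?r) *\<^sub>R y)) (sd ((1 / ?r) *\<^sub>R y) + asd (- (1 / ?r) *\<^sub>R x))"
      using that by (intro pinched_positive[OF lower upper pinch]) auto
    also have "\<dots> = (1 / ?r)\<^sup>2 * (y \<bullet> a y - x \<bullet> b y)"
      by (simp add: a b curv_form_linear linear_scale[OF linear_sd] linear_scale[OF linear_asd] linear_neg[OF linear_asd]
          curv_form_sym[of "sd y" "asd x"] power2_eq_square algebra_simps)
    finally show ?thesis using r by (simp add: zero_less_mult_iff)
  qed
  show "norm (\<Sum>c\<in>UNIV. y $ c *\<^sub>R \<beta> c) < norm (\<Sum>c\<in>UNIV. y $ c *\<^sub>R \<alpha> c)" if y: "y \<noteq> 0"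
  proof -
    \<comment> \<open>If \<open>b y = 0\<close>, then \<open>x = 0\<close> since \<open>norm y / 0 = 0\<close>, and the argument still works.\<close>
    define x where "x = (norm y / norm (b y)) *\<^sub>R b y"
    have x: "norm x \<le> norm y" by (simp add: x_def)
    have "norm y * norm (b y) = x \<bullet> b y"
      by (simp add: x_def dot_square_norm power2_eq_square)
    also have "\<dots> < y \<bullet> a y" by (rule pos[OF y x])
    also have "\<dots> \<le> norm y * norm (a y)" by (rule norm_cauchy_schwarz)
    finally show ?thesis using y by (simp add: a_def b_def)
  qed
  have mat: "(\<chi> c. \<alpha> c) *v y = a y" for y
  proof -
    have sym: "\<alpha> c $ d = \<alpha> d $ c" for c d
      by (simp add: \<alpha>_def) (rule curv_form_sym)
    have "((\<chi> c. \<alpha> c) *v y) $ c = a y $ c" for c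
      by (simp add: a_def matrix_vector_mult_def sym[of c] mult.commute)
    then show ?thesis by (simp add: vec_eq_iff)
  qed
  have "pos_def_matrix (\<chi> c. \<alpha> c)"
    unfolding pos_def_matrix_def mat using pos[of _ 0]
    by (auto simp: transpose_def \<alpha>_def curv_form_sym vec_eq_iff)
  then have "\<exists>L :: real^4 \<Rightarrow> real^3^3. smooth_on UNIV L \<and> (\<forall>y\<in>UNIV. transpose (L y) ** (\<chi> c. \<alpha> c) ** L y = mat 1)"
    by (intro gram_schmidt_smooth) (simp_all add: smooth_on_const)
  then obtain L :: "real^3^3" where L: "transpose L ** (\<chi> c. \<alpha> c) ** L = mat 1" by blast
  have "(det L)\<^sup>2 * det (\<chi> c. \<alpha> c) = 1"
    using arg_cong[OF L, of det] by (simp add: det_mul det_transpose power2_eq_square algebra_simps)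
  then show "det (\<chi> c. \<alpha> c) > 0"
    by (metis zero_less_one zero_less_mult_pos zero_le_power2 less_eq_real_def mult_zero_left zero_neq_one)
qed

end

section \<open>The Levi-Civita connection on self-dual forms\<close>

text \<open>
  The adjoint action of \<open>so(4)\<close> on self-dual forms only sees the self-dual part, as a cross product.
\<close>

lemma sd_bracket_two_form:
  "sd x ** (sd n + asd n') - (sd n + asd n') ** sd x = sd ((-2) *\<^sub>R cross3 x n)"
  by (simp add: forms_expand cross3_def algebra_simps)

context
  fixes U :: "(real^4) set" and g :: "real^4 \<Rightarrow> real^4^4" and x :: "real^4"
  assumes U: "open U" and g: "smooth_on U g" and posdef: "\<And>y. y \<in> U \<Longrightarrow> pos_def_matrix (g y)"
    and x: "x \<in> U"
begin

lemma oriented_smooth_coframe: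
  assumes \<sigma>: "\<sigma> \<in> {1, -1 :: real}"
  obtains V P E where "open V" "x \<in> V" "V \<subseteq> U" "smooth_on U P" "smooth_on U E"
    "\<And>y. y \<in> U \<Longrightarrow> P y ** E y = mat 1" "\<And>y. y \<in> U \<Longrightarrow> g y = transpose (P y) ** P y"
    "\<And>y. y \<in> V \<Longrightarrow> \<sigma> * det (P y :: real^4^4) > 0"
proof -
  obtain E0 :: "real^4 \<Rightarrow> real^4^4" where E0: "smooth_on U E0" "\<And>y. y \<in> U \<Longrightarrow> transpose (E0 y) ** g y ** E0 y = mat 1"
    using gram_schmidt_smooth[OF U g] posdef by blast
  define D :: "real^4^4" where "D = (\<chi> i j. if i = j then (if i = 1 then -1 else 1) else 0)"
  have D: "transpose D ** D = mat 1" "det D = -1"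
    by (simp_all add: D_def vec_eq_iff forall_4 matrix_matrix_mult_def transpose_def sum_4 mat_def det_4)
  have det0: "det (E0 x) \<noteq> 0"
    using arg_cong[OF E0(2)[OF x], of det] by (auto simp: det_mul)
  \<comment> \<open>The reflection \<open>D\<close> corrects the orientation at \<open>x\<close>, and then on a neighbourhood \<open>V\<close>.\<close>
  define C where "C = (if \<sigma> * det (E0 x) > 0 then mat 1 else D)"
  have C: "transpose C ** C = mat 1" by (simp add: C_def D)
  define E where "E y = E0 y ** C" for y
  have detE: "\<sigma> * det (E x) > 0"
    using det0 \<sigma> by (auto simp: E_def C_def det_mul D not_less)
  have smE: "smooth_on U E" unfolding E_def by (intro smooth_on_matrix_mult smooth_on_const U E0)
  have E: "transpose (E y) ** g y ** E y = mat 1" if "y \<in> U" for y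
  proof -
    have "transpose (E y) ** g y ** E y = transpose C ** (transpose (E0 y) ** g y ** E0 y) ** C"
      by (simp add: E_def matrix_transpose_mul matrix_mul_assoc)
    then show ?thesis by (simp add: E0(2)[OF that] C)
  qed
  define P where "P y = transpose (E y) ** g y" for y
  have smP: "smooth_on U P" unfolding P_def by (intro smooth_on_matrix_mult smooth_on_transpose U smE g)
  have sym: "transpose (g y) = g y" if "y \<in> U" for y using posdef[OF that] by (simp add: pos_def_matrix_def)
  have PE: "P y ** E y = mat 1" "g y = transpose (P y) ** P y" if "y \<in> U" for y
    using coframe_of_orthonormal_frame(1,3)[OF sym[OF that] E[OF that]] by (simp_all add: P_def)
  define V where "V = {y \<in> U. \<sigma> * det (P y) > 0}"
  have cont: "continuous_on U (\<lambda>y. P y $ i $ j)" for i j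
    by (intro smooth_on_continuous_on smooth_on_nth U smP)
  have "continuous_on U (\<lambda>y. \<sigma> * det (P y))"
    unfolding det_4 by (intro continuous_on_mult continuous_on_add continuous_on_diff continuous_on_const cont)
  then have "open (U \<inter> (\<lambda>y. \<sigma> * det (P y)) -` {0<..})"
    by (rule continuous_open_preimage[OF _ U open_greaterThan])
  then have "open V" by (simp add: V_def Int_def vimage_def)
  moreover have "x \<in> V"
  proof -
    have "det (P x) * det (E x) = 1" using arg_cong[OF PE(1)[OF x], of det] by (simp add: det_mul)
    then have "\<sigma> * det (P x) > 0"
      using detE \<sigma> zero_less_mult_iff[of "det (P x)" "det (E x)"] by auto
    then show ?thesis by (simp add: V_def x)
  qed
  ultimately show thesis
    by (intro that[of V P E] smE smP PE) (simp_all add: V_def)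
qed

text \<open>
  In the frame \<open>E\<close> the Levi-Civita connection has the matrix \<open>- N\<close>, and \<open>N = (dP - P \<Gamma>) E\<close> is skew
  because the connection is metric. Since \<open>so(4)\<close> preserves the standard self-dual forms under the
  bracket, the pullbacks of these forms are a frame with connection matrix \<open>A\<close>. The forms \<open>sd (axis b 1)\<close> have
  norm \<open>sqrt 2\<close>.
\<close>

lemma connection_on_self_dual_forms:
  assumes \<sigma>: "\<sigma> \<in> {1, -1 :: real}"
  obtains V P E e A where "open V" "x \<in> V" "V \<subseteq> U" "levi_civita_on_forms g \<sigma> V e A"
    "P ** E = mat 1" "g x = transpose P ** P" "\<sigma> * det P > 0"
    "\<And>b. e b x = (1 / sqrt 2) *\<^sub>R (transpose P ** sd (axis b 1) ** P)"
proof -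
  obtain V P E where V: "open V" "x \<in> V" "V \<subseteq> U" and P: "smooth_on U P" and E: "smooth_on U E"
    and PE: "\<And>y. y \<in> U \<Longrightarrow> P y ** E y = mat 1" and gP: "\<And>y. y \<in> U \<Longrightarrow> g y = transpose (P y) ** P y"
    and det: "\<And>y. y \<in> V \<Longrightarrow> \<sigma> * det (P y :: real^4^4) > 0"
    using oriented_smooth_coframe[OF \<sigma>] by blast
  define \<omega> :: "3 \<Rightarrow> real^4^4" where "\<omega> b = sd (axis b 1)" for b
  define e where "e b y = transpose (P y) ** ((1 / sqrt 2) *\<^sub>R \<omega> b) ** P y" for b y
  define D where "D k y = pd k P y - P y ** levi_civita g k y" for k y
  define N where "N k y = D k y ** E y" for k y
  define A :: "4 \<Rightarrow> real^4 \<Rightarrow> real^3^3" where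
    "A k y = (\<chi> a b. (\<omega> a \<bullet> (\<omega> b ** N k y - N k y ** \<omega> b)) * (1/4))" for k y
  note smG = smooth_on_levi_civita[OF U g posdef]
  have smN: "smooth_on U (N k)" for k
    unfolding N_def D_def by (intro smooth_on_matrix_mult smooth_on_diff smooth_on_pd smG U P E)
  have sme: "smooth_on U (e b)" for b
    unfolding e_def by (intro smooth_on_matrix_mult smooth_on_transpose smooth_on_const U P)
  have smA1: "smooth_on U (\<lambda>y. (\<omega> a \<bullet> (\<omega> b ** N k y - N k y ** \<omega> b)) * (1/4))" for a b k
  proof -
    have "smooth_on U (\<lambda>y. \<omega> b ** N k y - N k y ** \<omega> b)"
      by (intro smooth_on_diff smooth_on_matrix_mult smooth_on_const U smN)
    from smooth_on_mult[OF U smooth_on_inner[OF U smooth_on_const this] smooth_on_const]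
    show ?thesis .
  qed
  have smA: "smooth_on U (A k)" for k
    unfolding A_def by (intro smooth_on_vec_lambda U smA1)
  have skN: "two_form (N k y)" if y: "y \<in> U" for k y
  proof -
    have "pd k g y = pd k (\<lambda>y. transpose (P y) ** P y) y"
      using U y gP by (rule pd_cong)
    also have "\<dots> = transpose (pd k P y) ** P y + transpose (P y) ** pd k P y"
      by (simp add: pd_matrix_mult[OF smooth_on_transpose[OF U P] P y] pd_transpose[OF P y])
    finally have "transpose (pd k P y) ** P y + transpose (P y) ** pd k P y
      = transpose (levi_civita g k y) ** (transpose (P y) ** P y) + (transpose (P y) ** P y) ** levi_civita g k y"
      using levi_civita_metric[OF U g posdef y, of k] gP[OF y] by simp
    then have "transpose (D k y) ** P y + transpose (P y) ** D k y = 0"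
      by (simp add: D_def matrix_transpose_mul matrix_mul_assoc algebra_simps)
    then have "transpose (E y) ** (transpose (D k y) ** P y + transpose (P y) ** D k y) ** E y = 0"
      by simp
    then have "transpose (N k y) ** (P y ** E y) + transpose (P y ** E y) ** N k y = 0"
      by (simp add: N_def matrix_transpose_mul matrix_mul_assoc)
    then show ?thesis by (simp add: PE[OF y] two_form_def eq_neg_iff_add_eq_0)
  qed
  have br: "\<exists>n. \<forall>b. \<omega> b ** N k y - N k y ** \<omega> b = sd ((-2) *\<^sub>R cross3 (axis b 1) n)" if "y \<in> U" for k y
    using two_form_split[OF skN[OF that, of k]] sd_bracket_two_form unfolding \<omega>_def by metis
  have "transpose (A k y) = - A k y" if y: "y \<in> U" for k y
  proof -
    obtain n where n: "\<And>b. \<omega> b ** N k y - N k y ** \<omega> b = sd ((-2) *\<^sub>R cross3 (axis b 1) n)"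
      using br[OF y] by blast
    have sk: "v \<bullet> cross3 w n = - (w \<bullet> cross3 v n)" for v w
      by (simp add: cross3_def inner_vec_def sum_3 algebra_simps)
    have S: "(\<omega> b \<bullet> sd ((-2) *\<^sub>R cross3 (axis a 1) n)) * (1/4)
        = - ((\<omega> a \<bullet> sd ((-2) *\<^sub>R cross3 (axis b 1) n)) * (1/4))" for a b
      using sk[of "axis b 1" "axis a 1"] by (simp add: \<omega>_def inner_sd_sd)
    show ?thesis unfolding A_def n transpose_def vec_eq_iff
      by (intro allI, simp only: vec_lambda_beta vector_uminus_component, rule S)
  qed
  moreover have "nabla_form g k (e b) y = (\<Sum>a\<in>UNIV. A k y $ a $ b *\<^sub>R e a y)" if y: "y \<in> U" for k b y
  proof -
    have "pd k (e b) y = transpose (pd k P y) ** ((1 / sqrt 2) *\<^sub>R \<omega> b) ** P y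
      + transpose (P y) ** ((1 / sqrt 2) *\<^sub>R \<omega> b) ** pd k P y"
      unfolding e_def
      by (subst pd_matrix_mult[OF smooth_on_matrix_mult[OF U smooth_on_transpose[OF U P] smooth_on_const] P y],
          subst pd_matrix_mult[OF smooth_on_transpose[OF U P] smooth_on_const y])
         (simp add: pd_transpose[OF P y] pd_const)
    then have "nabla_form g k (e b) y = (1 / sqrt 2) *\<^sub>R (transpose (D k y) ** \<omega> b ** P y + transpose (P y) ** \<omega> b ** D k y)"
      by (simp add: nabla_form_def e_def D_def matrix_transpose_mul matrix_mul_assoc algebra_simps)
    moreover have "D k y = N k y ** P y"
      unfolding N_def by (metis inverse_right PE matrix_mul_assoc matrix_mul_rid y)
    moreover have "transpose (N k y) = - N k y" using skN[OF y] by (simp add: two_form_def)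
    ultimately have nab: "nabla_form g k (e b) y = (1 / sqrt 2) *\<^sub>R (transpose (P y) ** (\<omega> b ** N k y - N k y ** \<omega> b) ** P y)"
      by (simp add: matrix_transpose_mul matrix_mul_assoc)
    obtain n where n: "\<And>b. \<omega> b ** N k y - N k y ** \<omega> b = sd ((-2) *\<^sub>R cross3 (axis b 1) n)"
      using br[OF y] by blast
    let ?z = "(-2) *\<^sub>R cross3 (axis b 1) n"
    have "sd ?z = (\<Sum>a\<in>UNIV. ?z $ a *\<^sub>R \<omega> a)" by (simp add: \<omega>_def forms_expand axis_def)
    moreover have "A k y $ a $ b = ?z $ a" for a
      unfolding A_def n by (simp add: \<omega>_def inner_sd_sd inner_axis')
    ultimately show ?thesis
      unfolding nab n
      by (simp add: e_def bounded_bilinear.sum_left[OF bounded_bilinear_matrix_mult]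
        bounded_bilinear.sum_right[OF bounded_bilinear_matrix_mult] scaleR_sum_right mult.commute)
  qed
  moreover have "e a y \<in> self_dual_forms (g y) \<sigma>" if "y \<in> V" for a y
  proof -
    have y: "y \<in> U" using that V by blast
    show ?thesis
      unfolding gP[OF y] self_dual_forms_pullback[OF PE[OF y] \<sigma> det[OF that]]
      by (rule range_eqI[of _ _ "(1 / sqrt 2) *\<^sub>R axis a 1"]) (simp add: e_def \<omega>_def linear_scale[OF linear_sd])
  qed
  moreover have "form_inner (g y) (e a y) (e b y) = (if a = b then 1 else 0)" if "y \<in> V" for a b y
  proof -
    have y: "y \<in> U" using that V by blast
    show ?thesis
      unfolding gP[OF y] e_def form_inner_pullback[OF PE[OF y]]
      by (simp add: \<omega>_def inner_sd_sd inner_axis_axis)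
  qed
  ultimately have "levi_civita_on_forms g \<sigma> V e A"
    using V smooth_on_subset[OF sme V(3)] smooth_on_subset[OF smA V(3)]
    unfolding levi_civita_on_forms_def so3_connection_on_def by blast
  then show thesis
    using that[of V e A "P x" "E x"] V PE[OF x] gP[OF x] det[OF V(2)] by (simp add: e_def \<omega>_def)
qed

lemma curvature_on_forms:
  assumes lc: "levi_civita_on_forms g \<sigma> V e A" and V: "open V" "x \<in> V" "V \<subseteq> U"
  shows "(\<Sum>a\<in>UNIV. curvature A x i j $ a $ b *\<^sub>R e a x)
    = - (transpose (curvature (levi_civita g) x i j) ** e b x + e b x ** curvature (levi_civita g) x i j)"
proof (rule curvature_in_frame[OF V(1,2)])
  show "smooth_on V (e b)" "smooth_on V (A k)" for b k
    using lc unfolding levi_civita_on_forms_def so3_connection_on_def by blast+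
  show "smooth_on V (levi_civita g k)" for k
    by (rule smooth_on_subset[OF smooth_on_levi_civita[OF U g posdef] V(3)])
  fix y k b assume "y \<in> V"
  then have "nabla_form g k (e b) y = (\<Sum>a\<in>UNIV. A k y $ a $ b *\<^sub>R e a y)"
    using lc unfolding levi_civita_on_forms_def by blast
  then show "pd k (e b) y = (\<Sum>a\<in>UNIV. A k y $ a $ b *\<^sub>R e a y)
    + (transpose (levi_civita g k y) ** e b y + e b y ** levi_civita g k y)"
    by (simp add: nabla_form_def algebra_simps)
qed

text \<open>
  The curvature of the connection on self-dual forms is the action of the Riemann tensor on them, so by
  \<open>sd_bracket_two_form\<close> it is the cross product with the self-dual component of \<open>R(\<partial>\<^sub>i, \<partial>\<^sub>j)\<close>.
\<close>

lemma curvature_in_coframe: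
  assumes lc: "levi_civita_on_forms g \<sigma> V e A" and V: "open V" "x \<in> V" "V \<subseteq> U"
    and PE: "P ** E = mat 1" and gP: "g x = transpose P ** P"
    and e: "\<And>b. e b x = (1 / sqrt 2) *\<^sub>R (transpose P ** sd (axis b 1) ** P)"
  defines "\<phi> \<equiv> \<lambda>c. transpose P ** (\<chi> p q. (frame_curvature g x E P p q \<bullet> sd (axis c 1)) / 4) ** P"
  shows "curvature A x i j = (-2) *\<^sub>R cross_matrix (\<chi> c. \<phi> c $ i $ j)"
proof -
  define R where "R i j = curvature (levi_civita g) x i j" for i j
  define \<psi> where "\<psi> c = (\<chi> i j. ((P ** R i j ** E) \<bullet> sd (axis c 1)) / 4)" for c :: 3
  have "(transpose E ** \<psi> c ** E) $ p $ q = (\<Sum>i\<in>UNIV. \<Sum>j\<in>UNIV. E $ i $ p * E $ j $ q * \<psi> c $ i $ j)" for c p q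
    by (simp add: matrix_matrix_mult_def transpose_def sum_4 algebra_simps)
  moreover have "(frame_curvature g x E P p q \<bullet> sd (axis c 1)) / 4
      = (\<Sum>i\<in>UNIV. \<Sum>j\<in>UNIV. E $ i $ p * E $ j $ q * \<psi> c $ i $ j)" for c p q
    by (simp add: \<psi>_def frame_curvature_def curvature_op_def column_def
        bounded_bilinear.sum_left[OF bounded_bilinear_matrix_mult]
        bounded_bilinear.sum_right[OF bounded_bilinear_matrix_mult] inner_sum_left R_def sum_divide_distrib)
  ultimately have "(transpose E ** \<psi> c ** E) $ p $ q = (frame_curvature g x E P p q \<bullet> sd (axis c 1)) / 4" for c p q
    by simp
  then have "transpose E ** \<psi> c ** E = (\<chi> p q. (frame_curvature g x E P p q \<bullet> sd (axis c 1)) / 4)" for c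
    by (simp add: vec_eq_iff)
  note frame = this
  have \<phi>: "\<phi> = \<psi>"
    unfolding \<phi>_def frame[symmetric] pullback_inverse(1)[OF PE] ..
  have "transpose (R i j) ** g x + g x ** R i j = 0"
    unfolding R_def by (rule levi_civita_curvature_skew[OF U g posdef x])
  then have "transpose E ** (transpose (R i j) ** (transpose P ** P) + (transpose P ** P) ** R i j) ** E = 0"
    by (simp add: gP)
  then have "transpose (P ** R i j ** E) ** (P ** E) + transpose (P ** E) ** (P ** R i j ** E) = 0"
    by (simp add: matrix_transpose_mul matrix_mul_assoc)
  then have "two_form (P ** R i j ** E)"
    by (simp add: PE two_form_def eq_neg_iff_add_eq_0)
  then obtain r r' where r: "P ** R i j ** E = sd r + asd r'" by (rule two_form_split)
  have \<psi>r: "(\<chi> c. \<psi> c $ i $ j) = r"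
    by (simp add: \<psi>_def r vec_eq_iff inner_add_left inner_sd_sd inner_asd_sd inner_axis)
  have Rr: "R i j = E ** (sd r + asd r') ** P"
  proof -
    have "E ** (P ** R i j ** E) ** P = (E ** P) ** R i j ** (E ** P)" by (simp add: matrix_mul_assoc)
    then show ?thesis by (simp only: r inverse_right[OF PE] matrix_mul_lid matrix_mul_rid)
  qed
  have "sd (\<chi> a. curvature A x i j $ a $ b) = sd (2 *\<^sub>R cross3 (axis b 1) r)" for b
  proof -
    have "transpose (R i j) ** (transpose P ** sd (axis b 1) ** P) + (transpose P ** sd (axis b 1) ** P) ** R i j
      = transpose P ** (transpose (sd r + asd r') ** transpose (P ** E) ** sd (axis b 1)
        + sd (axis b 1) ** (P ** E) ** (sd r + asd r')) ** P"
      unfolding Rr by (simp add: matrix_transpose_mul matrix_mul_assoc)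
    also have "transpose (sd r + asd r') = - (sd r + asd r')"
      using two_form_lin(1)[OF two_form_sd two_form_asd] unfolding two_form_def by blast
    finally have act: "transpose (R i j) ** (transpose P ** sd (axis b 1) ** P) + (transpose P ** sd (axis b 1) ** P) ** R i j
      = transpose P ** (sd (axis b 1) ** (sd r + asd r') - (sd r + asd r') ** sd (axis b 1)) ** P"
      by (simp add: PE)
    have "transpose P ** sd (\<chi> a. curvature A x i j $ a $ b) ** P
       = (\<Sum>a\<in>UNIV. curvature A x i j $ a $ b *\<^sub>R (transpose P ** sd (axis a 1) ** P))"
    proof -
      have "sd (\<chi> a. curvature A x i j $ a $ b) = (\<Sum>a\<in>UNIV. curvature A x i j $ a $ b *\<^sub>R sd (axis a 1))"
        by (simp add: forms_expand axis_def)
      then show ?thesis by (simp add: bounded_bilinear.sum_left[OF bounded_bilinear_matrix_mult]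
        bounded_bilinear.sum_right[OF bounded_bilinear_matrix_mult])
    qed
    also have "(1 / sqrt 2) *\<^sub>R \<dots> = - (1 / sqrt 2) *\<^sub>R
      (transpose (R i j) ** (transpose P ** sd (axis b 1) ** P) + (transpose P ** sd (axis b 1) ** P) ** R i j)"
      using curvature_on_forms[OF lc V, of i j b]
      by (simp add: e R_def[symmetric] scaleR_sum_right scaleR_add_right mult.commute)
    finally have "transpose P ** sd (\<chi> a. curvature A x i j $ a $ b) ** P = - (transpose P ** sd ((-2) *\<^sub>R cross3 (axis b 1) r) ** P)"
      unfolding act sd_bracket_two_form by (simp add: scaleR_minus_right[symmetric] del: scaleR_minus_right)
    then have "transpose P ** sd (\<chi> a. curvature A x i j $ a $ b) ** P = transpose P ** sd (2 *\<^sub>R cross3 (axis b 1) r) ** P"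
      by (simp add: linear_neg[OF linear_sd])
    then show ?thesis by (metis pullback_inverse(2)[OF PE])
  qed
  moreover have "inj sd"
    by (rule linear_injective_0[OF linear_sd, THEN iffD2]) (metis inner_sd_sd inner_eq_zero_iff inner_zero_left mult_eq_0_iff zero_neq_numeral)
  ultimately have col: "(\<chi> a. curvature A x i j $ a $ b) = 2 *\<^sub>R cross3 (axis b 1) r" for b
    by (meson injD)
  have "curvature A x i j $ a $ b = (2 *\<^sub>R cross3 (axis b 1) r) $ a" for a b
    using col[of b] by (metis vec_lambda_beta)
  then show ?thesis
    unfolding \<phi> \<psi>r by (simp add: vec_eq_iff forall_3 cross_matrix_def cross3_def axis_def)
qed

text \<open>
  The number \<open>s\<close> is the common sign of the sectional curvatures. The algebraic results are applied to
  the tensor \<open>s R\<close>, whose sectional curvatures are positive; passing from \<open>R\<close> to \<open>s R\<close> multiplies the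
  determinant of \<open>\<alpha>\<close> by \<open>s\<close>, since \<open>\<alpha>\<close> is \<open>3 \<times> 3\<close>.
\<close>

lemma definite_if_pinched:
  assumes \<sigma>: "\<sigma> \<in> {1, -1 :: real}" and s: "s \<in> {1, -1 :: real}"
    and sign: "\<And>k. k \<in> sectional_curvatures g x \<Longrightarrow> s * k > 0"
    and pinch: "Inf (abs ` sectional_curvatures g x) / Sup (abs ` sectional_curvatures g x) > 2/5"
  shows "\<exists>V e A. open V \<and> x \<in> V \<and> V \<subseteq> U \<and> levi_civita_on_forms g \<sigma> V e A \<and>
    definite_at A x \<and> (\<exists>M. curvature_matrix A x M \<and> s * det M > 0)"
proof (rule connection_on_self_dual_forms[OF \<sigma>])
  fix V P E e A
  assume V: "open V" "x \<in> V" "V \<subseteq> U" and lc: "levi_civita_on_forms g \<sigma> V e A"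
    and PE: "P ** E = mat 1" and gP: "g x = transpose P ** P" and det: "\<sigma> * det P > 0"
    and e: "\<And>b. e b x = (1 / sqrt 2) *\<^sub>R (transpose P ** sd (axis b 1) ** P)"
  define \<rho> where "\<rho> = frame_curvature g x E P"
  have alg: "algebraic_curvature \<rho>"
    unfolding \<rho>_def by (rule algebraic_curvature_frame[OF U g posdef x PE gP])
  define S where "S = abs ` sectional_curvatures g x"
  have S: "sectional_curvatures g x = {sec_num \<rho> u v / gram_det u v |u v. u \<noteq> v \<and> independent {u, v}}"
    unfolding \<rho>_def by (rule sectional_curvatures_in_frame[OF U g posdef x PE gP])
  have plane: "curv_form \<rho> (sd a + asd b) (sd a + asd b) \<in> sectional_curvatures g x"
    if ab: "norm a = 1" "norm b = 1" for a b
  proof -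
    obtain u v where uv: "u \<bullet> u = 1" "v \<bullet> v = 1" "u \<bullet> v = 0" "bivector u v = - (1/2) *\<^sub>R (sd a + asd b)"
      using plane_of_unit_vectors[OF ab] by blast
    have "independent {u, v}"
      using uv by (intro pairwise_orthogonal_independent) (auto simp: pairwise_def orthogonal_def inner_commute)
    moreover have "u \<noteq> v" using uv by auto
    moreover have "gram_det u v = 1" by (simp add: gram_det_def uv)
    moreover have "sec_num \<rho> u v = curv_form \<rho> (sd a + asd b) (sd a + asd b)"
      unfolding sec_num_bivector[OF curv_skew(1)[OF alg] curv_skew(2)[OF alg]] uv(4)
      by (simp add: curv_form_linear(3-6) del: scaleR_minus_left)
    ultimately show ?thesis unfolding S by (metis (mono_tags, lifting) div_by_1 mem_Collect_eq)
  qed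
  have abs_s: "\<bar>k\<bar> = s * k" if "k \<in> sectional_curvatures g x" for k
    using sign[OF that] s by auto
  obtain B where B: "\<And>k. k \<in> S \<Longrightarrow> k \<le> B"
  proof
    fix k assume "k \<in> S"
    then obtain u v where k: "k = \<bar>sec_num \<rho> u v / gram_det u v\<bar>" and uv: "u \<noteq> v" "independent {u, v}"
      unfolding S_def S by blast
    have "gram_det u v > 0" using gram_det_pos[OF uv] .
    then show "k \<le> (\<Sum>p\<in>UNIV. \<Sum>q\<in>UNIV. norm (\<rho> p q)) / 2"
      using sec_num_bound[OF curv_skew(1)[OF alg] curv_skew(2)[OF alg], where u = u and v = v] by (simp add: k abs_div pos_divide_le_eq)
  qed
  define m M where "m = Inf S" and "M = Sup S"
  have bdd: "bdd_below S" "bdd_above S"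
    using B by (auto simp: S_def intro!: bdd_belowI[of _ 0] bdd_aboveI[of _ B])
  have mM: "m \<le> s * k" "s * k \<le> M" if "k \<in> sectional_curvatures g x" for k
  proof -
    have "s * k \<in> S" unfolding S_def using abs_s[OF that] that by (metis imageI)
    then show "m \<le> s * k" "s * k \<le> M"
      unfolding m_def M_def using bdd by (auto intro: cInf_lower cSup_upper)
  qed
  have "M > 0"
  proof -
    have k: "curv_form \<rho> (sd (axis 1 1) + asd (axis 1 1)) (sd (axis 1 1) + asd (axis 1 1)) \<in> sectional_curvatures g x"
      by (rule plane) simp_all
    show ?thesis using sign[OF k] mM(2)[OF k] by linarith
  qed
  then have "2 * M < 5 * m"
    using pinch unfolding S_def[symmetric] m_def[symmetric] M_def[symmetric] by (simp add: field_simps)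
  define \<rho>' where "\<rho>' p q = s *\<^sub>R \<rho> p q" for p q
  have alg': "algebraic_curvature \<rho>'"
    unfolding algebraic_curvature_def
  proof (intro conjI allI)
    fix p q k l
    show "\<rho>' p q = - \<rho>' q p" unfolding \<rho>'_def by (subst curv_skew(1)[OF alg]) simp
    show "transpose (\<rho>' p q) = - \<rho>' p q" by (simp add: \<rho>'_def curv_skew(2)[OF alg])
    show "\<rho>' p q $ k $ l + \<rho>' q l $ k $ p + \<rho>' l p $ k $ q = 0"
      using curv_bianchi[OF alg, of p q k l] by (simp add: \<rho>'_def distrib_left[symmetric])
  qed
  have cf: "curv_form \<rho>' v w = s * curv_form \<rho> v w" for v w
    by (simp add: curv_form_def \<rho>'_def sum_distrib_left algebra_simps)
  have bounds: "m \<le> curv_form \<rho>' (sd a + asd b) (sd a + asd b)" "curv_form \<rho>' (sd a + asd b) (sd a + asd b) \<le> M"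
    if "norm a = 1" "norm b = 1" for a b
    unfolding cf using mM[OF plane[OF that]] by auto
  define \<alpha> :: "3 \<Rightarrow> real^3" where "\<alpha> = (\<lambda>c. \<chi> d. curv_form \<rho> (sd (axis d 1)) (sd (axis c 1)))"
  define \<beta> :: "3 \<Rightarrow> real^3" where "\<beta> = (\<lambda>c. \<chi> d. curv_form \<rho> (asd (axis d 1)) (sd (axis c 1)))"
  have \<alpha>': "(\<chi> d. curv_form \<rho>' (sd (axis d 1)) (sd (axis c 1))) = s *\<^sub>R \<alpha> c"
    and \<beta>': "(\<chi> d. curv_form \<rho>' (asd (axis d 1)) (sd (axis c 1))) = s *\<^sub>R \<beta> c" for c
    by (simp_all add: \<alpha>_def \<beta>_def cf vec_eq_iff)
  have contr: "norm (\<Sum>c\<in>UNIV. y $ c *\<^sub>R \<beta> c) < norm (\<Sum>c\<in>UNIV. y $ c *\<^sub>R \<alpha> c)" if "y \<noteq> 0" for y :: "real^3"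
  proof -
    have *: "norm (\<Sum>c\<in>UNIV. y $ c *\<^sub>R (s *\<^sub>R f c)) = norm (\<Sum>c\<in>UNIV. y $ c *\<^sub>R f c)" for f :: "3 \<Rightarrow> real^3"
    proof -
      have "(\<Sum>c\<in>UNIV. y $ c *\<^sub>R (s *\<^sub>R f c)) = s *\<^sub>R (\<Sum>c\<in>UNIV. y $ c *\<^sub>R f c)"
        by (simp add: scaleR_sum_right mult.commute)
      then show ?thesis using s by auto
    qed
    show ?thesis
      using pinched_contraction(1)[OF alg' bounds \<open>2 * M < 5 * m\<close> that] unfolding \<alpha>' \<beta>' * .
  qed
  have det_\<alpha>: "s * det (\<chi> c. \<alpha> c) > 0"
  proof -
    have "det (\<chi> c. s *\<^sub>R \<alpha> c) > 0"
      using pinched_contraction(2)[OF alg' bounds \<open>2 * M < 5 * m\<close>] unfolding \<alpha>' .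
    moreover have "det (\<chi> c. s *\<^sub>R \<alpha> c) = s * det (\<chi> c. \<alpha> c)"
      using s by (auto simp: det_3)
    ultimately show ?thesis by simp
  qed
  note F = curvature_in_coframe[OF lc V PE gP e, folded \<rho>_def]
  have \<phi>: "transpose P ** (\<chi> p q. (\<rho> p q \<bullet> sd (axis c 1)) / 4) ** P
    = transpose P ** (sd (\<alpha> c) + asd (\<beta> c)) ** P" for c
    unfolding curvature_of_self_dual[OF alg] \<alpha>_def \<beta>_def ..
  have "definite_at A x" by (rule definite_if_contraction(1)[OF F \<phi> PE \<sigma> det contr])
  moreover obtain M' where "curvature_matrix A x M'" "det M' * det (\<chi> c. \<alpha> c) > 0"
    using definite_if_contraction(2)[OF F \<phi> PE \<sigma> det contr] by blast
  moreover from this det_\<alpha> s have "s * det M' > 0"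
    by (auto simp: zero_less_mult_iff)
  ultimately show ?thesis using V lc by blast
qed

end

section \<open>Optimality of the pinching constant\<close>

text \<open>
  In coordinates, without a frame, both the numerator and the denominator of the sectional curvature are
  values of \<open>sec_num\<close> at tensors that depend continuously on the point: the Riemann tensor with its
  index lowered, and the tensor of a space of constant curvature 1 with metric \<open>h\<close>.
\<close>

definition lowered_curvature :: "(real^4 \<Rightarrow> real^4^4) \<Rightarrow> real^4 \<Rightarrow> 4 \<Rightarrow> 4 \<Rightarrow> real^4^4" where
  "lowered_curvature g x i j = g x ** curvature (levi_civita g) x i j"

definition unit_curvature :: "real^4^4 \<Rightarrow> 4 \<Rightarrow> 4 \<Rightarrow> real^4^4" where
  "unit_curvature h i j = (\<chi> k l. h $ k $ i * h $ l $ j - h $ k $ j * h $ l $ i)"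

lemma bivector_mult_vector: "bivector a b *v v = (v \<bullet> b) *\<^sub>R a - (v \<bullet> a) *\<^sub>R b"
  by (simp add: vec_eq_iff bivector_def matrix_vector_mult_def inner_vec_def
      sum_subtractf sum_distrib_left algebra_simps)

lemma sec_num_unit_curvature:
  assumes sym: "transpose h = h"
  shows "sec_num (unit_curvature h) u v = (u \<bullet> (h *v u)) * (v \<bullet> (h *v v)) - (u \<bullet> (h *v v))\<^sup>2"
proof -
  have row: "(h *v w) $ k = (\<Sum>p\<in>UNIV. h $ k $ p * w $ p)" for w k
    by (simp add: matrix_vector_mult_def)
  have "(\<Sum>p\<in>UNIV. \<Sum>q\<in>UNIV. u $ p * v $ q * (unit_curvature h p q $ k $ l)) = bivector (h *v u) (h *v v) $ k $ l" for k l
    by (simp add: unit_curvature_def bivector_def row sum_4 algebra_simps)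
  then have *: "(\<Sum>p\<in>UNIV. \<Sum>q\<in>UNIV. (u $ p * v $ q) *\<^sub>R unit_curvature h p q) = bivector (h *v u) (h *v v)"
    by (simp add: vec_eq_iff)
  have "sec_num (unit_curvature h) u v = u \<bullet> ((\<Sum>p\<in>UNIV. \<Sum>q\<in>UNIV. (u $ p * v $ q) *\<^sub>R unit_curvature h p q) *v v)"
    by (simp add: sec_num_def matrix_vector_mult_sum_left scaleR_matrix_vector inner_sum_right)
  also have "\<dots> = (u \<bullet> (h *v u)) * (v \<bullet> (h *v v)) - (u \<bullet> (h *v v)) * (v \<bullet> (h *v u))"
    unfolding * bivector_mult_vector by (simp add: inner_diff_right)
  also have "v \<bullet> (h *v u) = u \<bullet> (h *v v)"
    using inner_transpose_mult[of v h u] by (simp add: sym inner_commute)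
  finally show ?thesis by (simp add: power2_eq_square)
qed

lemma sectional_lowered:
  assumes sym: "transpose (g x) = g x"
  shows "sectional g x u v = sec_num (lowered_curvature g x) u v / sec_num (unit_curvature (g x)) u v"
proof -
  have ip: "a \<bullet> (g x *v b) = (g x *v a) \<bullet> b" for a b
    using inner_transpose_mult[of a "g x" b] by (simp add: sym)
  have "riemann g x u v v \<bullet> (g x *v u) = sec_num (lowered_curvature g x) u v"
    unfolding ip by (simp add: riemann_eq curvature_op_def matrix_vector_mult_sum_left scaleR_matrix_vector
        bounded_bilinear.sum_right[OF bounded_bilinear_matrix_vector_mult] 
        bounded_bilinear.scaleR_right[OF bounded_bilinear_matrix_vector_mult]
        inner_sum_left inner_sum_right sec_num_def lowered_curvature_def matrix_vector_mul_assoc inner_commute)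
  then show ?thesis by (simp add: sectional_def Let_def sec_num_unit_curvature[OF sym])
qed

lemma sec_num_diff_bound:
  assumes "\<And>p q. \<rho> p q = - \<rho> q p" "\<And>p q. transpose (\<rho> p q) = - \<rho> p q"
    and "\<And>p q. \<rho>' p q = - \<rho>' q p" "\<And>p q. transpose (\<rho>' p q) = - \<rho>' p q"
    and close: "(\<Sum>p\<in>UNIV. \<Sum>q\<in>UNIV. norm (\<rho> p q - \<rho>' p q)) \<le> 2 * d"
    and G: "gram_det u v \<ge> 0"
  shows "\<bar>sec_num \<rho> u v - sec_num \<rho>' u v\<bar> \<le> d * gram_det u v"
proof -
  have "sec_num \<rho> u v - sec_num \<rho>' u v = sec_num (\<lambda>p q. \<rho> p q - \<rho>' p q) u v"
    by (simp add: sec_num_def sum_subtractf[symmetric] matrix_vector_mult_diff_rdistrib inner_diff_right right_diff_distrib)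
  also have "\<bar>\<dots>\<bar> \<le> (\<Sum>p\<in>UNIV. \<Sum>q\<in>UNIV. norm (\<rho> p q - \<rho>' p q)) / 2 * gram_det u v"
  proof (rule sec_num_bound)
    show "\<rho> p q - \<rho>' p q = - (\<rho> q p - \<rho>' q p)" for p q
      by (subst assms(1), subst assms(3)) simp
  qed (simp add: assms(2,4))
  also have "\<dots> \<le> d * gram_det u v"
    using close G by (intro mult_right_mono) auto
  finally show ?thesis .
qed

text \<open>
  With the complex structure \<open>J = sd (axis 1 1)\<close>, this is
  \<open>(1 - (5/2) s \<bar>x\<bar>\<^sup>2) + s (J x)(J x)\<^sup>T\<close>. At the origin it has the curvature tensor for which the
  inequalities of \<open>pinched_positive\<close> are equalities, with the sign \<open>s\<close>. In normal coordinates the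
  second-order part of such a metric is \<open>- (s/3) (5 \<bar>x\<bar>\<^sup>2 - 5 x x\<^sup>T - 3 (J x)(J x)\<^sup>T)\<close>; the substitution of
  \<open>(1 - (5/12) s \<bar>x\<bar>\<^sup>2) x\<close> for \<open>x\<close> affects neither the curvature at the origin nor the first-order part,
  and it adds \<open>- (5/6) s (\<bar>x\<bar>\<^sup>2 + 2 x x\<^sup>T)\<close> to the second-order part.
\<close>

definition extremal_metric :: "real \<Rightarrow> real^4 \<Rightarrow> real^4^4" where
  "extremal_metric s x = (\<chi> a b. mat 1 $ a $ b * (1 - 5/2 * s * (x \<bullet> x))
     + s * ((sd (axis 1 1) *v x) $ a * (sd (axis 1 1) *v x) $ b))"

lemma extremal_metric_0: "extremal_metric s 0 = mat 1"
  by (simp add: extremal_metric_def vec_eq_iff)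

lemma smooth_extremal_metric: 
  assumes U: "open U" shows "smooth_on U (extremal_metric s)"
proof -
  have J: "smooth_on U (\<lambda>x. (sd (axis 1 1) *v x) $ a)" for a
    by (intro smooth_on_nth smooth_on_matrix_vector_mult smooth_on_const smooth_on_id U)
  have 1: "smooth_on U (\<lambda>x::real^4. mat 1 $ a $ b * (1 - 5/2 * s * (x \<bullet> x)))" for a b :: 4
    by (intro smooth_on_mult[where f = "\<lambda>x. mat 1 $ a $ b"] smooth_on_diff smooth_on_mult[where f = "\<lambda>x. 5/2 * s"] smooth_on_inner
        smooth_on_const smooth_on_id U)
  have 2: "smooth_on U (\<lambda>x. s * ((sd (axis 1 1) *v x) $ a * (sd (axis 1 1) *v x) $ b))" for a b
    by (intro smooth_on_mult[where f = "\<lambda>x. s"] smooth_on_mult[OF U J J] smooth_on_const U)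
  show ?thesis unfolding extremal_metric_def[abs_def]
    by (intro smooth_on_vec_lambda smooth_on_add 1 2 U)
qed

lemma sd_axis_isometry: "(sd (axis i 1) *v x) \<bullet> (sd (axis i 1) *v y) = x \<bullet> y"
proof -
  have sk: "transpose (sd (axis i 1)) = - sd (axis i 1)" using two_form_sd unfolding two_form_def .
  have "(sd (axis i 1) *v x) \<bullet> (sd (axis i 1) *v y) = x \<bullet> ((transpose (sd (axis i 1)) ** sd (axis i 1)) *v y)"
    unfolding inner_transpose_mult[symmetric] by (simp add: matrix_vector_mul_assoc)
  also have "transpose (sd (axis i 1)) ** sd (axis i 1) = mat 1"
    unfolding sk by (simp add: sd_mult inner_axis_axis cross_refl linear_0[OF linear_sd])
  finally show ?thesis by simp
qed

lemma pos_def_extremal_metric: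
  assumes s: "\<bar>s\<bar> = 1" and x: "norm x < 1/2"
  shows "pos_def_matrix (extremal_metric s x)"
proof -
  let ?J = "sd (axis 1 1) *v x"
  have "v \<bullet> (extremal_metric s x *v v) > 0" if v: "v \<noteq> 0" for v
  proof -
    have "extremal_metric s x *v v = (1 - 5/2 * s * (x \<bullet> x)) *\<^sub>R v + (s * (?J \<bullet> v)) *\<^sub>R ?J"
    proof -
      have "(extremal_metric s x *v v) $ a = (\<Sum>b\<in>UNIV. mat 1 $ a $ b * (1 - 5/2 * s * (x \<bullet> x)) * v $ b)
          + (\<Sum>b\<in>UNIV. s * (?J $ a * ?J $ b) * v $ b)" for a
        by (simp add: extremal_metric_def matrix_vector_mult_def[of "\<chi> a b. _ a b"] distrib_right sum.distrib)
      moreover have "(\<Sum>b\<in>UNIV. s * (?J $ a * ?J $ b) * v $ b) = (s * (?J \<bullet> v)) * ?J $ a" for a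
        by (simp add: inner_vec_def sum_distrib_left sum_distrib_right algebra_simps)
      moreover have "(\<Sum>b\<in>UNIV. mat 1 $ a $ b * (1 - 5/2 * s * (x \<bullet> x)) * v $ b) = (1 - 5/2 * s * (x \<bullet> x)) * v $ a" for a :: 4
        by (simp add: mat_def if_distrib[of "\<lambda>t. t * _"] cong: if_cong)
      ultimately show ?thesis by (simp add: vec_eq_iff)
    qed
    then have "v \<bullet> (extremal_metric s x *v v) = (1 - 5/2 * s * (x \<bullet> x)) * (v \<bullet> v) + s * (?J \<bullet> v)\<^sup>2"
      by (simp add: inner_add_right power2_eq_square inner_commute)
    moreover have "(?J \<bullet> v)\<^sup>2 \<le> (x \<bullet> x) * (v \<bullet> v)"
      using Cauchy_Schwarz_ineq[of ?J v] by (simp add: sd_axis_isometry)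
    moreover have "- (?J \<bullet> v)\<^sup>2 \<le> s * (?J \<bullet> v)\<^sup>2"
      using mult_right_mono[of "-1" s "(?J \<bullet> v)\<^sup>2"] s by simp
    moreover have "(1 - 5/2 * (x \<bullet> x)) * (v \<bullet> v) \<le> (1 - 5/2 * s * (x \<bullet> x)) * (v \<bullet> v)"
      using s mult_right_mono[of s 1 "x \<bullet> x"] by (intro mult_right_mono) auto
    moreover have "(1 - 7/2 * (x \<bullet> x)) * (v \<bullet> v) > 0"
    proof (intro mult_pos_pos)
      have "norm x * norm x < 1/2 * (1/2)" using x by (intro mult_strict_mono') auto
      then show "1 - 7/2 * (x \<bullet> x) > 0" by (simp add: power2_norm_eq_inner[symmetric] power2_eq_square)
    qed (use v in simp)
    ultimately show ?thesis by (simp add: algebra_simps)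
  qed
  moreover have "transpose (extremal_metric s x) = extremal_metric s x"
    by (simp add: extremal_metric_def transpose_def vec_eq_iff mat_def)
  ultimately show ?thesis by (simp add: pos_def_matrix_def)
qed

lemma pd_extremal_metric:
  "pd k (extremal_metric s) y $ a $ b = - 5 * s * mat 1 $ a $ b * y $ k
     + s * (sd (axis 1 1) $ a $ k * (sd (axis 1 1) *v y) $ b + (sd (axis 1 1) *v y) $ a * sd (axis 1 1) $ b $ k)"
proof -
  let ?J = "sd (axis 1 1)"
  have J: "((\<lambda>y. (?J *v y) $ a) has_derivative (\<lambda>h. (?J *v h) $ a)) (at y)" for a
    by (intro bounded_linear.has_derivative[OF bounded_linear_compose[OF bounded_linear_vec_nth
          bounded_bilinear.bounded_linear_right[OF bounded_bilinear_matrix_vector_mult]]] has_derivative_ident)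
  have "((\<lambda>y. mat 1 $ a $ b * (1 - 5/2 * s * (y \<bullet> y)) + s * ((?J *v y) $ a * (?J *v y) $ b)) has_derivative
    (\<lambda>h. mat 1 $ a $ b * (0 - 5/2 * s * (y \<bullet> h + h \<bullet> y)) + s * ((?J *v y) $ a * (?J *v h) $ b + (?J *v h) $ a * (?J *v y) $ b))) (at y)"
    by (intro has_derivative_add has_derivative_mult_right has_derivative_diff has_derivative_const
        has_derivative_inner has_derivative_ident has_derivative_mult J)
  then have "pd k (\<lambda>y. extremal_metric s y $ a $ b) y = mat 1 $ a $ b * (- 5 * s * y $ k)
    + s * ((?J *v y) $ a * ?J $ b $ k + ?J $ a $ k * (?J *v y) $ b)"
    by (simp add: pd_def extremal_metric_def frechet_derivative_eqI inner_axis inner_axis' matrix_vector_mult_basis column_def)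
  moreover have "pd k (\<lambda>y. extremal_metric s y $ a $ b) y = pd k (extremal_metric s) y $ a $ b"
    by (rule pd_nth2[OF smooth_extremal_metric[of UNIV]]) simp_all
  ultimately show ?thesis by (simp add: algebra_simps)
qed

lemma pd_pd_extremal_metric:
  "pd j (\<lambda>y. pd k (extremal_metric s) y $ a $ b) y = - 5 * s * mat 1 $ a $ b * mat 1 $ j $ k
     + s * (sd (axis 1 1) $ a $ k * sd (axis 1 1) $ b $ j + sd (axis 1 1) $ a $ j * sd (axis 1 1) $ b $ k)"
proof -
  let ?J = "sd (axis 1 1)"
  have J: "((\<lambda>y. (?J *v y) $ a) has_derivative (\<lambda>h. (?J *v h) $ a)) (at y)" for a
    by (intro bounded_linear.has_derivative[OF bounded_linear_compose[OF bounded_linear_vec_nth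
          bounded_bilinear.bounded_linear_right[OF bounded_bilinear_matrix_vector_mult]]] has_derivative_ident)
  have N: "((\<lambda>y. y $ k) has_derivative (\<lambda>h. h $ k)) (at y)"
    by (intro bounded_linear.has_derivative[OF bounded_linear_vec_nth] has_derivative_ident)
  have "((\<lambda>y. - 5 * s * mat 1 $ a $ b * y $ k + s * (?J $ a $ k * (?J *v y) $ b + (?J *v y) $ a * ?J $ b $ k)) has_derivative
    (\<lambda>h. - 5 * s * mat 1 $ a $ b * h $ k + s * (?J $ a $ k * (?J *v h) $ b + (?J *v h) $ a * ?J $ b $ k))) (at y)"
    by (intro has_derivative_add has_derivative_mult_right has_derivative_mult_left J N)
  then show ?thesis
    by (simp add: pd_extremal_metric pd_def[of j] frechet_derivative_eqI matrix_vector_mult_basis column_def)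
       (simp add: mat_def axis_def)
qed

text \<open>
  The first derivatives of the metric vanish at the origin, so the curvature is the antisymmetrised second
  derivative of the metric.
\<close>

lemma curvature_extremal_metric:
  assumes s: "\<bar>s\<bar> = 1"
  shows "curvature (levi_civita (extremal_metric s)) 0 i j $ l $ k =
    s * (5 * (mat 1 $ i $ l * mat 1 $ j $ k - mat 1 $ i $ k * mat 1 $ j $ l)
      + 2 * sd (axis 1 1) $ i $ j * sd (axis 1 1) $ k $ l
      + sd (axis 1 1) $ i $ k * sd (axis 1 1) $ j $ l - sd (axis 1 1) $ i $ l * sd (axis 1 1) $ j $ k)"
proof -
  let ?g = "extremal_metric s" and ?U = "ball 0 (1/2) :: (real^4) set" and ?J = "sd (axis 1 1)"
  have U: "open ?U" and 0: "0 \<in> ?U" by simp_all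
  have g: "smooth_on ?U ?g" by (rule smooth_extremal_metric) simp
  have posdef: "pos_def_matrix (?g y)" if "y \<in> ?U" for y
    using that s by (intro pos_def_extremal_metric) simp_all
  have smG: "smooth_on ?U (levi_civita ?g i)" for i
    by (rule smooth_on_levi_civita[OF U g posdef])
  have low: "(?g y ** levi_civita ?g i y) $ m $ k = (pd i ?g y $ k $ m + pd k ?g y $ i $ m - pd m ?g y $ i $ k) / 2"
    if "y \<in> ?U" for y i m k
    by (rule levi_civita_lowered[OF U g _ that]) (rule posdef)
  have G0: "levi_civita ?g i 0 = 0" for i
    using low[OF 0, of i] by (simp add: vec_eq_iff extremal_metric_0 pd_extremal_metric)
  have smd: "smooth_on ?U (\<lambda>y. pd k ?g y $ a $ b)" for k a b
    by (intro smooth_on_nth smooth_on_pd U g)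
  have dG: "pd j (levi_civita ?g i) 0 $ m $ k = (pd j (\<lambda>y. pd i ?g y $ k $ m) 0
      + pd j (\<lambda>y. pd k ?g y $ i $ m) 0 - pd j (\<lambda>y. pd m ?g y $ i $ k) 0) / 2" for i j m k
  proof -
    have "pd j (\<lambda>y. ?g y ** levi_civita ?g i y) 0 = pd j ?g 0 ** levi_civita ?g i 0 + ?g 0 ** pd j (levi_civita ?g i) 0"
      by (rule pd_matrix_mult[OF g smG 0])
    then have "pd j (levi_civita ?g i) 0 $ m $ k = pd j (\<lambda>y. (?g y ** levi_civita ?g i y)) 0 $ m $ k"
      by (simp add: G0 extremal_metric_0)
    also have "\<dots> = pd j (\<lambda>y. (?g y ** levi_civita ?g i y) $ m $ k) 0"
      by (rule pd_nth2[symmetric, OF smooth_on_matrix_mult[OF U g smG] 0])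
    also have "\<dots> = pd j (\<lambda>y. (1/2) * ((pd i ?g y $ k $ m + pd k ?g y $ i $ m) + - pd m ?g y $ i $ k)) 0"
      using U 0 by (rule pd_cong) (simp add: low)
    also have "\<dots> = (1/2) * pd j (\<lambda>y. (pd i ?g y $ k $ m + pd k ?g y $ i $ m) + - pd m ?g y $ i $ k) 0"
      by (rule pd_linear[OF bounded_linear_mult_right _ 0, of _ _ "1/2"])
         (intro smooth_on_add smooth_on_minus smd U)
    also have "pd j (\<lambda>y. (pd i ?g y $ k $ m + pd k ?g y $ i $ m) + - pd m ?g y $ i $ k) 0
      = pd j (\<lambda>y. pd i ?g y $ k $ m + pd k ?g y $ i $ m) 0 + pd j (\<lambda>y. - pd m ?g y $ i $ k) 0"
      by (rule pd_add[OF _ _ 0]) (intro smooth_on_add smooth_on_minus smd U)+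
    also have "pd j (\<lambda>y. pd i ?g y $ k $ m + pd k ?g y $ i $ m) 0
      = pd j (\<lambda>y. pd i ?g y $ k $ m) 0 + pd j (\<lambda>y. pd k ?g y $ i $ m) 0"
      by (rule pd_add[OF smd smd 0])
    also have "pd j (\<lambda>y. - pd m ?g y $ i $ k) 0 = - pd j (\<lambda>y. pd m ?g y $ i $ k) 0"
      by (rule pd_linear[OF bounded_linear_minus[OF bounded_linear_ident] smd 0])
    finally show ?thesis by simp
  qed
  have m: "mat 1 $ b $ a = (mat 1 $ a $ b :: real)" for a b :: 4 by (simp add: mat_def)
  have J: "?J $ b $ a = - ?J $ a $ b" for a b by (rule two_form_components(2)[OF two_form_sd])
  show ?thesis
    unfolding curvature_def bracket_def G0 vector_add_component vector_minus_component dG pd_pd_extremal_metric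
    by (simp add: m[of j i] m[of k i] m[of l i] m[of k j] m[of l j] m[of l k]
        J[of j i] J[of k i] J[of l i] J[of k j] J[of l j] J[of l k] field_simps)
qed

text \<open>
  For orthonormal \<open>u\<close>, \<open>v\<close> the sectional curvature is \<open>s (5 - 3 cos\<^sup>2 \<theta>)\<close>, where \<open>\<theta>\<close> is the angle
  between \<open>u\<close> and \<open>J v\<close>; so its absolute value ranges from 2 to 5.
\<close>

lemma sec_num_extremal:
  assumes s: "\<bar>s\<bar> = 1"
  shows "sec_num (lowered_curvature (extremal_metric s) 0) u v
    = s * (5 * gram_det u v - 3 * (u \<bullet> (sd (axis 1 1) *v v))\<^sup>2)"
proof -
  let ?J = "sd (axis 1 1)" and ?C = "curvature (levi_civita (extremal_metric s)) 0"
  define t where "t = u \<bullet> (?J *v v)"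
  have Jv: "v \<bullet> (?J *v u) = - t" "u \<bullet> (?J *v u) = 0"
    using inner_skew[of ?J v u] inner_skew[of ?J u u] two_form_sd[of "axis 1 1"] by (simp_all add: two_form_def t_def)
  have "(\<Sum>i\<in>UNIV. \<Sum>j\<in>UNIV. u $ i * v $ j * ?C i j $ l $ k)
     = s * (5 * (u $ l * v $ k - u $ k * v $ l) + (- 2 * t) * ?J $ l $ k + (?J *v u) $ k * (?J *v v) $ l
        - (?J *v u) $ l * (?J *v v) $ k)" for l k
    using exhaust_4[of k] exhaust_4[of l]
    by (auto simp: curvature_extremal_metric[OF s] t_def inner_vec_def matrix_vector_mult_def sum_4 mat_def sd_def axis_def algebra_simps)
  then have "(\<Sum>i\<in>UNIV. \<Sum>j\<in>UNIV. (u $ i * v $ j) *\<^sub>R ?C i j)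
     = s *\<^sub>R (5 *\<^sub>R bivector u v + (- 2 * t) *\<^sub>R ?J - bivector (?J *v u) (?J *v v))"
    by (simp add: vec_eq_iff bivector_def algebra_simps)
  then have "sec_num (lowered_curvature (extremal_metric s) 0) u v
     = u \<bullet> ((s *\<^sub>R (5 *\<^sub>R bivector u v + (- 2 * t) *\<^sub>R ?J - bivector (?J *v u) (?J *v v))) *v v)"
    by (simp add: sec_num_def lowered_curvature_def extremal_metric_0 matrix_vector_mult_sum_left[symmetric]
        scaleR_matrix_vector[symmetric] inner_sum_right[symmetric] inner_scaleR_right[symmetric])
  also have "\<dots> = s * (5 * gram_det u v - 3 * t\<^sup>2)"
    by (simp add: scaleR_matrix_vector matrix_vector_mult_add_rdistrib matrix_vector_mult_diff_rdistrib bivector_mult_vector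
        inner_add_right inner_diff_right gram_det_def t_def[symmetric] Jv inner_commute power2_eq_square algebra_simps)
  finally show ?thesis by (simp add: t_def)
qed

text \<open>
  The difference of the two sides is the square of the modulus of the complex determinant of \<open>u\<close>
  and \<open>v\<close>, regarded as vectors in \<open>\<complex>\<^sup>2\<close>.
\<close>

lemma kaehler_angle_bound: "(u \<bullet> (sd (axis 1 1) *v v))\<^sup>2 \<le> gram_det u v"
proof -
  have "gram_det u v - (u \<bullet> (sd (axis 1 1) *v v))\<^sup>2
    = (u$1 * v$3 - u$2 * v$4 - u$3 * v$1 + u$4 * v$2)\<^sup>2 + (u$1 * v$4 + u$2 * v$3 - u$3 * v$2 - u$4 * v$1)\<^sup>2"
    by (simp add: gram_det_def inner_vec_def sum_4 matrix_vector_mult_def sd_def axis_def power2_eq_square algebra_simps)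
  then show ?thesis by (smt (verit) zero_le_power2)
qed

text \<open>
  At the origin the constant is \<open>2/5\<close>. If the tensors of numerator and denominator are within \<open>2 d\<close> of
  their values at the origin, then numerator and denominator are within \<open>d\<close> times the area squared of
  theirs, uniformly in the plane, so the pinching constant is at least
  \<open>((2 - d) / (1 + d)) / ((5 + d) / (1 - d))\<close>.
\<close>

lemma extremal_metric_pinched:
  assumes s: "\<bar>s\<bar> = 1" and K: "K < 2/5"
  obtains r where "0 < r" "r \<le> 1/2"
    "\<And>x k. x \<in> ball 0 r \<Longrightarrow> k \<in> sectional_curvatures (extremal_metric s) x \<Longrightarrow> s * k > 0"
    "\<And>x. x \<in> ball 0 r \<Longrightarrow> Inf (abs ` sectional_curvatures (extremal_metric s) x)
       / Sup (abs ` sectional_curvatures (extremal_metric s) x) > K"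
proof -
  let ?g = "extremal_metric s" and ?U = "ball 0 (1/2) :: (real^4) set"
  have U: "open ?U" and 0: "0 \<in> ?U" by simp_all
  have g: "smooth_on ?U ?g" by (rule smooth_extremal_metric) simp
  have posdef: "pos_def_matrix (?g y)" if "y \<in> ?U" for y
    using that s by (intro pos_def_extremal_metric) simp_all
  have smG: "smooth_on ?U (levi_civita ?g i)" for i
    by (rule smooth_on_levi_civita[OF U g posdef])
  obtain d where d: "0 < d" "d < 1" "K < ((2 - d) / (1 + d)) / ((5 + d) / (1 - d))"
  proof -
    have "((\<lambda>d::real. ((2 - d) / (1 + d)) / ((5 + d) / (1 - d))) \<longlongrightarrow> ((2 - 0) / (1 + 0)) / ((5 + 0) / (1 - 0))) (at_right 0)"
      by (intro tendsto_intros) auto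
    then have "eventually (\<lambda>d::real. K < ((2 - d) / (1 + d)) / ((5 + d) / (1 - d))) (at_right 0)"
      using K by (intro order_tendstoD(1)) auto
    moreover have "eventually (\<lambda>d::real. 0 < d \<and> d < 1) (at_right 0)"
      using eventually_at_right_real[of 0 1] by (auto elim: eventually_mono)
    ultimately have "eventually (\<lambda>d::real. 0 < d \<and> d < 1 \<and> K < ((2 - d) / (1 + d)) / ((5 + d) / (1 - d))) (at_right 0)"
      by eventually_elim auto
    then show thesis using that eventually_happens'[OF trivial_limit_at_right_real] by blast
  qed
  define f where "f x = (\<Sum>p\<in>UNIV. \<Sum>q\<in>UNIV. norm (lowered_curvature ?g x p q - lowered_curvature ?g 0 p q))" for x
  define h where "h x = (\<Sum>p\<in>UNIV. \<Sum>q\<in>UNIV. norm (unit_curvature (?g x) p q - unit_curvature (?g 0) p q))" for x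
  have sml: "smooth_on ?U (\<lambda>x. lowered_curvature ?g x p q)" for p q
    unfolding lowered_curvature_def curvature_def bracket_def
    by (intro smooth_on_matrix_mult smooth_on_add smooth_on_diff smooth_on_pd smG g U)
  have smf: "smooth_on ?U (\<lambda>x. unit_curvature (?g x) p q)" for p q
  proof -
    have "smooth_on ?U (\<lambda>x. ?g x $ a $ b)" for a b by (intro smooth_on_nth g U)
    note smooth_on_mult[OF U this this]
    then show ?thesis unfolding unit_curvature_def by (intro smooth_on_vec_lambda smooth_on_diff U)
  qed
  have "continuous_on ?U f" "continuous_on ?U h" unfolding f_def h_def
    by (intro continuous_on_sum continuous_on_norm continuous_on_diff continuous_on_const smooth_on_continuous_on sml smf)+
  then have "isCont f 0" "isCont h 0"
    using continuous_on_eq_continuous_at[OF U] 0 by blast+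
  then obtain r1 r2 where r: "r1 > 0" "r2 > 0" "\<And>x. dist x 0 < r1 \<Longrightarrow> dist (f x) (f 0) < 2 * d"
    "\<And>x. dist x 0 < r2 \<Longrightarrow> dist (h x) (h 0) < 2 * d"
    using d(1) unfolding continuous_at_eps_delta by (metis mult_pos_pos zero_less_numeral)
  define r where "r = min (1/2) (min r1 r2)"
  define lo hi where "lo = (2 - d) / (1 + d)" and "hi = (5 + d) / (1 - d)"
  have lohi: "0 < lo" "0 < hi" "K < lo / hi" using d by (simp_all add: lo_def hi_def)
  have bounds: "lo \<le> s * k \<and> s * k \<le> hi" if x: "x \<in> ball 0 r" and k: "k \<in> sectional_curvatures ?g x" for x k
  proof -
    have xU: "x \<in> ?U" using x by (simp add: r_def)
    obtain u v where k: "k = sectional ?g x u v" and uv: "u \<noteq> v" "independent {u, v}"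
      using k unfolding sectional_curvatures_def by blast
    define G where "G = gram_det u v"
    have G: "G > 0" unfolding G_def by (rule gram_det_pos[OF uv])
    have sym: "transpose (?g y) = ?g y" if "y \<in> ?U" for y
      using posdef[OF that] by (simp add: pos_def_matrix_def)
    define N where "N y = sec_num (lowered_curvature ?g y) u v" for y
    define D where "D y = sec_num (unit_curvature (?g y)) u v" for y
    have fl: "unit_curvature h p q = - unit_curvature h q p" "transpose (unit_curvature h p q) = - unit_curvature h p q" for h p q
      by (simp_all add: unit_curvature_def vec_eq_iff transpose_def)
    have lw: "lowered_curvature ?g y p q = - lowered_curvature ?g y q p" for y p q
      unfolding lowered_curvature_def by (subst curvature_skew) simp
    have lw': "transpose (lowered_curvature ?g y p q) = - lowered_curvature ?g y p q" if y: "y \<in> ?U" for y p q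
    proof -
      have "transpose (curvature (levi_civita ?g) y p q) ** ?g y + ?g y ** curvature (levi_civita ?g) y p q = 0"
        by (rule levi_civita_curvature_skew[OF U g _ y]) (rule posdef)
      then show ?thesis
        by (simp add: lowered_curvature_def matrix_transpose_mul sym[OF y] eq_neg_iff_add_eq_0)
    qed
    have "\<bar>N x - N 0\<bar> \<le> d * G"
      unfolding N_def G_def
    proof (rule sec_num_diff_bound[OF lw lw'[OF xU] lw lw'[OF 0]])
      show "(\<Sum>p\<in>UNIV. \<Sum>q\<in>UNIV. norm (lowered_curvature ?g x p q - lowered_curvature ?g 0 p q)) \<le> 2 * d"
        using r(3)[of x] x by (simp add: f_def r_def dist_real_def dist_commute)
    qed (use G in \<open>simp add: G_def\<close>)
    moreover have "\<bar>D x - D 0\<bar> \<le> d * G"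
      unfolding D_def G_def
    proof (rule sec_num_diff_bound[OF fl fl])
      show "(\<Sum>p\<in>UNIV. \<Sum>q\<in>UNIV. norm (unit_curvature (?g x) p q - unit_curvature (?g 0) p q)) \<le> 2 * d"
        using r(4)[of x] x by (simp add: h_def r_def dist_real_def dist_commute)
    qed (use G in \<open>simp add: G_def\<close>)
    moreover have "D 0 = G"
      using sec_num_unit_curvature[OF sym[OF 0], of u v] by (simp add: D_def extremal_metric_0 G_def gram_det_def)
    moreover have "2 * G \<le> s * N 0" "s * N 0 \<le> 5 * G"
    proof -
      have "s * s = 1" using s by (metis abs_mult_self_eq mult_1)
      then have "s * N 0 = 5 * G - 3 * (u \<bullet> (sd (axis 1 1) *v v))\<^sup>2"
        unfolding N_def sec_num_extremal[OF s] G_def by (simp flip: mult.assoc)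
      then show "2 * G \<le> s * N 0" "s * N 0 \<le> 5 * G"
        using kaehler_angle_bound[of u v] by (simp_all add: G_def)
    qed
    moreover have "\<bar>s * N x - s * N 0\<bar> = \<bar>N x - N 0\<bar>"
      using s by (simp add: right_diff_distrib[symmetric] abs_mult)
    ultimately have *: "(2 - d) * G \<le> s * N x" "s * N x \<le> (5 + d) * G" "(1 - d) * G \<le> D x" "D x \<le> (1 + d) * G"
      by (auto simp: algebra_simps abs_le_iff)
    have D: "D x > 0" using *(3) d G by (smt (verit) mult_pos_pos)
    have "s * k = s * N x / D x"
      by (simp add: k sectional_lowered[of ?g x, OF sym[OF xU]] N_def D_def)
    moreover have "lo \<le> s * N x / D x"
    proof -
      have "lo * D x \<le> lo * ((1 + d) * G)" using *(4) lohi by (intro mult_left_mono) auto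
      also have "\<dots> = (2 - d) * G" using d by (simp add: lo_def)
      also have "\<dots> \<le> s * N x" by (rule *(1))
      finally show ?thesis using D by (simp add: pos_le_divide_eq)
    qed
    moreover have "s * N x / D x \<le> hi"
    proof -
      have "s * N x \<le> (5 + d) * G" by (rule *(2))
      also have "\<dots> = hi * ((1 - d) * G)" using d by (simp add: hi_def)
      also have "\<dots> \<le> hi * D x" using *(3) lohi by (intro mult_left_mono) auto
      finally show ?thesis using D by (simp add: pos_divide_le_eq)
    qed
    ultimately show ?thesis by simp
  qed
  show thesis
  proof
    show "0 < r" "r \<le> 1/2" using r by (simp_all add: r_def)
    show "s * k > 0" if "x \<in> ball 0 r" "k \<in> sectional_curvatures ?g x" for x k
      using bounds[OF that] lohi by linarith
    fix x :: "real^4" assume x: "x \<in> ball 0 r"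
    let ?S = "abs ` sectional_curvatures ?g x"
    have S: "lo \<le> t \<and> t \<le> hi" if tS: "t \<in> ?S" for t
    proof -
      obtain k where k: "k \<in> sectional_curvatures ?g x" "t = \<bar>k\<bar>" using tS by blast
      have "\<bar>s * k\<bar> = s * k" using bounds[OF x k(1)] lohi by simp
      then have "t = s * k" using s k(2) by (simp add: abs_mult)
      then show ?thesis using bounds[OF x k(1)] by simp
    qed
    have "axis 1 1 \<noteq> (axis 2 1 :: real^4)" by (simp add: axis_eq_axis)
    moreover have "independent {axis 1 1, axis 2 1 :: real^4}"
      by (rule independent_mono[OF independent_Basis]) (auto simp: axis_in_Basis_iff)
    ultimately have ne: "?S \<noteq> {}" unfolding sectional_curvatures_def by blast
    then obtain t where t: "t \<in> ?S" by blast
    have "bdd_above ?S" using S by (intro bdd_aboveI[of _ hi]) blast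
    then have "t \<le> Sup ?S" using t by (intro cSup_upper)
    then have "Sup ?S > 0" using S[OF t] lohi by linarith
    moreover have "Sup ?S \<le> hi" using ne S by (intro cSup_least) auto
    moreover have "lo \<le> Inf ?S" using ne S by (intro cInf_greatest) auto
    ultimately have "lo / hi \<le> Inf ?S / Sup ?S" using lohi by (intro frac_le) auto
    then show "Inf ?S / Sup ?S > K" using lohi by linarith
  qed
qed

text \<open>
  The curvature endomorphisms at the origin are orthogonal to \<open>J\<close>, which is a self-dual form. So their
  self-dual components have only two nonzero coordinates, and two two-forms span the image of the
  curvature map.
\<close>

lemma extremal_metric_not_definite:
  assumes s: "\<bar>s\<bar> = 1" and V: "open V" "0 \<in> V" "V \<subseteq> ball 0 (1/2)"
    and lc: "levi_civita_on_forms (extremal_metric s) 1 V e A"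
  shows "\<not> definite_at A 0"
proof -
  let ?g = "extremal_metric s" and ?U = "ball 0 (1/2) :: (real^4) set" and ?J = "sd (axis 1 1)"
  have U: "open ?U" and 0: "0 \<in> ?U" by simp_all
  have g: "smooth_on ?U ?g" by (rule smooth_extremal_metric) simp
  have posdef: "pos_def_matrix (?g y)" if "y \<in> ?U" for y
    using that s by (intro pos_def_extremal_metric) simp_all
  define C where "C i j = curvature (levi_civita ?g) 0 i j" for i j
  have C: "transpose (C i j) = - C i j" for i j
  proof -
    have "transpose (C i j) ** ?g 0 + ?g 0 ** C i j = 0"
      unfolding C_def by (rule levi_civita_curvature_skew[OF U g _ 0]) (rule posdef)
    then show ?thesis by (simp add: extremal_metric_0 eq_neg_iff_add_eq_0)
  qed
  have CJ: "C i j \<bullet> ?J = 0" for i j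
    using exhaust_4[of i] exhaust_4[of j]
    by (auto simp: C_def inner_vec_def curvature_extremal_metric[OF s] sum_4 sd_def axis_def mat_def)
  have "\<exists>z. e b 0 = sd z" for b
  proof -
    have "e b 0 \<in> self_dual_forms (?g 0) 1"
      using lc V(2) unfolding levi_civita_on_forms_def by blast
    then have "e b 0 \<in> self_dual_forms (transpose (mat 1) ** mat 1) 1"
      by (simp add: extremal_metric_0)
    then show ?thesis
      by (subst (asm) self_dual_forms_pullback[where E = "mat 1"]) auto
  qed
  then obtain o' where o': "\<And>b. e b 0 = sd (o' b)" by metis
  have orth: "2 * (o' a \<bullet> o' b) = (if a = b then 1 else 0)" for a b
  proof -
    have "form_inner (?g 0) (e a 0) (e b 0) = (if a = b then 1 else 0)"
      using lc V(2) unfolding levi_civita_on_forms_def by blast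
    then have "form_inner (transpose (mat 1) ** mat 1) (transpose (mat 1) ** e a 0 ** mat 1) (transpose (mat 1) ** e b 0 ** mat 1)
      = (if a = b then 1 else 0)"
      by (simp add: extremal_metric_0)
    then show ?thesis
      by (subst (asm) form_inner_pullback[where E = "mat 1"]) (simp_all add: o' inner_sd_sd)
  qed
  define r where "r i j = (\<chi> c. (C i j \<bullet> sd (axis c 1)) / 4)" for i j
  have split: "\<exists>r'. C i j = sd (r i j) + asd r'" for i j
  proof -
    obtain a b where ab: "C i j = sd a + asd b" using two_form_split C unfolding two_form_def by metis
    moreover have "r i j = a"
      by (simp add: r_def ab vec_eq_iff inner_add_left inner_sd_sd inner_asd_sd inner_axis)
    ultimately show ?thesis by blast
  qed
  have r1: "r i j $ 1 = 0" for i j by (simp add: r_def CJ)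
  have F: "curvature A 0 i j $ a $ b = 4 * (r i j \<bullet> cross3 (o' a) (o' b))" for i j a b
  proof -
    obtain r' where r': "C i j = sd (r i j) + asd r'" using split by blast
    have "(\<Sum>a\<in>UNIV. curvature A 0 i j $ a $ b *\<^sub>R e a 0)
      = - (transpose (curvature (levi_civita ?g) 0 i j) ** e b 0 + e b 0 ** curvature (levi_civita ?g) 0 i j)"
      by (rule curvature_on_forms[OF U g _ 0 lc V]) (rule posdef)
    then have "(\<Sum>a\<in>UNIV. curvature A 0 i j $ a $ b *\<^sub>R sd (o' a)) = - (sd (o' b) ** C i j - C i j ** sd (o' b))"
      using C[of i j] by (simp add: o' C_def[symmetric])
    also have "\<dots> = sd (2 *\<^sub>R cross3 (o' b) (r i j))"
      unfolding r' sd_bracket_two_form by (simp add: linear_neg[OF linear_sd] linear_scale[OF linear_sd])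
    finally have "(\<Sum>a\<in>UNIV. curvature A 0 i j $ a $ b *\<^sub>R sd (o' a)) \<bullet> sd (o' c)
      = sd (2 *\<^sub>R cross3 (o' b) (r i j)) \<bullet> sd (o' c)" for c by simp
    then have "(\<Sum>a\<in>UNIV. curvature A 0 i j $ a $ b * (4 * (o' a \<bullet> o' c))) = 8 * (cross3 (o' b) (r i j) \<bullet> o' c)" for c
      by (simp add: inner_sum_left inner_sd_sd)
    moreover have "4 * (o' a \<bullet> o' c) = (if a = c then 2 else 0)" for a c
      using orth[of a c] by (auto split: if_splits)
    ultimately have "(\<Sum>a\<in>UNIV. curvature A 0 i j $ a $ b * (if a = c then 2 else 0)) = 8 * (cross3 (o' b) (r i j) \<bullet> o' c)" for c
      by simp
    from this[of a] have "curvature A 0 i j $ a $ b = 4 * (cross3 (o' b) (r i j) \<bullet> o' a)"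
      by (simp add: if_distrib[of "\<lambda>t. _ * t"] cong: if_cong)
    moreover have "cross3 (o' b) (r i j) \<bullet> o' a = r i j \<bullet> cross3 (o' a) (o' b)"
      by (simp add: cross3_def inner_vec_def sum_3 algebra_simps)
    ultimately show ?thesis by simp
  qed
  define M where "M c = (\<chi> a b. 4 * cross3 (o' a) (o' b) $ c)" for c
  have FM: "curvature A 0 i j = r i j $ 2 *\<^sub>R M 2 + r i j $ 3 *\<^sub>R M 3" for i j
    by (simp add: vec_eq_iff F M_def inner_vec_def[of "r i j"] sum_3 r1)
  let ?B = "{(\<chi> i j. r i j $ 2), (\<chi> i j. r i j $ 3)}"
  have "curvature_image A 0 \<subseteq> span ?B"
  proof
    fix w assume "w \<in> curvature_image A 0"
    then obtain \<xi> where \<xi>: "linear \<xi>" "w = curvature_map A 0 \<xi>" by (auto simp: curvature_image_def)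
    have "w = \<xi> (M 2) *\<^sub>R (\<chi> i j. r i j $ 2) + \<xi> (M 3) *\<^sub>R (\<chi> i j. r i j $ 3)"
      by (simp add: \<xi>(2) curvature_map_def FM linear_add[OF \<xi>(1)] linear_scale[OF \<xi>(1)] vec_eq_iff mult.commute)
    then show "w \<in> span ?B" by (simp add: span_add span_scale span_base)
  qed
  then have "dim (curvature_image A 0) \<le> dim ?B" by (metis dim_span dim_subset)
  also have "\<dots> \<le> card ?B" by (rule dim_le_card') simp
  also have "\<dots> \<le> 2" by (simp add: card_insert_if)
  finally show ?thesis by (simp add: definite_at_def)
qed

definition chart_manifold :: "(real^4) set \<Rightarrow> (real^4 \<Rightarrow> real^4^4) \<Rightarrow> (real^4) riemannian_data" where
  "chart_manifold B g = \<lparr>mtopology = top_of_set B, atlas = {(B, id)}, metric_of = (\<lambda>_. g)\<rparr>"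

lemma second_countable_euclidean: "second_countable (euclidean :: 'a::second_countable_topology topology)"
proof -
  obtain B :: "'a set set" where B: "countable B" "topological_basis B" using ex_countable_basis by blast
  have "\<exists>V\<in>B. x \<in> V \<and> V \<subseteq> U" if "open U" "x \<in> U" for U x
    by (rule topological_basisE[OF B(2) that]) blast
  then show ?thesis
    unfolding second_countable_def using B topological_basis_open[OF B(2)]
    by (intro exI[of _ B]) simp
qed

lemma oriented_riemannian_chart_manifold:
  assumes B: "open B" and g: "smooth_on B g" and posdef: "\<And>y. y \<in> B \<Longrightarrow> pos_def_matrix (g y)"
  shows "oriented_riemannian_4manifold (chart_manifold B g)"
proof -
  let ?c = "(B, id :: real^4 \<Rightarrow> real^4)"
  have tr: "transition ?c ?c y = y" if "y \<in> B" for y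
    using that by (simp add: transition_def inv_into_f_f[of id B])
  have sm: "smooth_on B (transition ?c ?c)"
    using smooth_on_cong[OF B tr, of "\<lambda>y. y"] smooth_on_id[OF B] tr by (metis smooth_on_cong B)
  have jac: "jacobian (transition ?c ?c) y = mat 1" if "y \<in> B" for y
  proof -
    have "frechet_derivative (transition ?c ?c) (at y) = frechet_derivative (\<lambda>y. y) (at y)"
      by (rule frechet_derivative_cong_open(1)[OF B that tr])
    also have "\<dots> = (\<lambda>h. h)" by (rule frechet_derivative_eqI) (rule has_derivative_ident)
    finally show ?thesis by (simp add: jacobian_def matrix_id_mat_1[unfolded id_def])
  qed
  have "is_chart (top_of_set B) ?c"
    using B by (simp add: is_chart_def chart_image_def subtopology_subtopology homeomorphic_map_id)
  then have "oriented_smooth_atlas (top_of_set B) {?c}"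
    using sm jac by (simp add: oriented_smooth_atlas_def overlap_def)
  moreover have "Hausdorff_space (top_of_set B)"
    by (intro Hausdorff_space_subtopology Hausdorff_space_euclidean)
  moreover have "second_countable (top_of_set B)"
    by (intro second_countable_subtopology second_countable_euclidean)
  ultimately show ?thesis
    unfolding oriented_riemannian_4manifold_def chart_manifold_def
    using g posdef tr jac by (simp add: chart_image_def overlap_def)
qed

lemma pinching_counterexample:
  assumes s: "\<bar>s\<bar> = 1" and K: "K < 2/5"
  obtains X :: "(real^4) riemannian_data" where "oriented_riemannian_4manifold X" "pointwise_pinched K X"
    "\<And>c x k. c \<in> atlas X \<Longrightarrow> x \<in> chart_image c \<Longrightarrow> k \<in> sectional_curvatures (metric_of X c) x \<Longrightarrow> s * k > 0"
    "\<not> positive_definite_on_forms 1 X" "\<not> negative_definite_on_forms 1 X"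
proof -
  obtain r where r: "0 < r" "r \<le> 1/2"
    and sign: "\<And>x k. x \<in> ball 0 r \<Longrightarrow> k \<in> sectional_curvatures (extremal_metric s) x \<Longrightarrow> s * k > 0"
    and pinch: "\<And>x. x \<in> ball 0 r \<Longrightarrow> Inf (abs ` sectional_curvatures (extremal_metric s) x)
       / Sup (abs ` sectional_curvatures (extremal_metric s) x) > K"
    using extremal_metric_pinched[OF s K] by blast
  let ?B = "ball 0 r :: (real^4) set" and ?g = "extremal_metric s"
  define X where "X = chart_manifold ?B ?g"
  have X: "atlas X = {(?B, id)}" "metric_of X c = ?g" "chart_image (?B, id) = ?B" for c
    by (simp_all add: X_def chart_manifold_def chart_image_def)
  have "oriented_riemannian_4manifold X"
    unfolding X_def
  proof (rule oriented_riemannian_chart_manifold)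
    show "pos_def_matrix (?g y)" if "y \<in> ?B" for y
      using that r s by (intro pos_def_extremal_metric) simp_all
  qed (simp_all add: smooth_extremal_metric)
  moreover have "pointwise_pinched K X"
    using pinch by (simp add: pointwise_pinched_def X Let_def)
  moreover have "s * k > 0" if "c \<in> atlas X" "x \<in> chart_image c" "k \<in> sectional_curvatures (metric_of X c) x" for c x k
    using that sign by (auto simp: X)
  moreover have not_def: "\<not> definite_at A 0"
    if "open V" "0 \<in> V" "V \<subseteq> ?B" "levi_civita_on_forms ?g 1 V e A" for V e A
    by (rule extremal_metric_not_definite[OF s that(1,2) _ that(4)]) (use that(3) r in auto)
  have "\<not> positive_definite_on_forms 1 X" "\<not> negative_definite_on_forms 1 X"
    unfolding positive_definite_on_forms_def negative_definite_on_forms_def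
      positive_definite_at_def negative_definite_at_def
    using not_def r(1) by (auto simp: X intro!: bexI[of _ 0])
  ultimately show thesis using that by blast
qed

lemma definite_on_forms_if_pinched:
  fixes X :: "'a riemannian_data"
  assumes X: "oriented_riemannian_4manifold X" and pinch: "pointwise_pinched (2/5) X" and \<sigma>: "\<sigma> \<in> {1, -1}"
  shows "positive_sectional X \<Longrightarrow> positive_definite_on_forms \<sigma> X"
    and "negative_sectional X \<Longrightarrow> negative_definite_on_forms \<sigma> X"
proof -
  have main: "\<exists>V e A. open V \<and> x \<in> V \<and> V \<subseteq> chart_image c \<and> levi_civita_on_forms (metric_of X c) \<sigma> V e A \<and>
    definite_at A x \<and> (\<exists>M. curvature_matrix A x M \<and> s * det M > 0)"
    if c: "c \<in> atlas X" and x: "x \<in> chart_image c" and s: "s \<in> {1, -1 :: real}"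
      and sign: "\<And>k. k \<in> sectional_curvatures (metric_of X c) x \<Longrightarrow> s * k > 0" for c x s
  proof (rule definite_if_pinched[OF _ _ _ x \<sigma> s sign])
    show "open (chart_image c)"
      using X c unfolding oriented_riemannian_4manifold_def oriented_smooth_atlas_def is_chart_def by blast
    show "smooth_on (chart_image c) (metric_of X c)"
      using X c unfolding oriented_riemannian_4manifold_def by blast
    show "pos_def_matrix (metric_of X c y)" if "y \<in> chart_image c" for y
      using X c that unfolding oriented_riemannian_4manifold_def by blast
    show "Inf (abs ` sectional_curvatures (metric_of X c) x) / Sup (abs ` sectional_curvatures (metric_of X c) x) > 2/5"
      using pinch c x unfolding pointwise_pinched_def Let_def by blast
  qed
  show "positive_definite_on_forms \<sigma> X" if "positive_sectional X"
  proof -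
    have "\<And>c x k. c \<in> atlas X \<Longrightarrow> x \<in> chart_image c \<Longrightarrow> k \<in> sectional_curvatures (metric_of X c) x \<Longrightarrow> 1 * k > 0"
      using that unfolding positive_sectional_def by simp
    then show ?thesis
      using main[of _ _ 1] unfolding positive_definite_on_forms_def positive_definite_at_def by simp
  qed
  show "negative_definite_on_forms \<sigma> X" if "negative_sectional X"
  proof -
    have "\<And>c x k. c \<in> atlas X \<Longrightarrow> x \<in> chart_image c \<Longrightarrow> k \<in> sectional_curvatures (metric_of X c) x \<Longrightarrow> (-1) * k > 0"
      using that unfolding negative_sectional_def by simp
    then show ?thesis
      using main[of _ _ "-1"] unfolding negative_definite_on_forms_def negative_definite_at_def by simp
  qed
qed

theorem theorem3p7:
  shows "(\<forall>X :: 'a riemannian_data. oriented_riemannian_4manifold X \<and>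
            positive_sectional X \<and> pointwise_pinched (2/5) X \<longrightarrow>
            positive_definite_on_forms 1 X \<and> positive_definite_on_forms (-1) X)
       \<and> (\<forall>X :: 'a riemannian_data. oriented_riemannian_4manifold X \<and>
            negative_sectional X \<and> pointwise_pinched (2/5) X \<longrightarrow>
            negative_definite_on_forms 1 X \<and> negative_definite_on_forms (-1) X)
       \<and> (\<forall>K < 2/5. \<not> (\<forall>X :: (real^4) riemannian_data. oriented_riemannian_4manifold X \<and>
            positive_sectional X \<and> pointwise_pinched K X \<longrightarrow>
            positive_definite_on_forms 1 X \<and> positive_definite_on_forms (-1) X))
       \<and> (\<forall>K < 2/5. \<not> (\<forall>X :: (real^4) riemannian_data. oriented_riemannian_4manifold X \<and>
            negative_sectional X \<and> pointwise_pinched K X \<longrightarrow>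
            negative_definite_on_forms 1 X \<and> negative_definite_on_forms (-1) X))"
proof (intro conjI allI impI)
  fix X :: "'a riemannian_data"
  assume "oriented_riemannian_4manifold X \<and> positive_sectional X \<and> pointwise_pinched (2/5) X"
  then show "positive_definite_on_forms 1 X" "positive_definite_on_forms (-1) X"
    by (auto intro: definite_on_forms_if_pinched(1))
next
  fix X :: "'a riemannian_data"
  assume "oriented_riemannian_4manifold X \<and> negative_sectional X \<and> pointwise_pinched (2/5) X"
  then show "negative_definite_on_forms 1 X" "negative_definite_on_forms (-1) X"
    by (auto intro: definite_on_forms_if_pinched(2))
next
  fix K :: real assume K: "K < 2/5"
  obtain X :: "(real^4) riemannian_data" where X: "oriented_riemannian_4manifold X" "pointwise_pinched K X"
    "\<And>c x k. c \<in> atlas X \<Longrightarrow> x \<in> chart_image c \<Longrightarrow> k \<in> sectional_curvatures (metric_of X c) x \<Longrightarrow> 1 * k > 0"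
    "\<not> positive_definite_on_forms 1 X"
    using pinching_counterexample[of 1, OF _ K] by (metis abs_one)
  then have "positive_sectional X" by (simp add: positive_sectional_def)
  then show "\<not> (\<forall>X :: (real^4) riemannian_data. oriented_riemannian_4manifold X \<and>
      positive_sectional X \<and> pointwise_pinched K X \<longrightarrow>
      positive_definite_on_forms 1 X \<and> positive_definite_on_forms (-1) X)"
    using X by blast
next
  fix K :: real assume K: "K < 2/5"
  obtain X :: "(real^4) riemannian_data" where X: "oriented_riemannian_4manifold X" "pointwise_pinched K X"
    "\<And>c x k. c \<in> atlas X \<Longrightarrow> x \<in> chart_image c \<Longrightarrow> k \<in> sectional_curvatures (metric_of X c) x \<Longrightarrow> (-1) * k > 0"
    "\<not> negative_definite_on_forms 1 X"
    using pinching_counterexample[of "-1", OF _ K] by (metis abs_minus_cancel abs_one)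
  then have "negative_sectional X" by (simp add: negative_sectional_def)
  then show "\<not> (\<forall>X :: (real^4) riemannian_data. oriented_riemannian_4manifold X \<and>
      negative_sectional X \<and> pointwise_pinched K X \<longrightarrow>
      negative_definite_on_forms 1 X \<and> negative_definite_on_forms (-1) X)"
    using X by blast
qed

end
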